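(* Let $\mathbb{E}$ be a (finitely complete) Mal'tsev category. Then for every object $X$ of $\mathbb{E}$, the fiber $\mathsf{Cat}_X\mathbb{E}=\mathsf{Grd}_X\mathbb{E}$ is an $\mathrm{Equ}$-saturating protomodular category.
   Context: A Mal'tsev category is a finitely complete category in which any internal reflexive relation is an equivalence relation. $\mathsf{Cat}_X\mathbb{E}$ is the category of internal categories in $\mathbb{E}$ with object of objects $X$ and internal functors that are the identity on $X$; $\mathsf{Grd}_X\mathbb{E}$ is its full subcategory of internal groupoids. In a Mal'tsev category every internal category is a groupoid, so that $\mathsf{Cat}_X\mathbb{E}=\mathsf{Grd}_X\mathbb{E}$. A finitely complete category is protomodular when, for the fibration of points (split epimorphisms $(f,s)$, $fs=1$, sent to their codomain), every base-change functor (pullback along a map) reflects isomorphisms. In a finitely complete category, a monomorphism $u:U\rightarrowtail X$ is saturated with respect to an internal equivalence relation $T$ on $X$ when the square formed by $u^{-1}T\to T$, $u$ and the projections $d_0$ (from $u^{-1}T$ to $U$ and from $T$ to $X$) is a pullback, where $u^{-1}T$ is the inverse image of $T$ along $u$. A finitely complete category is $\mathrm{Equ}$-saturating when, for any monomorphism $u:U\rightarrowtail X$ and any internal equivalence relation $S$ on $U$, among the internal equivalence relations $T$ on $X$ such that $u$ is saturated with respect to $T$ and $u^{-1}T\subset S$, there is a largest one. *)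

theory Defs
  imports Main
begin

section \<open>Categories\<close>

text \<open>
  Objects and arrows live in carrier sets.  \<open>g \<cdot> f\<close> is ``\<open>g\<close> after \<open>f\<close>'' and is meaningful
  only when \<open>src g = trg f\<close>.
\<close>

record ('o, 'm) cat_data =
  ob :: "'o set"
  ar :: "'m set"
  src :: "'m \<Rightarrow> 'o"
  trg :: "'m \<Rightarrow> 'o"
  idt :: "'o \<Rightarrow> 'm"
  cmp :: "'m \<Rightarrow> 'm \<Rightarrow> 'm"  (infixr "\<cdot>\<index>" 75)

definition hom :: "('o, 'm) cat_data \<Rightarrow> 'o \<Rightarrow> 'o \<Rightarrow> 'm set" where
  "hom C A B = {f \<in> ar C. src C f = A \<and> trg C f = B}"

locale category =
  fixes C :: "('o, 'm) cat_data" (structure)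
  assumes src_ob: "f \<in> ar C \<Longrightarrow> src C f \<in> ob C"
    and trg_ob: "f \<in> ar C \<Longrightarrow> trg C f \<in> ob C"
    and idt_hom: "A \<in> ob C \<Longrightarrow> idt C A \<in> hom C A A"
    and cmp_hom: "f \<in> hom C A B \<Longrightarrow> g \<in> hom C B D \<Longrightarrow> g \<cdot> f \<in> hom C A D"
    and cmp_idt_right: "f \<in> hom C A B \<Longrightarrow> f \<cdot> idt C A = f"
    and cmp_idt_left: "f \<in> hom C A B \<Longrightarrow> idt C B \<cdot> f = f"
    and cmp_assoc: "f \<in> hom C A B \<Longrightarrow> g \<in> hom C B D \<Longrightarrow> h \<in> hom C D E \<Longrightarrow>
      h \<cdot> (g \<cdot> f) = (h \<cdot> g) \<cdot> f"

definition full_subcategory :: "('o, 'm) cat_data \<Rightarrow> ('o \<Rightarrow> bool) \<Rightarrow> ('o, 'm) cat_data" where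
  "full_subcategory C P =
     C\<lparr>ob := {A \<in> ob C. P A}, ar := {f \<in> ar C. P (src C f) \<and> P (trg C f)}\<rparr>"

definition monic :: "('o, 'm) cat_data \<Rightarrow> 'm \<Rightarrow> bool" where
  "monic C u \<longleftrightarrow> u \<in> ar C \<and>
     (\<forall>Z a b. a \<in> hom C Z (src C u) \<and> b \<in> hom C Z (src C u) \<and> u \<cdot>\<^bsub>C\<^esub> a = u \<cdot>\<^bsub>C\<^esub> b \<longrightarrow> a = b)"

definition iso :: "('o, 'm) cat_data \<Rightarrow> 'm \<Rightarrow> bool" where
  "iso C f \<longleftrightarrow> f \<in> ar C \<and>
     (\<exists>g \<in> hom C (trg C f) (src C f).
        g \<cdot>\<^bsub>C\<^esub> f = idt C (src C f) \<and> f \<cdot>\<^bsub>C\<^esub> g = idt C (trg C f))"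

definition is_functor ::
    "('p, 'n) cat_data \<Rightarrow> ('o, 'm) cat_data \<Rightarrow> ('p \<Rightarrow> 'o) \<Rightarrow> ('n \<Rightarrow> 'm) \<Rightarrow> bool" where
  "is_functor J C Fo Fa \<longleftrightarrow>
     (\<forall>j \<in> ob J. Fo j \<in> ob C) \<and>
     (\<forall>a \<in> ar J. Fa a \<in> hom C (Fo (src J a)) (Fo (trg J a))) \<and>
     (\<forall>j \<in> ob J. Fa (idt J j) = idt C (Fo j)) \<and>
     (\<forall>a \<in> ar J. \<forall>b \<in> ar J. src J b = trg J a \<longrightarrow> Fa (b \<cdot>\<^bsub>J\<^esub> a) = Fa b \<cdot>\<^bsub>C\<^esub> Fa a)"

definition reflects_isos :: "('p, 'n) cat_data \<Rightarrow> ('o, 'm) cat_data \<Rightarrow> ('n \<Rightarrow> 'm) \<Rightarrow> bool" where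
  "reflects_isos D C Fa \<longleftrightarrow> (\<forall>h \<in> ar D. iso C (Fa h) \<longrightarrow> iso D h)"


section \<open>Finite limits\<close>

definition is_cone ::
    "('p, 'n) cat_data \<Rightarrow> ('o, 'm) cat_data \<Rightarrow> ('p \<Rightarrow> 'o) \<Rightarrow> ('n \<Rightarrow> 'm) \<Rightarrow> 'o \<Rightarrow> ('p \<Rightarrow> 'm) \<Rightarrow> bool" where
  "is_cone J C Fo Fa L leg \<longleftrightarrow>
     L \<in> ob C \<and> (\<forall>j \<in> ob J. leg j \<in> hom C L (Fo j)) \<and>
     (\<forall>a \<in> ar J. Fa a \<cdot>\<^bsub>C\<^esub> leg (src J a) = leg (trg J a))"

definition is_limit ::
    "('p, 'n) cat_data \<Rightarrow> ('o, 'm) cat_data \<Rightarrow> ('p \<Rightarrow> 'o) \<Rightarrow> ('n \<Rightarrow> 'm) \<Rightarrow> 'o \<Rightarrow> ('p \<Rightarrow> 'm) \<Rightarrow> bool" where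
  "is_limit J C Fo Fa L leg \<longleftrightarrow> is_cone J C Fo Fa L leg \<and>
     (\<forall>K k. is_cone J C Fo Fa K k \<longrightarrow>
        (\<exists>!h. h \<in> hom C K L \<and> (\<forall>j \<in> ob J. leg j \<cdot>\<^bsub>C\<^esub> h = k j)))"

text \<open>Every finite category is isomorphic to one whose objects and arrows are natural numbers.\<close>

locale finitely_complete_category = category +
  assumes finite_limits:
    "\<And>(J :: (nat, nat) cat_data) Fo Fa.
       category J \<Longrightarrow> finite (ob J) \<Longrightarrow> finite (ar J) \<Longrightarrow> is_functor J C Fo Fa \<Longrightarrow>
       \<exists>L leg. is_limit J C Fo Fa L leg"

definition is_pullback :: "('o, 'm) cat_data \<Rightarrow> 'm \<Rightarrow> 'm \<Rightarrow> 'm \<Rightarrow> 'm \<Rightarrow> bool" where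
  "is_pullback C f g p q \<longleftrightarrow>
     f \<in> ar C \<and> g \<in> ar C \<and> trg C f = trg C g \<and>
     p \<in> hom C (src C p) (src C f) \<and> q \<in> hom C (src C p) (src C g) \<and>
     f \<cdot>\<^bsub>C\<^esub> p = g \<cdot>\<^bsub>C\<^esub> q \<and>
     (\<forall>Z a b. a \<in> hom C Z (src C f) \<and> b \<in> hom C Z (src C g) \<and> f \<cdot>\<^bsub>C\<^esub> a = g \<cdot>\<^bsub>C\<^esub> b \<longrightarrow>
        (\<exists>!h. h \<in> hom C Z (src C p) \<and> p \<cdot>\<^bsub>C\<^esub> h = a \<and> q \<cdot>\<^bsub>C\<^esub> h = b))"

definition is_product :: "('o, 'm) cat_data \<Rightarrow> 'o \<Rightarrow> 'o \<Rightarrow> 'm \<Rightarrow> 'm \<Rightarrow> bool" where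
  "is_product C A B p q \<longleftrightarrow>
     p \<in> hom C (src C p) A \<and> q \<in> hom C (src C p) B \<and>
     (\<forall>Z a b. a \<in> hom C Z A \<and> b \<in> hom C Z B \<longrightarrow>
        (\<exists>!h. h \<in> hom C Z (src C p) \<and> p \<cdot>\<^bsub>C\<^esub> h = a \<and> q \<cdot>\<^bsub>C\<^esub> h = b))"

text \<open>
  Chosen pullbacks and products, given by their two projections (the object is the source of
  either projection), with the induced arrows into them.
\<close>

definition pb :: "('o, 'm) cat_data \<Rightarrow> 'm \<Rightarrow> 'm \<Rightarrow> 'm \<times> 'm" where
  "pb C f g = (SOME (p, q). is_pullback C f g p q)"

abbreviation pb0 where "pb0 C f g \<equiv> fst (pb C f g)"
abbreviation pb1 where "pb1 C f g \<equiv> snd (pb C f g)"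

definition pb_pair :: "('o, 'm) cat_data \<Rightarrow> 'm \<Rightarrow> 'm \<Rightarrow> 'm \<Rightarrow> 'm \<Rightarrow> 'm" where
  "pb_pair C f g a b = (THE h. h \<in> hom C (src C a) (src C (pb0 C f g)) \<and>
     pb0 C f g \<cdot>\<^bsub>C\<^esub> h = a \<and> pb1 C f g \<cdot>\<^bsub>C\<^esub> h = b)"

definition chosen_prod :: "('o, 'm) cat_data \<Rightarrow> 'o \<Rightarrow> 'o \<Rightarrow> 'm \<times> 'm" where
  "chosen_prod C A B = (SOME (p, q). is_product C A B p q)"

abbreviation pr0 where "pr0 C A B \<equiv> fst (chosen_prod C A B)"
abbreviation pr1 where "pr1 C A B \<equiv> snd (chosen_prod C A B)"

definition prod_pair :: "('o, 'm) cat_data \<Rightarrow> 'm \<Rightarrow> 'm \<Rightarrow> 'm" where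
  "prod_pair C a b = (THE h. h \<in> hom C (src C a) (src C (pr0 C (trg C a) (trg C b))) \<and>
     pr0 C (trg C a) (trg C b) \<cdot>\<^bsub>C\<^esub> h = a \<and> pr1 C (trg C a) (trg C b) \<cdot>\<^bsub>C\<^esub> h = b)"

definition prod_map :: "('o, 'm) cat_data \<Rightarrow> 'm \<Rightarrow> 'm \<Rightarrow> 'm" where
  "prod_map C u v = prod_pair C (u \<cdot>\<^bsub>C\<^esub> pr0 C (src C u) (src C v)) (v \<cdot>\<^bsub>C\<^esub> pr1 C (src C u) (src C v))"


section \<open>Internal relations\<close>

text \<open>A relation on \<open>X\<close> is a jointly monic pair of arrows \<open>(d0, d1)\<close> into \<open>X\<close>.\<close>

definition is_relation :: "('o, 'm) cat_data \<Rightarrow> 'o \<Rightarrow> 'm \<times> 'm \<Rightarrow> bool" where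
  "is_relation C X = (\<lambda>(d0, d1).
     X \<in> ob C \<and> d0 \<in> hom C (src C d0) X \<and> d1 \<in> hom C (src C d0) X \<and>
     (\<forall>Z a b. a \<in> hom C Z (src C d0) \<and> b \<in> hom C Z (src C d0) \<and>
        d0 \<cdot>\<^bsub>C\<^esub> a = d0 \<cdot>\<^bsub>C\<^esub> b \<and> d1 \<cdot>\<^bsub>C\<^esub> a = d1 \<cdot>\<^bsub>C\<^esub> b \<longrightarrow> a = b))"

definition is_reflexive :: "('o, 'm) cat_data \<Rightarrow> 'o \<Rightarrow> 'm \<times> 'm \<Rightarrow> bool" where
  "is_reflexive C X = (\<lambda>(d0, d1). is_relation C X (d0, d1) \<and>
     (\<exists>s \<in> hom C X (src C d0). d0 \<cdot>\<^bsub>C\<^esub> s = idt C X \<and> d1 \<cdot>\<^bsub>C\<^esub> s = idt C X))"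

definition is_symmetric :: "('o, 'm) cat_data \<Rightarrow> 'o \<Rightarrow> 'm \<times> 'm \<Rightarrow> bool" where
  "is_symmetric C X = (\<lambda>(d0, d1). is_relation C X (d0, d1) \<and>
     (\<exists>t \<in> hom C (src C d0) (src C d0). d0 \<cdot>\<^bsub>C\<^esub> t = d1 \<and> d1 \<cdot>\<^bsub>C\<^esub> t = d0))"

definition is_transitive :: "('o, 'm) cat_data \<Rightarrow> 'o \<Rightarrow> 'm \<times> 'm \<Rightarrow> bool" where
  "is_transitive C X = (\<lambda>(d0, d1). is_relation C X (d0, d1) \<and>
     (\<exists>t \<in> hom C (src C (pb0 C d1 d0)) (src C d0).
        d0 \<cdot>\<^bsub>C\<^esub> t = d0 \<cdot>\<^bsub>C\<^esub> pb0 C d1 d0 \<and> d1 \<cdot>\<^bsub>C\<^esub> t = d1 \<cdot>\<^bsub>C\<^esub> pb1 C d1 d0))"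

definition is_equivalence :: "('o, 'm) cat_data \<Rightarrow> 'o \<Rightarrow> 'm \<times> 'm \<Rightarrow> bool" where
  "is_equivalence C X R \<longleftrightarrow> is_reflexive C X R \<and> is_symmetric C X R \<and> is_transitive C X R"

text \<open>Inclusion as subobjects of \<open>X \<times> X\<close>.\<close>

definition rel_le :: "('o, 'm) cat_data \<Rightarrow> 'm \<times> 'm \<Rightarrow> 'm \<times> 'm \<Rightarrow> bool" where
  "rel_le C = (\<lambda>(d0, d1) (e0, e1).
     \<exists>t \<in> hom C (src C d0) (src C e0). e0 \<cdot>\<^bsub>C\<^esub> t = d0 \<and> e1 \<cdot>\<^bsub>C\<^esub> t = d1)"

text \<open>
  The inverse image of \<open>T = (d0, d1)\<close> along \<open>u : U \<rightarrow> X\<close> is the pullback of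
  \<open>(d0, d1) : T \<rightarrow> X \<times> X\<close> along \<open>u \<times> u\<close>; \<open>inv_image_map\<close> is its projection to \<open>T\<close>.
\<close>

definition inv_image_rel :: "('o, 'm) cat_data \<Rightarrow> 'm \<Rightarrow> 'm \<times> 'm \<Rightarrow> 'm \<times> 'm" where
  "inv_image_rel C u T =
     (pr0 C (src C u) (src C u) \<cdot>\<^bsub>C\<^esub> pb0 C (prod_map C u u) (prod_pair C (fst T) (snd T)),
      pr1 C (src C u) (src C u) \<cdot>\<^bsub>C\<^esub> pb0 C (prod_map C u u) (prod_pair C (fst T) (snd T)))"

definition inv_image_map :: "('o, 'm) cat_data \<Rightarrow> 'm \<Rightarrow> 'm \<times> 'm \<Rightarrow> 'm" where
  "inv_image_map C u T = pb1 C (prod_map C u u) (prod_pair C (fst T) (snd T))"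

definition saturated :: "('o, 'm) cat_data \<Rightarrow> 'm \<Rightarrow> 'm \<times> 'm \<Rightarrow> bool" where
  "saturated C u T \<longleftrightarrow>
     is_pullback C u (fst T) (fst (inv_image_rel C u T)) (inv_image_map C u T)"


section \<open>Points and base change\<close>

text \<open>
  An object of the fibre of points over \<open>Y\<close> is a pair \<open>(p, s)\<close> with \<open>p \<cdot> s = idt Y\<close>.  Arrows
  carry their source and target.
\<close>

definition is_point :: "('o, 'm) cat_data \<Rightarrow> 'o \<Rightarrow> 'm \<times> 'm \<Rightarrow> bool" where
  "is_point C Y = (\<lambda>(p, s). Y \<in> ob C \<and> p \<in> hom C (src C p) Y \<and> s \<in> hom C Y (src C p) \<and>
     p \<cdot>\<^bsub>C\<^esub> s = idt C Y)"

definition Pt :: "('o, 'm) cat_data \<Rightarrow> 'o \<Rightarrow> ('m \<times> 'm, ('m \<times> 'm) \<times> 'm \<times> ('m \<times> 'm)) cat_data" where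
  "Pt C Y = \<lparr>
     ob = {A. is_point C Y A},
     ar = {(A, h, B). is_point C Y A \<and> is_point C Y B \<and>
             h \<in> hom C (src C (fst A)) (src C (fst B)) \<and>
             fst B \<cdot>\<^bsub>C\<^esub> h = fst A \<and> h \<cdot>\<^bsub>C\<^esub> snd A = snd B},
     src = (\<lambda>(A, h, B). A),
     trg = (\<lambda>(A, h, B). B),
     idt = (\<lambda>A. (A, idt C (src C (fst A)), A)),
     cmp = (\<lambda>(A', k, B) (A, h, B'). (A, k \<cdot>\<^bsub>C\<^esub> h, B))\<rparr>"

definition base_change_ob :: "('o, 'm) cat_data \<Rightarrow> 'm \<Rightarrow> 'm \<times> 'm \<Rightarrow> 'm \<times> 'm" where
  "base_change_ob C f = (\<lambda>(p, s).
     (pb0 C f p, pb_pair C f p (idt C (src C f)) (s \<cdot>\<^bsub>C\<^esub> f)))"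

definition base_change_ar ::
    "('o, 'm) cat_data \<Rightarrow> 'm \<Rightarrow> ('m \<times> 'm) \<times> 'm \<times> ('m \<times> 'm) \<Rightarrow> ('m \<times> 'm) \<times> 'm \<times> ('m \<times> 'm)" where
  "base_change_ar C f = (\<lambda>(A, h, B).
     (base_change_ob C f A,
      pb_pair C f (fst B) (pb0 C f (fst A)) (h \<cdot>\<^bsub>C\<^esub> pb1 C f (fst A)),
      base_change_ob C f B))"


section \<open>Mal'tsev, protomodular and Equ-saturating categories\<close>

locale maltsev_category = finitely_complete_category +
  assumes reflexive_imp_equivalence: "is_reflexive C X R \<Longrightarrow> is_equivalence C X R"

locale protomodular_category = finitely_complete_category +
  assumes base_change_reflects_isos:
    "f \<in> ar C \<Longrightarrow> reflects_isos (Pt C (trg C f)) (Pt C (src C f)) (base_change_ar C f)"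

definition equ_candidate ::
    "('o, 'm) cat_data \<Rightarrow> 'm \<Rightarrow> 'm \<times> 'm \<Rightarrow> 'm \<times> 'm \<Rightarrow> bool" where
  "equ_candidate C u S T \<longleftrightarrow>
     is_equivalence C (trg C u) T \<and> saturated C u T \<and> rel_le C (inv_image_rel C u T) S"

locale equ_saturating_category = finitely_complete_category +
  assumes largest_equ_candidate:
    "monic C u \<Longrightarrow> is_equivalence C (src C u) S \<Longrightarrow>
       \<exists>T. equ_candidate C u S T \<and> (\<forall>T'. equ_candidate C u S T' \<longrightarrow> rel_le C T' T)"


section \<open>Internal categories with a fixed object of objects\<close>

text \<open>
  The object of arrows is the source of \<open>idom\<close>.  The composable pairs are the chosen pullback
  of \<open>icod\<close> along \<open>idom\<close>, so a generalized element \<open>(f, g)\<close> of it satisfies \<open>icod f = idom g\<close>,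
  and \<open>icmp\<close> sends it to ``\<open>g\<close> after \<open>f\<close>''.
\<close>

record 'm icat =
  idom :: 'm
  icod :: 'm
  iunit :: 'm
  icmp :: 'm

abbreviation arr_ob :: "('o, 'm) cat_data \<Rightarrow> 'm icat \<Rightarrow> 'o" where
  "arr_ob E A \<equiv> src E (idom A)"

abbreviation cp0 :: "('o, 'm) cat_data \<Rightarrow> 'm icat \<Rightarrow> 'm" where
  "cp0 E A \<equiv> pb0 E (icod A) (idom A)"

abbreviation cp1 :: "('o, 'm) cat_data \<Rightarrow> 'm icat \<Rightarrow> 'm" where
  "cp1 E A \<equiv> pb1 E (icod A) (idom A)"

abbreviation cpair :: "('o, 'm) cat_data \<Rightarrow> 'm icat \<Rightarrow> 'm \<Rightarrow> 'm \<Rightarrow> 'm" where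
  "cpair E A \<equiv> pb_pair E (icod A) (idom A)"

text \<open>
  In the associativity law the object of composable triples is the chosen pullback of \<open>cp1\<close>
  along \<open>cp0\<close>; its projections send \<open>(f, g, h)\<close> to \<open>(f, g)\<close> and to \<open>(g, h)\<close>.
\<close>

definition internal_category :: "('o, 'm) cat_data \<Rightarrow> 'o \<Rightarrow> 'm icat \<Rightarrow> bool" where
  "internal_category E X A \<longleftrightarrow>
     X \<in> ob E \<and>
     idom A \<in> hom E (arr_ob E A) X \<and> icod A \<in> hom E (arr_ob E A) X \<and>
     iunit A \<in> hom E X (arr_ob E A) \<and>
     icmp A \<in> hom E (src E (cp0 E A)) (arr_ob E A) \<and>
     idom A \<cdot>\<^bsub>E\<^esub> iunit A = idt E X \<and> icod A \<cdot>\<^bsub>E\<^esub> iunit A = idt E X \<and>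
     idom A \<cdot>\<^bsub>E\<^esub> icmp A = idom A \<cdot>\<^bsub>E\<^esub> cp0 E A \<and>
     icod A \<cdot>\<^bsub>E\<^esub> icmp A = icod A \<cdot>\<^bsub>E\<^esub> cp1 E A \<and>
     icmp A \<cdot>\<^bsub>E\<^esub> cpair E A (iunit A \<cdot>\<^bsub>E\<^esub> idom A) (idt E (arr_ob E A)) = idt E (arr_ob E A) \<and>
     icmp A \<cdot>\<^bsub>E\<^esub> cpair E A (idt E (arr_ob E A)) (iunit A \<cdot>\<^bsub>E\<^esub> icod A) = idt E (arr_ob E A) \<and>
     (let t0 = pb0 E (cp1 E A) (cp0 E A); t1 = pb1 E (cp1 E A) (cp0 E A) in
        icmp A \<cdot>\<^bsub>E\<^esub> cpair E A (icmp A \<cdot>\<^bsub>E\<^esub> t0) (cp1 E A \<cdot>\<^bsub>E\<^esub> t1) =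
        icmp A \<cdot>\<^bsub>E\<^esub> cpair E A (cp0 E A \<cdot>\<^bsub>E\<^esub> t0) (icmp A \<cdot>\<^bsub>E\<^esub> t1))"

definition internal_groupoid :: "('o, 'm) cat_data \<Rightarrow> 'o \<Rightarrow> 'm icat \<Rightarrow> bool" where
  "internal_groupoid E X A \<longleftrightarrow> internal_category E X A \<and>
     (\<exists>j \<in> hom E (arr_ob E A) (arr_ob E A).
        idom A \<cdot>\<^bsub>E\<^esub> j = icod A \<and> icod A \<cdot>\<^bsub>E\<^esub> j = idom A \<and>
        icmp A \<cdot>\<^bsub>E\<^esub> cpair E A (idt E (arr_ob E A)) j = iunit A \<cdot>\<^bsub>E\<^esub> idom A \<and>
        icmp A \<cdot>\<^bsub>E\<^esub> cpair E A j (idt E (arr_ob E A)) = iunit A \<cdot>\<^bsub>E\<^esub> icod A)"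

text \<open>Internal functors that are the identity on objects, given by their effect on arrows.\<close>

definition internal_functor :: "('o, 'm) cat_data \<Rightarrow> 'm icat \<Rightarrow> 'm icat \<Rightarrow> 'm \<Rightarrow> bool" where
  "internal_functor E A B F \<longleftrightarrow>
     F \<in> hom E (arr_ob E A) (arr_ob E B) \<and>
     idom B \<cdot>\<^bsub>E\<^esub> F = idom A \<and> icod B \<cdot>\<^bsub>E\<^esub> F = icod A \<and>
     F \<cdot>\<^bsub>E\<^esub> iunit A = iunit B \<and>
     F \<cdot>\<^bsub>E\<^esub> icmp A = icmp B \<cdot>\<^bsub>E\<^esub> cpair E B (F \<cdot>\<^bsub>E\<^esub> cp0 E A) (F \<cdot>\<^bsub>E\<^esub> cp1 E A)"

definition Cat :: "('o, 'm) cat_data \<Rightarrow> 'o \<Rightarrow> ('m icat, 'm icat \<times> 'm \<times> 'm icat) cat_data" where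
  "Cat E X = \<lparr>
     ob = {A. internal_category E X A},
     ar = {(A, F, B). internal_category E X A \<and> internal_category E X B \<and>
             internal_functor E A B F},
     src = (\<lambda>(A, F, B). A),
     trg = (\<lambda>(A, F, B). B),
     idt = (\<lambda>A. (A, idt E (arr_ob E A), A)),
     cmp = (\<lambda>(B', G, D) (A, F, B). (A, G \<cdot>\<^bsub>E\<^esub> F, D))\<rparr>"

definition Grd :: "('o, 'm) cat_data \<Rightarrow> 'o \<Rightarrow> ('m icat, 'm icat \<times> 'm \<times> 'm icat) cat_data" where
  "Grd E X = full_subcategory (Cat E X) (internal_groupoid E X)"

end

theory Submission
  imports Defs
begin

text \<open>
  Everything is computed on generalized elements. In a Mal'tsev category every relation between two
  objects is difunctional. Applied to the commutative triangles \<open>g f = h\<close> of an internal category this gives cancellation and then inverses, and it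
  shows that a subobject of the object of arrows that contains the identities is closed under
  composition.

  Limits in the fibre are limits over \<open>X \<times> X\<close>, so that monomorphisms, relations and pullbacks of the
  fibre are such in the base. The fibre is protomodular since an arrow \<open>c\<close> of a groupoid over \<open>B\<close> with
  section \<open>s\<close> is \<open>s (p c)\<close> followed by an arrow lying over an identity, and these latter arrows are
  preserved by any base change. For a subgroupoid \<open>u : U \<rightarrow> A\<close> and an equivalence
  relation \<open>S\<close> on \<open>U\<close>, the largest candidate relates \<open>a\<close> to \<open>b\<close> when they are parallel and \<open>b a\<^sup>-\<^sup>1\<close> is
  the image of an arrow that \<open>S\<close> relates to an identity. This is automatically a subgroupoid of \<open>A \<times> A\<close>
  because it contains the identities, and it is an equivalence relation because it is reflexive.
\<close>

section \<open>Finite limits\<close>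

text \<open>That this candidate is the largest comes from a translation. If a candidate
  \<open>V\<close> relates \<open>a\<close> to \<open>b\<close>, composing with the reflexive pair
  on the inverse of \<open>a\<close> shows that \<open>V\<close> relates an identity to
  \<open>b\<close> after the inverse of \<open>a\<close>. The identity comes from \<open>U\<close>,
  so by saturation the other arrow does too, and the inclusion of the inverse image in
  \<open>S\<close> says that its lift is related by \<open>S\<close> to an identity.

  Two obstacles shape the proof. The difference of a parallel pair is a loop at the codomain, so
  forming differences is in general not an arrow of the fibre. The largest candidate is therefore a
  pullback of \<open>E\<close> along non-functorial arrows, and its composition has to come from the
  Mal'tsev property instead of from limits in the fibre.

  Moreover \<open>pb\<close> and \<open>chosen_prod\<close> pick limits by choice, independently in
  \<open>E\<close> and in the fibre. A chosen limit of the fibre agrees with one built from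
  \<open>E\<close> only up to isomorphism, so facts pass from one to the other through universal
  properties.\<close>

lemma hom_iff [simp]: "f \<in> hom C A B \<longleftrightarrow> f \<in> ar C \<and> src C f = A \<and> trg C f = B"
  by (simp add: hom_def)

text \<open>The two arrows may have different targets, so that one notion serves for relations
  between two objects, for the projections of pullbacks and products and, with \<open>p = q\<close>,
  for a single monomorphism.\<close>

definition jointly_monic :: "('o, 'm) cat_data \<Rightarrow> 'm \<Rightarrow> 'm \<Rightarrow> bool" where
  "jointly_monic C p q \<longleftrightarrow>
     (\<forall>Z a b. a \<in> hom C Z (src C p) \<and> b \<in> hom C Z (src C p) \<and>
        p \<cdot>\<^bsub>C\<^esub> a = p \<cdot>\<^bsub>C\<^esub> b \<and> q \<cdot>\<^bsub>C\<^esub> a = q \<cdot>\<^bsub>C\<^esub> b \<longrightarrow> a = b)"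

lemma jointly_monicD:
  "jointly_monic C p q \<Longrightarrow> a \<in> ar C \<Longrightarrow> b \<in> ar C \<Longrightarrow> trg C a = src C p \<Longrightarrow> trg C b = src C p \<Longrightarrow>
    src C a = src C b \<Longrightarrow> p \<cdot>\<^bsub>C\<^esub> a = p \<cdot>\<^bsub>C\<^esub> b \<Longrightarrow> q \<cdot>\<^bsub>C\<^esub> a = q \<cdot>\<^bsub>C\<^esub> b \<Longrightarrow> a = b"
  unfolding jointly_monic_def hom_iff by blast

lemma monicD:
  "monic C u \<Longrightarrow> a \<in> ar C \<Longrightarrow> b \<in> ar C \<Longrightarrow> trg C a = src C u \<Longrightarrow> trg C b = src C u \<Longrightarrow>
    src C a = src C b \<Longrightarrow> u \<cdot>\<^bsub>C\<^esub> a = u \<cdot>\<^bsub>C\<^esub> b \<Longrightarrow> a = b"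
  unfolding monic_def hom_iff by blast

lemma is_pullback_typing:
  assumes "is_pullback C f g p q"
  shows "f \<in> ar C" "g \<in> ar C" "trg C f = trg C g" "p \<in> ar C" "q \<in> ar C" "src C q = src C p"
    "trg C p = src C f" "trg C q = src C g" "f \<cdot>\<^bsub>C\<^esub> p = g \<cdot>\<^bsub>C\<^esub> q"
  using assms unfolding is_pullback_def by auto

lemma is_pullback_ex:
  assumes "is_pullback C f g p q" "a \<in> ar C" "b \<in> ar C" "src C a = src C b"
    "trg C a = src C f" "trg C b = src C g" "f \<cdot>\<^bsub>C\<^esub> a = g \<cdot>\<^bsub>C\<^esub> b"
  obtains h where "h \<in> ar C" "src C h = src C b" "trg C h = src C p" "p \<cdot>\<^bsub>C\<^esub> h = a" "q \<cdot>\<^bsub>C\<^esub> h = b"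
  using assms unfolding is_pullback_def hom_iff by metis

text \<open>Uniqueness of the induced arrow is separated from its existence and proved once, as
  joint monicity of the projections.\<close>

lemma is_pullbackI:
  assumes "f \<in> ar C" "g \<in> ar C" "trg C f = trg C g" "p \<in> hom C P (src C f)" "q \<in> hom C P (src C g)"
    "f \<cdot>\<^bsub>C\<^esub> p = g \<cdot>\<^bsub>C\<^esub> q"
    "\<And>Z a b. a \<in> hom C Z (src C f) \<Longrightarrow> b \<in> hom C Z (src C g) \<Longrightarrow> f \<cdot>\<^bsub>C\<^esub> a = g \<cdot>\<^bsub>C\<^esub> b \<Longrightarrow>
      \<exists>h. h \<in> hom C Z P \<and> p \<cdot>\<^bsub>C\<^esub> h = a \<and> q \<cdot>\<^bsub>C\<^esub> h = b"
    "jointly_monic C p q"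
  shows "is_pullback C f g p q"
proof -
  have "\<exists>!h. h \<in> hom C Z (src C p) \<and> p \<cdot>\<^bsub>C\<^esub> h = a \<and> q \<cdot>\<^bsub>C\<^esub> h = b"
    if "a \<in> hom C Z (src C f)" "b \<in> hom C Z (src C g)" "f \<cdot>\<^bsub>C\<^esub> a = g \<cdot>\<^bsub>C\<^esub> b" for Z a b
    using assms(7)[OF that] assms(4,8) unfolding jointly_monic_def hom_iff by metis
  with assms show ?thesis unfolding is_pullback_def by auto
qed

context category
begin

declare src_ob [simp] trg_ob [simp]

lemma idt_ar [simp]: "A \<in> ob C \<Longrightarrow> idt C A \<in> ar C"
  and src_idt [simp]: "A \<in> ob C \<Longrightarrow> src C (idt C A) = A"
  and trg_idt [simp]: "A \<in> ob C \<Longrightarrow> trg C (idt C A) = A"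
  using idt_hom by auto

lemma cmp_ar [simp]: "g \<in> ar C \<Longrightarrow> f \<in> ar C \<Longrightarrow> src C g = trg C f \<Longrightarrow> g \<cdot> f \<in> ar C"
  and src_cmp [simp]: "g \<in> ar C \<Longrightarrow> f \<in> ar C \<Longrightarrow> src C g = trg C f \<Longrightarrow> src C (g \<cdot> f) = src C f"
  and trg_cmp [simp]: "g \<in> ar C \<Longrightarrow> f \<in> ar C \<Longrightarrow> src C g = trg C f \<Longrightarrow> trg C (g \<cdot> f) = trg C g"
  using cmp_hom[of f "src C f" "trg C f" g "trg C g"] by auto

lemma cmp_idt [simp]: "f \<in> ar C \<Longrightarrow> src C f = A \<Longrightarrow> f \<cdot> idt C A = f"
  and idt_cmp [simp]: "f \<in> ar C \<Longrightarrow> trg C f = A \<Longrightarrow> idt C A \<cdot> f = f"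
  using cmp_idt_right[of f "src C f" "trg C f"] cmp_idt_left[of f "src C f" "trg C f"] by auto

lemma assoc [simp]:
  "h \<in> ar C \<Longrightarrow> g \<in> ar C \<Longrightarrow> f \<in> ar C \<Longrightarrow> src C g = trg C f \<Longrightarrow> src C h = trg C g \<Longrightarrow>
    (h \<cdot> g) \<cdot> f = h \<cdot> (g \<cdot> f)"
  using cmp_assoc[of f "src C f" "trg C f" g "trg C g" h "trg C h"] by simp

lemma cmp_reassoc:
  "h \<cdot> g = k \<Longrightarrow> h \<in> ar C \<Longrightarrow> g \<in> ar C \<Longrightarrow> f \<in> ar C \<Longrightarrow> src C h = trg C g \<Longrightarrow> src C g = trg C f \<Longrightarrow>
    h \<cdot> (g \<cdot> f) = k \<cdot> f"
  using assoc by metis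

lemma is_pullback_jointly_monic:
  assumes "is_pullback C f g p q"
  shows "jointly_monic C p q"
  unfolding jointly_monic_def
proof (intro allI impI)
  fix Z a b
  assume h: "a \<in> hom C Z (src C p) \<and> b \<in> hom C Z (src C p) \<and> p \<cdot> a = p \<cdot> b \<and> q \<cdot> a = q \<cdot> b"
  note ty = is_pullback_typing[OF assms]
  have "f \<cdot> (p \<cdot> b) = g \<cdot> (q \<cdot> b)"
    using h ty(1-8) by (simp add: cmp_reassoc[OF ty(9)])
  moreover have "p \<cdot> b \<in> hom C Z (src C f)" "q \<cdot> b \<in> hom C Z (src C g)" using h ty by auto
  ultimately have "\<exists>!h. h \<in> hom C Z (src C p) \<and> p \<cdot> h = p \<cdot> b \<and> q \<cdot> h = q \<cdot> b"
    using assms unfolding is_pullback_def by blast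
  with h show "a = b" by blast
qed

lemma is_pullback_commute:
  assumes "is_pullback C f g p q" "z \<in> ar C" "trg C z = src C p"
  shows "f \<cdot> (p \<cdot> z) = g \<cdot> (q \<cdot> z)"
proof -
  note ty = is_pullback_typing[OF assms(1)]
  show ?thesis using ty(1-8) assms(2,3) by (simp add: cmp_reassoc[OF ty(9)])
qed

lemma is_product_typing:
  assumes "is_product C A B p q"
  shows "p \<in> ar C" "q \<in> ar C" "src C q = src C p" "trg C p = A" "trg C q = B"
  using assms unfolding is_product_def by auto

lemma is_product_ex:
  assumes "is_product C A B p q" "a \<in> ar C" "b \<in> ar C" "src C a = src C b" "trg C a = A" "trg C b = B"
  obtains h where "h \<in> ar C" "src C h = src C b" "trg C h = src C p" "p \<cdot> h = a" "q \<cdot> h = b"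
  using assms unfolding is_product_def hom_iff by metis

lemma is_product_jointly_monic:
  assumes "is_product C A B p q"
  shows "jointly_monic C p q"
  unfolding jointly_monic_def
proof (intro allI impI)
  fix Z a b
  assume h: "a \<in> hom C Z (src C p) \<and> b \<in> hom C Z (src C p) \<and> p \<cdot> a = p \<cdot> b \<and> q \<cdot> a = q \<cdot> b"
  note ty = is_product_typing[OF assms]
  have "p \<cdot> b \<in> hom C Z A" "q \<cdot> b \<in> hom C Z B" using h ty by auto
  then have "\<exists>!h. h \<in> hom C Z (src C p) \<and> p \<cdot> h = p \<cdot> b \<and> q \<cdot> h = q \<cdot> b"
    using assms unfolding is_product_def by blast
  with h show "a = b" by blast
qed

section \<open>Products as pullbacks over a terminal object; uniqueness of pullbacks\<close>

definition is_terminal :: "'o \<Rightarrow> bool" where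
  "is_terminal T \<longleftrightarrow> T \<in> ob C \<and> (\<forall>A \<in> ob C. \<exists>!t. t \<in> hom C A T)"

text \<open>Any two parallel arrows into a terminal object are equal, so the compatibility condition
  of the pullback always holds.\<close>

lemma is_product_iff_is_pullback:
  assumes "is_terminal T" "a \<in> hom C A T" "b \<in> hom C B T"
  shows "is_product C A B p q \<longleftrightarrow> is_pullback C a b p q"
proof -
  have eq: "a \<cdot> x = b \<cdot> y" if "x \<in> hom C Z A" "y \<in> hom C Z B" for x y Z
  proof -
    have "Z \<in> ob C" using that by auto
    then have "\<exists>!t. t \<in> hom C Z T" using assms(1) by (auto simp: is_terminal_def)
    moreover have "a \<cdot> x \<in> hom C Z T" "b \<cdot> y \<in> hom C Z T" using that assms by auto
    ultimately show ?thesis by blast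
  qed
  show ?thesis
  proof
    assume p: "is_product C A B p q"
    note ty = is_product_typing[OF p]
    show "is_pullback C a b p q"
      using p assms ty eq[of p "src C p" q] unfolding is_product_def is_pullback_def by simp
  next
    assume p: "is_pullback C a b p q"
    note ty = is_pullback_typing[OF p]
    show "is_product C A B p q"
      using p assms ty eq unfolding is_product_def is_pullback_def by (simp add: conj_commute)
  qed
qed

text \<open>The two comparison arrows are mutually inverse because each pair of projections is
  jointly monic. Together with \<open>is_pullback_transport\<close> this makes it possible to
  replace a pullback known only by choice with one given by a construction.\<close>

lemma is_pullback_iso_apex:
  assumes "is_pullback C f g p q" "is_pullback C f g p' q'"
  obtains t where "iso C t" "src C t = src C p'" "trg C t = src C p" "p \<cdot> t = p'" "q \<cdot> t = q'"
proof -
  note ty = is_pullback_typing[OF assms(1)] is_pullback_typing[OF assms(2)]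
  obtain t where t: "t \<in> ar C" "src C t = src C q'" "trg C t = src C p" "p \<cdot> t = p'" "q \<cdot> t = q'"
    using is_pullback_ex[OF assms(1), of p' q'] ty by metis
  obtain s where s: "s \<in> ar C" "src C s = src C q" "trg C s = src C p'" "p' \<cdot> s = p" "q' \<cdot> s = q"
    using is_pullback_ex[OF assms(2), of p q] ty by metis
  have o: "src C p \<in> ob C" "src C p' \<in> ob C" using ty by auto
  have "s \<cdot> t = idt C (src C p')"
    by (rule jointly_monicD[OF is_pullback_jointly_monic[OF assms(2)]])
      (use s t ty o in \<open>simp_all add: cmp_reassoc[OF s(4)] cmp_reassoc[OF s(5)]\<close>)
  moreover have "t \<cdot> s = idt C (src C p)"
    by (rule jointly_monicD[OF is_pullback_jointly_monic[OF assms(1)]])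
      (use s t ty o in \<open>simp_all add: cmp_reassoc[OF t(4)] cmp_reassoc[OF t(5)]\<close>)
  ultimately have "iso C t" unfolding iso_def using s(1-3) t(1-3) ty(6,15) by auto
  then show thesis using that[of t] t ty(15) by simp
qed

lemma is_pullback_transport:
  assumes "is_pullback C f g p q" "iso C t" "trg C t = src C p"
  shows "is_pullback C f g (p \<cdot> t) (q \<cdot> t)"
proof (rule is_pullbackI)
  note ty = is_pullback_typing[OF assms(1)]
  obtain s where t: "t \<in> ar C" and s: "s \<in> ar C" "src C s = src C p" "trg C s = src C t"
    "s \<cdot> t = idt C (src C t)" "t \<cdot> s = idt C (src C p)"
    using assms(2,3) unfolding iso_def by auto
  show "f \<in> ar C" "g \<in> ar C" "trg C f = trg C g"
    "p \<cdot> t \<in> hom C (src C t) (src C f)" "q \<cdot> t \<in> hom C (src C t) (src C g)"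
    using ty t assms(3) by auto
  show "f \<cdot> (p \<cdot> t) = g \<cdot> (q \<cdot> t)" using is_pullback_commute[OF assms(1)] t assms(3) by simp
  show "jointly_monic C (p \<cdot> t) (q \<cdot> t)"
    unfolding jointly_monic_def
  proof (intro allI impI)
    fix Z a b assume h: "a \<in> hom C Z (src C (p \<cdot> t)) \<and> b \<in> hom C Z (src C (p \<cdot> t)) \<and>
      (p \<cdot> t) \<cdot> a = (p \<cdot> t) \<cdot> b \<and> (q \<cdot> t) \<cdot> a = (q \<cdot> t) \<cdot> b"
    then have ab: "a \<in> ar C" "b \<in> ar C" "src C a = Z" "src C b = Z" "trg C a = src C t" "trg C b = src C t"
      using ty t assms(3) by auto
    have "t \<cdot> a = t \<cdot> b"
      by (rule jointly_monicD[OF is_pullback_jointly_monic[OF assms(1)]]) (use h ab ty t assms(3) in simp_all)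
    then have "s \<cdot> (t \<cdot> a) = s \<cdot> (t \<cdot> b)" by simp
    then show "a = b" using ab s t assms(3) by (simp add: cmp_reassoc[OF s(4)])
  qed
  fix Z a b assume h: "a \<in> hom C Z (src C f)" "b \<in> hom C Z (src C g)" "f \<cdot> a = g \<cdot> b"
  then obtain k where k: "k \<in> ar C" "src C k = src C b" "trg C k = src C p" "p \<cdot> k = a" "q \<cdot> k = b"
    using is_pullback_ex[OF assms(1), of a b] by auto
  show "\<exists>h. h \<in> hom C Z (src C t) \<and> (p \<cdot> t) \<cdot> h = a \<and> (q \<cdot> t) \<cdot> h = b"
    by (rule exI[of _ "s \<cdot> k"]) (use h k s t ty assms(3) in \<open>simp add: cmp_reassoc[OF s(5)]\<close>)
qed

text \<open>Binary products are pullbacks over the terminal object, and equalizers are pullbacks of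
  graphs. A limit over \<open>J\<close> is then the product of the objects of the diagram, cut down
  by one equalizer for each arrow of \<open>J\<close>.\<close>

lemma finitely_complete_categoryI:
  assumes T: "is_terminal T"
    and pbs: "\<And>f g. f \<in> ar C \<Longrightarrow> g \<in> ar C \<Longrightarrow> trg C f = trg C g \<Longrightarrow> \<exists>p q. is_pullback C f g p q"
  shows "finitely_complete_category C"
proof unfold_locales
  have prods: "\<exists>p q. is_product C A B p q" if AB: "A \<in> ob C" "B \<in> ob C" for A B
  proof -
    obtain a b where ab: "a \<in> hom C A T" "b \<in> hom C B T" using T AB unfolding is_terminal_def by blast
    then obtain p q where "is_pullback C a b p q" using pbs[of a b] by auto
    then show ?thesis using is_product_iff_is_pullback[OF T ab] by blast
  qed
  have eqs: "\<exists>e. e \<in> ar C \<and> trg C e = src C f \<and> f \<cdot> e = g \<cdot> e \<and>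
      (\<forall>k \<in> ar C. trg C k = src C f \<and> f \<cdot> k = g \<cdot> k \<longrightarrow> (\<exists>!h. h \<in> hom C (src C k) (src C e) \<and> e \<cdot> h = k))"
    if fg: "f \<in> ar C" "g \<in> ar C" "src C f = src C g" "trg C f = trg C g" for f g
  proof -
    have o: "src C f \<in> ob C" "src C g \<in> ob C" "trg C g \<in> ob C" using fg by auto
    obtain p q where pq: "is_product C (src C f) (trg C f) p q" using prods fg o by metis
    note pt = is_product_typing[OF pq]
    \<comment> \<open>\<open>u = (1, f)\<close> and \<open>v = (1, g)\<close> are the graphs. In
      their pullback the first components force the two projections to be equal, and the second
      components then say that \<open>f\<close> and \<open>g\<close> agree on it.\<close>
    obtain u where u: "u \<in> ar C" "src C u = src C f" "trg C u = src C p" "p \<cdot> u = idt C (src C f)" "q \<cdot> u = f"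
      using is_product_ex[OF pq, of "idt C (src C f)" f] fg o by auto
    obtain v where v: "v \<in> ar C" "src C v = src C f" "trg C v = src C p" "p \<cdot> v = idt C (src C f)" "q \<cdot> v = g"
      using is_product_ex[OF pq, of "idt C (src C f)" g] fg o by auto
    obtain e e' where e: "is_pullback C u v e e'" using pbs[of u v] u v by auto
    note et = is_pullback_typing[OF e]
    have "p \<cdot> (u \<cdot> e) = p \<cdot> (v \<cdot> e')" using et by simp
    then have ee: "e' = e" using et(1-8) u v pt fg
      by (simp add: cmp_reassoc[OF u(4)] cmp_reassoc[OF v(4)])
    have "q \<cdot> (u \<cdot> e) = q \<cdot> (v \<cdot> e')" using et by simp
    then have "f \<cdot> e = g \<cdot> e" using et(1-8) u v pt fg unfolding ee
      by (simp add: cmp_reassoc[OF u(5)] cmp_reassoc[OF v(5)])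
    moreover have "\<exists>!h. h \<in> hom C (src C k) (src C e) \<and> e \<cdot> h = k"
      if k: "k \<in> ar C" "trg C k = src C f" "f \<cdot> k = g \<cdot> k" for k
    proof -
      have "u \<cdot> k = v \<cdot> k"
        by (rule jointly_monicD[OF is_product_jointly_monic[OF pq]])
          (use k u v fg pt in \<open>simp_all add: cmp_reassoc[OF u(4)] cmp_reassoc[OF v(4)]
              cmp_reassoc[OF u(5)] cmp_reassoc[OF v(5)]\<close>)
      then obtain h where h: "h \<in> ar C" "src C h = src C k" "trg C h = src C e" "e \<cdot> h = k"
        using is_pullback_ex[OF e, of k k] k fg u v by auto
      show ?thesis
      proof (rule ex1I[of _ h])
        show "h \<in> hom C (src C k) (src C e) \<and> e \<cdot> h = k" using h by simp
        fix y assume "y \<in> hom C (src C k) (src C e) \<and> e \<cdot> y = k"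
        with h show "y = h"
          by - (rule jointly_monicD[OF is_pullback_jointly_monic[OF e, unfolded ee]], simp_all)
      qed
    qed
    ultimately show ?thesis using et u by (intro exI[of _ e]) auto
  qed
  fix J :: "(nat, nat) cat_data" and Fo Fa
  assume J: "category J" "finite (ob J)" "finite (ar J)" and F: "is_functor J C Fo Fa"
  have J_ob: "src J a \<in> ob J" "trg J a \<in> ob J" if "a \<in> ar J" for a
    using category.src_ob[OF J(1)] category.trg_ob[OF J(1)] that by auto
  have F_ob: "\<And>j. j \<in> ob J \<Longrightarrow> Fo j \<in> ob C"
    and F_ar: "\<And>a. a \<in> ar J \<Longrightarrow> Fa a \<in> ar C \<and> src C (Fa a) = Fo (src J a) \<and> trg C (Fa a) = Fo (trg J a)"
    using F unfolding is_functor_def by auto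
  \<comment> \<open>The product is formed over an arbitrary set \<open>S\<close> of objects of
    \<open>J\<close>, which lets an induction add one object at a time, starting from the terminal
    object.\<close>
  define is_prod where "is_prod S L leg \<longleftrightarrow> L \<in> ob C \<and> (\<forall>j \<in> S. leg j \<in> hom C L (Fo j)) \<and>
      (\<forall>K k. K \<in> ob C \<and> (\<forall>j \<in> S. k j \<in> hom C K (Fo j)) \<longrightarrow>
        (\<exists>!h. h \<in> hom C K L \<and> (\<forall>j \<in> S. leg j \<cdot> h = k j)))" for S L leg
  have is_prodD: "L \<in> ob C" "\<And>j. j \<in> S \<Longrightarrow> leg j \<in> hom C L (Fo j)"
    "\<And>K k. K \<in> ob C \<Longrightarrow> \<forall>j \<in> S. k j \<in> hom C K (Fo j) \<Longrightarrow>
        \<exists>!h. h \<in> hom C K L \<and> (\<forall>j \<in> S. leg j \<cdot> h = k j)" if "is_prod S L leg" for S L leg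
    using that unfolding is_prod_def by blast+
  have fin_prods: "\<exists>L leg. is_prod S L leg"
    if "finite S" "S \<subseteq> ob J" for S
    using that
  proof (induction S)
    case empty
    then show ?case using T unfolding is_terminal_def is_prod_def by (intro exI[of _ T]) auto
  next
    case (insert i S)
    then have "\<exists>L leg. is_prod S L leg" by simp
    then obtain L leg where IH: "is_prod S L leg" by blast
    note L = is_prodD(1,2)[OF IH] and Lu = is_prodD(3)[OF IH]
    obtain p q where pq: "is_product C (Fo i) L p q" using prods[of "Fo i" L] L(1) F_ob insert.prems by auto
    note pt = is_product_typing[OF pq]
    define leg' where "leg' j = (if j = i then p else leg j \<cdot> q)" for j
    have l': "leg' i = p" "\<And>j. j \<in> S \<Longrightarrow> leg' j = leg j \<cdot> q" using insert.hyps unfolding leg'_def by auto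
    show ?case
      unfolding is_prod_def
    proof (rule exI[of _ "src C p"], rule exI[of _ leg'], intro conjI allI impI)
      show "src C p \<in> ob C" using pt by simp
      show "\<forall>j \<in> insert i S. leg' j \<in> hom C (src C p) (Fo j)" using pt L(2) l' by auto
      fix K k assume k: "K \<in> ob C \<and> (\<forall>j \<in> insert i S. k j \<in> hom C K (Fo j))"
      then obtain h where h: "h \<in> hom C K L" "\<forall>j \<in> S. leg j \<cdot> h = k j"
        and hu: "\<And>h'. h' \<in> hom C K L \<Longrightarrow> \<forall>j \<in> S. leg j \<cdot> h' = k j \<Longrightarrow> h' = h"
        using Lu[of K k] by auto
      obtain x where x: "x \<in> ar C" "src C x = K" "trg C x = src C p" "p \<cdot> x = k i" "q \<cdot> x = h"
        using is_product_ex[OF pq, of "k i" h] k h by auto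
      show "\<exists>!h. h \<in> hom C K (src C p) \<and> (\<forall>j \<in> insert i S. leg' j \<cdot> h = k j)"
      proof (rule ex1I[of _ x])
        show "x \<in> hom C K (src C p) \<and> (\<forall>j \<in> insert i S. leg' j \<cdot> x = k j)"
          using x l' h pt L(2) by auto
        fix y assume y: "y \<in> hom C K (src C p) \<and> (\<forall>j \<in> insert i S. leg' j \<cdot> y = k j)"
        then have "q \<cdot> y = h" using l' pt L(2) by (intro hu) auto
        with y x l' show "y = x"
          by - (rule jointly_monicD[OF is_product_jointly_monic[OF pq]], auto)
      qed
    qed
  qed
  from fin_prods[OF J(2)] obtain L leg where prod_J: "is_prod (ob J) L leg" by blast
  note L = is_prodD(1,2)[OF prod_J] and Lu = is_prodD(3)[OF prod_J]
  \<comment> \<open>\<open>l\<close> is universal among the arrows into the product whose components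
    are compatible with the arrows in \<open>S\<close>. The identity does this for the empty set,
    and each further arrow of \<open>J\<close> is handled by precomposing \<open>l\<close> with one
    equalizer.\<close>
  define is_cut where "is_cut S l \<longleftrightarrow> l \<in> ar C \<and> trg C l = L \<and>
      (\<forall>a \<in> S. Fa a \<cdot> (leg (src J a) \<cdot> l) = leg (trg J a) \<cdot> l) \<and>
      (\<forall>k \<in> ar C. trg C k = L \<and> (\<forall>a \<in> S. Fa a \<cdot> (leg (src J a) \<cdot> k) = leg (trg J a) \<cdot> k) \<longrightarrow>
        (\<exists>!h. h \<in> hom C (src C k) (src C l) \<and> l \<cdot> h = k))" for S l
  have is_cutD: "l \<in> ar C" "trg C l = L"
      "\<And>b. b \<in> S \<Longrightarrow> Fa b \<cdot> (leg (src J b) \<cdot> l) = leg (trg J b) \<cdot> l"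
      "\<And>k. k \<in> ar C \<Longrightarrow> trg C k = L \<Longrightarrow>
        \<forall>b \<in> S. Fa b \<cdot> (leg (src J b) \<cdot> k) = leg (trg J b) \<cdot> k \<Longrightarrow>
        \<exists>!h. h \<in> hom C (src C k) (src C l) \<and> l \<cdot> h = k" if "is_cut S l" for S l
    using that unfolding is_cut_def by blast+
  have cut: "\<exists>l. is_cut S l" if "finite S" "S \<subseteq> ar J" for S
    using that
  proof (induction S)
    case empty
    then show ?case using L(1) unfolding is_cut_def by (intro exI[of _ "idt C L"]) auto
  next
    case (insert a S)
    then obtain l where IH: "is_cut S l" by auto
    note l = is_cutD(1-3)[OF IH] and lu = is_cutD(4)[OF IH]
    have aJ: "a \<in> ar J" and S: "\<And>b. b \<in> S \<Longrightarrow> b \<in> ar J" using insert.prems by auto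
    note ty = F_ar J_ob L(2)
    let ?f = "Fa a \<cdot> (leg (src J a) \<cdot> l)" and ?g = "leg (trg J a) \<cdot> l"
    have fg: "?f \<in> ar C" "?g \<in> ar C" "src C ?f = src C l" "src C ?g = src C l" "trg C ?f = trg C ?g"
      using F_ar[OF aJ] L(2)[OF J_ob(1)[OF aJ]] L(2)[OF J_ob(2)[OF aJ]] l(1,2) by simp_all
    obtain e where e_raw: "e \<in> ar C \<and> trg C e = src C ?f \<and> ?f \<cdot> e = ?g \<cdot> e \<and>
      (\<forall>k \<in> ar C. trg C k = src C ?f \<and> ?f \<cdot> k = ?g \<cdot> k \<longrightarrow> (\<exists>!h. h \<in> hom C (src C k) (src C e) \<and> e \<cdot> h = k))"
      using eqs[of ?f ?g] fg by metis
    have e: "e \<in> ar C" "trg C e = src C l" "?f \<cdot> e = ?g \<cdot> e"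
      and eu: "\<And>k. k \<in> ar C \<Longrightarrow> trg C k = src C l \<Longrightarrow> ?f \<cdot> k = ?g \<cdot> k \<Longrightarrow>
        \<exists>!h. h \<in> hom C (src C k) (src C e) \<and> e \<cdot> h = k"
      using e_raw fg(3) by metis+
    have le: "Fa b \<cdot> (leg (src J b) \<cdot> (l \<cdot> e)) = leg (trg J b) \<cdot> (l \<cdot> e)" if "b \<in> insert a S" for b
    proof (cases "b = a")
      case True
      then show ?thesis using e l ty aJ by simp
    next
      case False
      with that have b: "b \<in> S" "b \<in> ar J" using S by auto
      have "(Fa b \<cdot> (leg (src J b) \<cdot> l)) \<cdot> e = (leg (trg J b) \<cdot> l) \<cdot> e" using l(3)[OF b(1)] by simp
      then show ?thesis using e l(1,2) ty b(2) by simp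
    qed
    show ?case
      unfolding is_cut_def
    proof (rule exI[of _ "l \<cdot> e"], intro conjI ballI impI)
      show "l \<cdot> e \<in> ar C" "trg C (l \<cdot> e) = L" using l e by auto
      fix b assume "b \<in> insert a S"
      then show "Fa b \<cdot> (leg (src J b) \<cdot> (l \<cdot> e)) = leg (trg J b) \<cdot> (l \<cdot> e)" by (rule le)
    next
      fix k assume k: "k \<in> ar C" "trg C k = L \<and> (\<forall>a \<in> insert a S. Fa a \<cdot> (leg (src J a) \<cdot> k) = leg (trg J a) \<cdot> k)"
      then obtain h where h: "h \<in> ar C" "src C h = src C k" "trg C h = src C l" "l \<cdot> h = k"
        and hu: "\<And>h'. h' \<in> hom C (src C k) (src C l) \<Longrightarrow> l \<cdot> h' = k \<Longrightarrow> h' = h" using lu[of k] by auto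
      have "?f \<cdot> h = ?g \<cdot> h" using k h l ty aJ by simp
      then obtain x where x: "x \<in> ar C" "src C x = src C k" "trg C x = src C e" "e \<cdot> x = h"
        and xu: "\<And>x'. x' \<in> hom C (src C k) (src C e) \<Longrightarrow> e \<cdot> x' = h \<Longrightarrow> x' = x"
        using eu[of h] h by auto
      show "\<exists>!h. h \<in> hom C (src C k) (src C (l \<cdot> e)) \<and> (l \<cdot> e) \<cdot> h = k"
      proof (rule ex1I[of _ x])
        show "x \<in> hom C (src C k) (src C (l \<cdot> e)) \<and> (l \<cdot> e) \<cdot> x = k" using x l e h by simp
        fix y assume y: "y \<in> hom C (src C k) (src C (l \<cdot> e)) \<and> (l \<cdot> e) \<cdot> y = k"
        then have "e \<cdot> y = h" using l e by (intro hu) auto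
        then show "y = x" using y l e by (intro xu) auto
      qed
    qed
  qed
  from cut[OF J(3)] obtain l where cut_J: "is_cut (ar J) l" by blast
  note l = is_cutD(1-3)[OF cut_J] and lu = is_cutD(4)[OF cut_J]
  have "is_limit J C Fo Fa (src C l) (\<lambda>j. leg j \<cdot> l)"
    unfolding is_limit_def
  proof (intro conjI allI impI)
    show "is_cone J C Fo Fa (src C l) (\<lambda>j. leg j \<cdot> l)"
      unfolding is_cone_def using l L by auto
    fix K k assume "is_cone J C Fo Fa K k"
    then have k: "K \<in> ob C" "\<forall>j \<in> ob J. k j \<in> hom C K (Fo j)" "\<And>a. a \<in> ar J \<Longrightarrow> Fa a \<cdot> k (src J a) = k (trg J a)"
      unfolding is_cone_def by auto
    from Lu[OF k(1,2)] obtain h where h: "h \<in> ar C" "src C h = K" "trg C h = L" "\<And>j. j \<in> ob J \<Longrightarrow> leg j \<cdot> h = k j"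
      and hu: "\<And>h'. h' \<in> hom C K L \<Longrightarrow> \<forall>j \<in> ob J. leg j \<cdot> h' = k j \<Longrightarrow> h' = h" by auto
    have "\<forall>b \<in> ar J. Fa b \<cdot> (leg (src J b) \<cdot> h) = leg (trg J b) \<cdot> h" using h(4) k(3) J_ob by simp
    from lu[OF h(1,3) this] obtain x where x: "x \<in> ar C" "src C x = K" "trg C x = src C l" "l \<cdot> x = h"
      and xu: "\<And>x'. x' \<in> hom C K (src C l) \<Longrightarrow> l \<cdot> x' = h \<Longrightarrow> x' = x" using h by auto
    show "\<exists>!h. h \<in> hom C K (src C l) \<and> (\<forall>j \<in> ob J. (leg j \<cdot> l) \<cdot> h = k j)"
    proof (rule ex1I[of _ x])
      show "x \<in> hom C K (src C l) \<and> (\<forall>j \<in> ob J. (leg j \<cdot> l) \<cdot> x = k j)" using x h l L by simp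
      fix y assume y: "y \<in> hom C K (src C l) \<and> (\<forall>j \<in> ob J. (leg j \<cdot> l) \<cdot> y = k j)"
      then have "l \<cdot> y = h" using l L by (intro hu) auto
      then show "y = x" using y by (intro xu) auto
    qed
  qed
  then show "\<exists>L leg. is_limit J C Fo Fa L leg" by blast
qed

end

section \<open>Terminal object, chosen pullbacks and chosen products\<close>

context finitely_complete_category
begin

lemma terminal_exists: "\<exists>T. is_terminal T"
proof -
  \<comment> \<open>The cones over the empty diagram are just objects. \<open>undefined\<close>
    serves as the functor because it is never evaluated.\<close>
  let ?J = "\<lparr>ob = {}, ar = {}, src = id, trg = id, idt = id, cmp = (\<lambda>g f. f)\<rparr> :: (nat, nat) cat_data"
  have "category ?J" by unfold_locales simp_all
  moreover have "is_functor ?J C (\<lambda>_. undefined) (\<lambda>_. undefined)" unfolding is_functor_def by simp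
  ultimately have "\<exists>T leg. is_limit ?J C (\<lambda>_. undefined) (\<lambda>_. undefined) T leg"
    by (intro finite_limits) simp_all
  then obtain T leg where "is_limit ?J C (\<lambda>_. undefined) (\<lambda>_. undefined) T leg" by blast
  then have "is_terminal T" unfolding is_limit_def is_cone_def is_terminal_def by simp
  then show ?thesis by blast
qed

lemma pullback_exists:
  assumes f: "f \<in> ar C" and g: "g \<in> ar C" and fg: "trg C f = trg C g"
  shows "\<exists>p q. is_pullback C f g p q"
proof -
  \<comment> \<open>The cospan category: the identities of the objects \<open>0\<close>,
    \<open>1\<close>, \<open>2\<close> bear the same numbers, and
    \<open>3 : 0 \<rightarrow> 2\<close> and \<open>4 : 1 \<rightarrow> 2\<close> are the other
    arrows. In every composite at least one factor is an identity, so \<open>cmp\<close> returns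
    \<open>b\<close> when it is \<open>3\<close> or \<open>4\<close> and \<open>a\<close>
    otherwise.\<close>
  let ?J = "\<lparr>ob = {0, 1, 2}, ar = {0, 1, 2, 3, 4},
    src = (\<lambda>a. if a = 3 then 0 else if a = 4 then 1 else a), trg = (\<lambda>a. if a = 3 \<or> a = 4 then 2 else a),
    idt = id, cmp = (\<lambda>b a. if b = 3 \<or> b = 4 then b else a)\<rparr> :: (nat, nat) cat_data"
  define Fo where "Fo j = (if j = 0 then src C f else if j = 1 then src C g else trg C f)" for j :: nat
  define Fa where "Fa a = (if a = 3 then f else if a = 4 then g else idt C (Fo a))" for a :: nat
  have "category ?J" by unfold_locales (auto split: if_splits)
  moreover have "is_functor ?J C Fo Fa"
    unfolding is_functor_def Fa_def Fo_def using f g fg by auto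
  ultimately have "\<exists>L leg. is_limit ?J C Fo Fa L leg" by (intro finite_limits) simp_all
  then obtain L leg where lim: "is_limit ?J C Fo Fa L leg" by blast
  have leg: "leg 0 \<in> ar C" "src C (leg 0) = L" "trg C (leg 0) = src C f"
    "leg 1 \<in> ar C" "src C (leg 1) = L" "trg C (leg 1) = src C g"
    "leg 2 \<in> ar C" "src C (leg 2) = L" "trg C (leg 2) = trg C f" "f \<cdot> leg 0 = leg 2" "g \<cdot> leg 1 = leg 2"
    using lim unfolding is_limit_def is_cone_def Fo_def Fa_def by (simp_all add: numeral_2_eq_2)
  have lu: "\<exists>!h. h \<in> hom C Z L \<and> leg 0 \<cdot> h = a \<and> leg 1 \<cdot> h = b"
    if ab: "a \<in> hom C Z (src C f)" "b \<in> hom C Z (src C g)" "f \<cdot> a = g \<cdot> b" for Z a b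
  proof -
    define k where "k j = (if j = 0 then a else if j = 1 then b else f \<cdot> a)" for j :: nat
    have Z: "Z \<in> ob C" using ab by auto
    have k: "k 0 = a" "k 1 = b" "k 2 = f \<cdot> a" unfolding k_def by simp_all
    have Fo: "Fo 0 = src C f" "Fo 1 = src C g" "Fo 2 = trg C f" unfolding Fo_def by simp_all
    have kh: "\<forall>j \<in> {0, 1, 2}. k j \<in> hom C Z (Fo j)" using ab f g fg Fo k by auto
    have "is_cone ?J C Fo Fa Z k"
      unfolding is_cone_def
    proof (intro conjI)
      show "\<forall>j \<in> ob ?J. k j \<in> hom C Z (Fo j)" using kh fg by simp
      show "\<forall>a \<in> ar ?J. Fa a \<cdot> k (src ?J a) = k (trg ?J a)"
        using kh Z k ab(3) Fo unfolding Fa_def by auto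
    qed (rule Z)
    then have "\<exists>!h. h \<in> hom C Z L \<and> (\<forall>j \<in> ob ?J. leg j \<cdot> h = k j)"
      using lim unfolding is_limit_def by blast
    then obtain h where h: "h \<in> hom C Z L" "\<forall>j \<in> ob ?J. leg j \<cdot> h = k j"
      and hu: "\<And>h'. h' \<in> hom C Z L \<Longrightarrow> \<forall>j \<in> ob ?J. leg j \<cdot> h' = k j \<Longrightarrow> h' = h" by blast
    show ?thesis
    proof (rule ex1I[of _ h])
      show "h \<in> hom C Z L \<and> leg 0 \<cdot> h = a \<and> leg 1 \<cdot> h = b" using h k by simp
      fix y assume y: "y \<in> hom C Z L \<and> leg 0 \<cdot> y = a \<and> leg 1 \<cdot> y = b"
      then have "leg 2 \<cdot> y = f \<cdot> a"
        using leg(1-9) f by (simp add: leg(10)[symmetric])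
      then show "y = h" using y k by (intro hu) auto
    qed
  qed
  have "is_pullback C f g (leg 0) (leg 1)"
    unfolding is_pullback_def
  proof (intro conjI allI impI, goal_cases)
    case (7 Z a b)
    then show ?case using lu[of a Z b] leg by simp
  qed (use f g fg leg in simp_all)
  then show ?thesis by blast
qed

lemma product_exists:
  assumes "A \<in> ob C" "B \<in> ob C"
  shows "\<exists>p q. is_product C A B p q"
proof -
  obtain T where T: "is_terminal T" using terminal_exists by blast
  then obtain a b where ab: "a \<in> hom C A T" "b \<in> hom C B T" using assms unfolding is_terminal_def by blast
  then obtain p q where "is_pullback C a b p q" using pullback_exists[of a b] by auto
  then show ?thesis using is_product_iff_is_pullback[OF T ab] by blast
qed

lemma pb_is_pullback:
  assumes "f \<in> ar C" "g \<in> ar C" "trg C f = trg C g"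
  shows "is_pullback C f g (pb0 C f g) (pb1 C f g)"
proof -
  have "\<exists>r. case r of (p, q) \<Rightarrow> is_pullback C f g p q" using pullback_exists[OF assms] by auto
  then have "case pb C f g of (p, q) \<Rightarrow> is_pullback C f g p q" unfolding pb_def by (rule someI_ex)
  then show ?thesis by (simp add: case_prod_beta)
qed

lemma pb0_ar [simp]: "f \<in> ar C \<Longrightarrow> g \<in> ar C \<Longrightarrow> trg C f = trg C g \<Longrightarrow> pb0 C f g \<in> ar C"
  and pb1_ar [simp]: "f \<in> ar C \<Longrightarrow> g \<in> ar C \<Longrightarrow> trg C f = trg C g \<Longrightarrow> pb1 C f g \<in> ar C"
  and src_pb1 [simp]: "f \<in> ar C \<Longrightarrow> g \<in> ar C \<Longrightarrow> trg C f = trg C g \<Longrightarrow> src C (pb1 C f g) = src C (pb0 C f g)"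
  and trg_pb0 [simp]: "f \<in> ar C \<Longrightarrow> g \<in> ar C \<Longrightarrow> trg C f = trg C g \<Longrightarrow> trg C (pb0 C f g) = src C f"
  and trg_pb1 [simp]: "f \<in> ar C \<Longrightarrow> g \<in> ar C \<Longrightarrow> trg C f = trg C g \<Longrightarrow> trg C (pb1 C f g) = src C g"
  and pb_commute0: "f \<in> ar C \<Longrightarrow> g \<in> ar C \<Longrightarrow> trg C f = trg C g \<Longrightarrow> f \<cdot> pb0 C f g = g \<cdot> pb1 C f g"
  using is_pullback_typing[OF pb_is_pullback[of f g]] by simp_all

lemma pb_commute:
  "f \<in> ar C \<Longrightarrow> g \<in> ar C \<Longrightarrow> trg C f = trg C g \<Longrightarrow> z \<in> ar C \<Longrightarrow> trg C z = src C (pb0 C f g) \<Longrightarrow>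
    f \<cdot> (pb0 C f g \<cdot> z) = g \<cdot> (pb1 C f g \<cdot> z)"
  using is_pullback_commute[OF pb_is_pullback[of f g]] by simp

lemma pb_eqI:
  assumes "f \<in> ar C" "g \<in> ar C" "trg C f = trg C g" "a \<in> ar C" "b \<in> ar C" "src C a = src C b"
    "trg C a = src C (pb0 C f g)" "trg C b = src C (pb0 C f g)"
    "pb0 C f g \<cdot> a = pb0 C f g \<cdot> b" "pb1 C f g \<cdot> a = pb1 C f g \<cdot> b"
  shows "a = b"
  using jointly_monicD[OF is_pullback_jointly_monic[OF pb_is_pullback[OF assms(1-3)]] assms(4,5,7,8,6,9,10)] .

lemma pb_pair_props:
  assumes "f \<in> ar C" "g \<in> ar C" "trg C f = trg C g" "a \<in> ar C" "b \<in> ar C" "src C a = src C b"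
    "trg C a = src C f" "trg C b = src C g" "f \<cdot> a = g \<cdot> b"
  shows "pb_pair C f g a b \<in> hom C (src C a) (src C (pb0 C f g)) \<and>
     pb0 C f g \<cdot> pb_pair C f g a b = a \<and> pb1 C f g \<cdot> pb_pair C f g a b = b"
proof -
  have "a \<in> hom C (src C a) (src C f)" "b \<in> hom C (src C a) (src C g)" using assms by simp_all
  then have "\<exists>!h. h \<in> hom C (src C a) (src C (pb0 C f g)) \<and> pb0 C f g \<cdot> h = a \<and> pb1 C f g \<cdot> h = b"
    using assms(9) pb_is_pullback[OF assms(1-3)] unfolding is_pullback_def by blast
  from theI'[OF this] show ?thesis unfolding pb_pair_def .
qed

context
  fixes f g a b
  assumes fgab: "f \<in> ar C" "g \<in> ar C" "trg C f = trg C g" "a \<in> ar C" "b \<in> ar C" "src C a = src C b"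
    "trg C a = src C f" "trg C b = src C g" "f \<cdot> a = g \<cdot> b"
begin

lemma pb_pair_ar [simp]: "pb_pair C f g a b \<in> ar C"
  and src_pb_pair [simp]: "src C (pb_pair C f g a b) = src C a"
  and trg_pb_pair [simp]: "trg C (pb_pair C f g a b) = src C (pb0 C f g)"
  and pb0_pb_pair [simp]: "pb0 C f g \<cdot> pb_pair C f g a b = a"
  and pb1_pb_pair [simp]: "pb1 C f g \<cdot> pb_pair C f g a b = b"
  using pb_pair_props[OF fgab] by simp_all

lemma pb0_pb_pair' [simp]: "k \<in> ar C \<Longrightarrow> trg C k = src C a \<Longrightarrow> pb0 C f g \<cdot> (pb_pair C f g a b \<cdot> k) = a \<cdot> k"
  and pb1_pb_pair' [simp]: "k \<in> ar C \<Longrightarrow> trg C k = src C a \<Longrightarrow> pb1 C f g \<cdot> (pb_pair C f g a b \<cdot> k) = b \<cdot> k"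
  using fgab by (simp_all add: cmp_reassoc[OF pb0_pb_pair] cmp_reassoc[OF pb1_pb_pair])

lemma pb_pair_unique:
  assumes "h \<in> ar C" "src C h = src C a" "trg C h = src C (pb0 C f g)" "pb0 C f g \<cdot> h = a" "pb1 C f g \<cdot> h = b"
  shows "pb_pair C f g a b = h"
  by (rule pb_eqI[OF fgab(1-3)]) (use assms fgab in simp_all)

end

lemma pb_pair_natural:
  assumes "f \<in> ar C" "g \<in> ar C" "trg C f = trg C g" "a \<in> ar C" "b \<in> ar C" "src C a = src C b"
    "trg C a = src C f" "trg C b = src C g" "f \<cdot> a = g \<cdot> b" "k \<in> ar C" "trg C k = src C a"
  shows "pb_pair C f g a b \<cdot> k = pb_pair C f g (a \<cdot> k) (b \<cdot> k)"
proof -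
  have "f \<cdot> (a \<cdot> k) = g \<cdot> (b \<cdot> k)" using assms(1-8,10,11) by (simp add: cmp_reassoc[OF assms(9)])
  then show ?thesis by (intro pb_pair_unique[symmetric]) (use assms(1-11) in simp_all)
qed

lemma chosen_prod_is_product:
  assumes "A \<in> ob C" "B \<in> ob C"
  shows "is_product C A B (pr0 C A B) (pr1 C A B)"
proof -
  have "\<exists>r. case r of (p, q) \<Rightarrow> is_product C A B p q" using product_exists[OF assms] by auto
  then have "case chosen_prod C A B of (p, q) \<Rightarrow> is_product C A B p q" unfolding chosen_prod_def by (rule someI_ex)
  then show ?thesis by (simp add: case_prod_beta)
qed

lemma pr0_ar [simp]: "A \<in> ob C \<Longrightarrow> B \<in> ob C \<Longrightarrow> pr0 C A B \<in> ar C"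
  and pr1_ar [simp]: "A \<in> ob C \<Longrightarrow> B \<in> ob C \<Longrightarrow> pr1 C A B \<in> ar C"
  and src_pr1 [simp]: "A \<in> ob C \<Longrightarrow> B \<in> ob C \<Longrightarrow> src C (pr1 C A B) = src C (pr0 C A B)"
  and trg_pr0 [simp]: "A \<in> ob C \<Longrightarrow> B \<in> ob C \<Longrightarrow> trg C (pr0 C A B) = A"
  and trg_pr1 [simp]: "A \<in> ob C \<Longrightarrow> B \<in> ob C \<Longrightarrow> trg C (pr1 C A B) = B"
  using is_product_typing[OF chosen_prod_is_product[of A B]] by simp_all

lemma prod_eqI:
  assumes "A \<in> ob C" "B \<in> ob C" "a \<in> ar C" "b \<in> ar C" "src C a = src C b"
    "trg C a = src C (pr0 C A B)" "trg C b = src C (pr0 C A B)"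
    "pr0 C A B \<cdot> a = pr0 C A B \<cdot> b" "pr1 C A B \<cdot> a = pr1 C A B \<cdot> b"
  shows "a = b"
  using jointly_monicD[OF is_product_jointly_monic[OF chosen_prod_is_product[OF assms(1,2)]] assms(3,4,6,7,5,8,9)] .

lemma prod_pair_props:
  assumes "a \<in> ar C" "b \<in> ar C" "src C a = src C b"
  shows "prod_pair C a b \<in> hom C (src C a) (src C (pr0 C (trg C a) (trg C b))) \<and>
     pr0 C (trg C a) (trg C b) \<cdot> prod_pair C a b = a \<and> pr1 C (trg C a) (trg C b) \<cdot> prod_pair C a b = b"
proof -
  have o: "trg C a \<in> ob C" "trg C b \<in> ob C" using assms by auto
  have "a \<in> hom C (src C a) (trg C a)" "b \<in> hom C (src C a) (trg C b)" using assms by simp_all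
  then have "\<exists>!h. h \<in> hom C (src C a) (src C (pr0 C (trg C a) (trg C b))) \<and>
      pr0 C (trg C a) (trg C b) \<cdot> h = a \<and> pr1 C (trg C a) (trg C b) \<cdot> h = b"
    using chosen_prod_is_product[OF o] unfolding is_product_def by blast
  from theI'[OF this] show ?thesis unfolding prod_pair_def .
qed

context
  fixes a b A B
  assumes ab: "a \<in> ar C" "b \<in> ar C" "src C a = src C b" "trg C a = A" "trg C b = B"
begin

lemma prod_pair_ar [simp]: "prod_pair C a b \<in> ar C"
  and src_prod_pair [simp]: "src C (prod_pair C a b) = src C a"
  and trg_prod_pair [simp]: "trg C (prod_pair C a b) = src C (pr0 C A B)"
  and pr0_prod_pair [simp]: "pr0 C A B \<cdot> prod_pair C a b = a"
  and pr1_prod_pair [simp]: "pr1 C A B \<cdot> prod_pair C a b = b"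
  using prod_pair_props[OF ab(1-3)] ab by simp_all

lemma pr0_prod_pair' [simp]: "k \<in> ar C \<Longrightarrow> trg C k = src C a \<Longrightarrow> pr0 C A B \<cdot> (prod_pair C a b \<cdot> k) = a \<cdot> k"
  and pr1_prod_pair' [simp]: "k \<in> ar C \<Longrightarrow> trg C k = src C a \<Longrightarrow> pr1 C A B \<cdot> (prod_pair C a b \<cdot> k) = b \<cdot> k"
  using ab trg_ob[of a] trg_ob[of b]
  by (simp_all add: cmp_reassoc[OF pr0_prod_pair] cmp_reassoc[OF pr1_prod_pair])

end

lemma prod_pair_natural:
  assumes "a \<in> ar C" "b \<in> ar C" "src C a = src C b" "k \<in> ar C" "trg C k = src C a"
  shows "prod_pair C a b \<cdot> k = prod_pair C (a \<cdot> k) (b \<cdot> k)"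
  by (rule prod_eqI[of "trg C a" "trg C b"]) (use assms trg_ob[of b] in simp_all)

end

section \<open>Internal categories on generalized elements\<close>

text \<open>Composition of generalized elements in diagrammatic order: \<open>icomp E A f g\<close>
  is \<open>g\<close> after \<open>f\<close>. It is controlled only on pairs that are
  \<open>composable\<close>, since \<open>cpair\<close> is a definite description.\<close>

definition icomp :: "('o, 'm) cat_data \<Rightarrow> 'm icat \<Rightarrow> 'm \<Rightarrow> 'm \<Rightarrow> 'm" where
  "icomp E A f g = icmp A \<cdot>\<^bsub>E\<^esub> cpair E A f g"

abbreviation composable :: "('o, 'm) cat_data \<Rightarrow> 'm icat \<Rightarrow> 'm \<Rightarrow> 'm \<Rightarrow> bool" where
  "composable E A f g \<equiv> f \<in> ar E \<and> g \<in> ar E \<and> trg E f = arr_ob E A \<and> trg E g = arr_ob E A \<and>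
     src E f = src E g \<and> icod A \<cdot>\<^bsub>E\<^esub> f = idom A \<cdot>\<^bsub>E\<^esub> g"

locale fixed_objects = finitely_complete_category E for E :: "('o, 'm) cat_data" (structure) +
  fixes X :: 'o
  assumes X_ob [simp]: "X \<in> ob E"
begin

abbreviation icat :: "'m icat \<Rightarrow> bool" where
  "icat \<equiv> internal_category E X"

lemma icat_typing [simp]:
  assumes "icat A"
  shows "idom A \<in> ar E" "trg E (idom A) = X" "icod A \<in> ar E" "src E (icod A) = arr_ob E A" "trg E (icod A) = X"
    "iunit A \<in> ar E" "src E (iunit A) = X" "trg E (iunit A) = arr_ob E A"
    "icmp A \<in> ar E" "src E (icmp A) = src E (cp0 E A)" "trg E (icmp A) = arr_ob E A"
    "idom A \<cdot> iunit A = idt E X" "icod A \<cdot> iunit A = idt E X"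
  using assms unfolding internal_category_def by simp_all

lemma icat_laws:
  assumes "icat A"
  shows "idom A \<cdot> icmp A = idom A \<cdot> cp0 E A" "icod A \<cdot> icmp A = icod A \<cdot> cp1 E A"
    "icomp E A (iunit A \<cdot> idom A) (idt E (arr_ob E A)) = idt E (arr_ob E A)"
    "icomp E A (idt E (arr_ob E A)) (iunit A \<cdot> icod A) = idt E (arr_ob E A)"
    "icomp E A (icmp A \<cdot> pb0 E (cp1 E A) (cp0 E A)) (cp1 E A \<cdot> pb1 E (cp1 E A) (cp0 E A)) =
      icomp E A (cp0 E A \<cdot> pb0 E (cp1 E A) (cp0 E A)) (icmp A \<cdot> pb1 E (cp1 E A) (cp0 E A))"
  using assms unfolding internal_category_def Let_def icomp_def by - (elim conjE, assumption)+

lemma arr_ob_ob [simp]: "icat A \<Longrightarrow> arr_ob E A \<in> ob E"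
  using icat_typing(1) by simp

lemma idom_iunit [simp]: "icat A \<Longrightarrow> x \<in> ar E \<Longrightarrow> trg E x = X \<Longrightarrow> idom A \<cdot> (iunit A \<cdot> x) = x"
  and icod_iunit [simp]: "icat A \<Longrightarrow> x \<in> ar E \<Longrightarrow> trg E x = X \<Longrightarrow> icod A \<cdot> (iunit A \<cdot> x) = x"
  by (simp_all add: cmp_reassoc[of "idom A"] cmp_reassoc[of "icod A"])

lemma icomp_ar [simp]: "icat A \<Longrightarrow> composable E A f g \<Longrightarrow> icomp E A f g \<in> ar E"
  and src_icomp [simp]: "icat A \<Longrightarrow> composable E A f g \<Longrightarrow> src E (icomp E A f g) = src E f"
  and trg_icomp [simp]: "icat A \<Longrightarrow> composable E A f g \<Longrightarrow> trg E (icomp E A f g) = arr_ob E A"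
  unfolding icomp_def by simp_all

lemma idom_icomp [simp]:
  assumes A: "icat A" and c: "composable E A f g"
  shows "idom A \<cdot> icomp E A f g = idom A \<cdot> f"
proof -
  show ?thesis using A c unfolding icomp_def by (simp add: cmp_reassoc[OF icat_laws(1)[OF A]])
qed

lemma icod_icomp [simp]:
  assumes A: "icat A" and c: "composable E A f g"
  shows "icod A \<cdot> icomp E A f g = icod A \<cdot> g"
proof -
  show ?thesis using A c unfolding icomp_def by (simp add: cmp_reassoc[OF icat_laws(2)[OF A]])
qed

lemma icomp_natural [simp]:
  assumes A: "icat A" and c: "composable E A f g" and k: "k \<in> ar E" "trg E k = src E f"
  shows "icomp E A f g \<cdot> k = icomp E A (f \<cdot> k) (g \<cdot> k)"
  using assms unfolding icomp_def by (simp add: pb_pair_natural)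

lemma composable_natural:
  assumes A: "icat A" and c: "composable E A f g" and k: "k \<in> ar E" "trg E k = src E f"
  shows "icod A \<cdot> (f \<cdot> k) = idom A \<cdot> (g \<cdot> k)"
  using A c k cmp_assoc[symmetric] by (simp add: cmp_reassoc[of "icod A" f "idom A \<cdot> g"])

lemma icomp_iunit_left:
  assumes A: "icat A" and f: "f \<in> ar E" "trg E f = arr_ob E A" "idom A \<cdot> f = x"
  shows "icomp E A (iunit A \<cdot> x) f = f"
proof -
  from arg_cong[OF icat_laws(3)[OF A], of "\<lambda>z. z \<cdot> f"] A f(1,2) show ?thesis
    by (simp add: f(3)[symmetric])
qed

lemma icomp_iunit_right:
  assumes A: "icat A" and f: "f \<in> ar E" "trg E f = arr_ob E A" "icod A \<cdot> f = x"
  shows "icomp E A f (iunit A \<cdot> x) = f"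
proof -
  from arg_cong[OF icat_laws(4)[OF A], of "\<lambda>z. z \<cdot> f"] A f(1,2) show ?thesis
    by (simp add: f(3)[symmetric])
qed

text \<open>The defining law speaks of the universal composable triple. The arrow \<open>k\<close>
  classifies the triple \<open>(f, g, h)\<close>, and precomposing the law with \<open>k\<close>
  gives associativity for these elements.\<close>

lemma icomp_assoc:
  assumes A: "icat A" and fg: "composable E A f g" and gh: "composable E A g h"
  shows "icomp E A (icomp E A f g) h = icomp E A f (icomp E A g h)"
proof -
  let ?t0 = "pb0 E (cp1 E A) (cp0 E A)" and ?t1 = "pb1 E (cp1 E A) (cp0 E A)"
  define k where "k = pb_pair E (cp1 E A) (cp0 E A) (cpair E A f g) (cpair E A g h)"
  have k: "k \<in> ar E" "src E k = src E g" "trg E k = src E ?t0" "?t0 \<cdot> k = cpair E A f g" "?t1 \<cdot> k = cpair E A g h"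
    using A fg gh unfolding k_def by simp_all
  have t: "?t0 \<in> ar E" "?t1 \<in> ar E" "trg E ?t0 = src E (cp0 E A)" "trg E ?t1 = src E (cp0 E A)"
    "src E ?t1 = src E ?t0" "cp1 E A \<cdot> ?t0 = cp0 E A \<cdot> ?t1"
    using A pb_commute0[of "cp1 E A" "cp0 E A"] by simp_all
  note law = icat_laws(5)[OF A] and dc = icat_laws(1,2)[OF A]
  have c1: "icod A \<cdot> (icmp A \<cdot> ?t0) = idom A \<cdot> (cp1 E A \<cdot> ?t1)"
    using A t(1-5) pb_commute[of "icod A" "idom A" ?t1] by (simp add: cmp_reassoc[OF dc(2)] t(6))
  have c2: "icod A \<cdot> (cp0 E A \<cdot> ?t0) = idom A \<cdot> (icmp A \<cdot> ?t1)"
    using A t(1-5) pb_commute[of "icod A" "idom A" ?t0] by (simp add: cmp_reassoc[OF dc(1)] t(6))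
  have "icomp E A (icmp A \<cdot> ?t0) (cp1 E A \<cdot> ?t1) \<cdot> k = icomp E A (icomp E A f g) h"
    using A t k c1 fg gh by (simp add: icomp_def[of E A f g])
  moreover have "icomp E A (cp0 E A \<cdot> ?t0) (icmp A \<cdot> ?t1) \<cdot> k = icomp E A f (icomp E A g h)"
    using A t k c2 fg gh by (simp add: icomp_def[of E A g h])
  ultimately show ?thesis using law by simp
qed

text \<open>A Yoneda argument: an operation \<open>M\<close> on elements that is natural in their
  source is represented by its value at the generic composable pair \<open>(?p, ?q)\<close>. Every
  composable pair is the generic one precomposed with its classifying arrow, so this value induces
  \<open>M\<close> everywhere, and the category laws need only be known for elements.\<close>

lemma internal_category_ofI:
  assumes d: "d \<in> hom E W X" and c: "c \<in> hom E W X" and i: "i \<in> hom E X W"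
    and di: "d \<cdot> i = idt E X" and ci: "c \<cdot> i = idt E X"
    and M: "\<And>f g. f \<in> ar E \<Longrightarrow> g \<in> ar E \<Longrightarrow> trg E f = W \<Longrightarrow> trg E g = W \<Longrightarrow> src E f = src E g \<Longrightarrow>
      c \<cdot> f = d \<cdot> g \<Longrightarrow> M f g \<in> hom E (src E f) W \<and> d \<cdot> M f g = d \<cdot> f \<and> c \<cdot> M f g = c \<cdot> g"
    and Mn: "\<And>f g k. f \<in> ar E \<Longrightarrow> g \<in> ar E \<Longrightarrow> trg E f = W \<Longrightarrow> trg E g = W \<Longrightarrow> src E f = src E g \<Longrightarrow>
      c \<cdot> f = d \<cdot> g \<Longrightarrow> k \<in> ar E \<Longrightarrow> trg E k = src E f \<Longrightarrow> M f g \<cdot> k = M (f \<cdot> k) (g \<cdot> k)"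
    and Ml: "\<And>f. f \<in> ar E \<Longrightarrow> trg E f = W \<Longrightarrow> M (i \<cdot> (d \<cdot> f)) f = f"
    and Mr: "\<And>f. f \<in> ar E \<Longrightarrow> trg E f = W \<Longrightarrow> M f (i \<cdot> (c \<cdot> f)) = f"
    and Ma: "\<And>f g h. f \<in> ar E \<Longrightarrow> g \<in> ar E \<Longrightarrow> h \<in> ar E \<Longrightarrow> trg E f = W \<Longrightarrow> trg E g = W \<Longrightarrow> trg E h = W \<Longrightarrow>
      src E f = src E g \<Longrightarrow> src E g = src E h \<Longrightarrow> c \<cdot> f = d \<cdot> g \<Longrightarrow> c \<cdot> g = d \<cdot> h \<Longrightarrow> M (M f g) h = M f (M g h)"
  obtains A where "icat A" "idom A = d" "icod A = c" "iunit A = i"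
    "\<And>f g. composable E A f g \<Longrightarrow> icomp E A f g = M f g"
proof -
  let ?p = "pb0 E c d" and ?q = "pb1 E c d"
  define A where "A = \<lparr>idom = d, icod = c, iunit = i, icmp = M ?p ?q\<rparr>"
  have s [simp]: "idom A = d" "icod A = c" "iunit A = i" "icmp A = M ?p ?q" unfolding A_def by simp_all
  have ty [simp]: "d \<in> ar E" "src E d = W" "trg E d = X" "c \<in> ar E" "src E c = W" "trg E c = X"
    "i \<in> ar E" "src E i = X" "trg E i = W" using c d i by simp_all
  have W [simp]: "W \<in> ob E" using src_ob[of d] by simp
  have pq [simp]: "c \<cdot> ?p = d \<cdot> ?q" using pb_commute0[of c d] by simp
  have m [simp]: "M ?p ?q \<in> ar E" "src E (M ?p ?q) = src E ?p" "trg E (M ?p ?q) = W"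
    "d \<cdot> M ?p ?q = d \<cdot> ?p" "c \<cdot> M ?p ?q = c \<cdot> ?q" using M[of ?p ?q] by simp_all
  have di' [simp]: "d \<cdot> (i \<cdot> x) = x" "c \<cdot> (i \<cdot> x) = x" if "x \<in> ar E" "trg E x = X" for x
    using that by (simp_all add: cmp_reassoc[OF di] cmp_reassoc[OF ci])
  have comp: "M ?p ?q \<cdot> pb_pair E c d f g = M f g"
    if "f \<in> ar E" "g \<in> ar E" "trg E f = W" "trg E g = W" "src E f = src E g" "c \<cdot> f = d \<cdot> g" for f g
    using Mn[of ?p ?q "pb_pair E c d f g"] that by simp
  let ?t0 = "pb0 E ?q ?p" and ?t1 = "pb1 E ?q ?p"
  have t: "?q \<cdot> ?t0 = ?p \<cdot> ?t1" using pb_commute0[of ?q ?p] by simp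
  have c1: "c \<cdot> (?p \<cdot> ?t0) = d \<cdot> (?p \<cdot> ?t1)"
    using pb_commute[of c d ?t0] t by simp
  have c2: "c \<cdot> (?p \<cdot> ?t1) = d \<cdot> (?q \<cdot> ?t1)"
    using pb_commute[of c d ?t1] by simp
  have m0: "M ?p ?q \<cdot> ?t0 = M (?p \<cdot> ?t0) (?p \<cdot> ?t1)"
    using Mn[of ?p ?q ?t0] t by simp
  have m1: "M ?p ?q \<cdot> ?t1 = M (?p \<cdot> ?t1) (?q \<cdot> ?t1)"
    using Mn[of ?p ?q ?t1] by simp
  note M0 = M[of "?p \<cdot> ?t0" "?p \<cdot> ?t1", simplified] and M1 = M[of "?p \<cdot> ?t1" "?q \<cdot> ?t1", simplified]
  have "icat A"
    unfolding internal_category_def Let_def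
  proof (intro conjI, goal_cases)
    case 10
    show ?case using comp[of "i \<cdot> d" "idt E W"] Ml[of "idt E W"] by simp
  next
    case 11
    show ?case using comp[of "idt E W" "i \<cdot> c"] Mr[of "idt E W"] by simp
  next
    case 12
    have "M ?p ?q \<cdot> pb_pair E c d (M ?p ?q \<cdot> ?t0) (?q \<cdot> ?t1) = M (M (?p \<cdot> ?t0) (?p \<cdot> ?t1)) (?q \<cdot> ?t1)"
      unfolding m0 using M0 c1 c2 by (intro comp) simp_all
    moreover have "M ?p ?q \<cdot> pb_pair E c d (?p \<cdot> ?t0) (M ?p ?q \<cdot> ?t1) = M (?p \<cdot> ?t0) (M (?p \<cdot> ?t1) (?q \<cdot> ?t1))"
      unfolding m1 using M1 c1 c2 by (intro comp) simp_all
    ultimately show ?case using Ma[of "?p \<cdot> ?t0" "?p \<cdot> ?t1" "?q \<cdot> ?t1"] c1 c2 by simp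
  qed (use di ci in simp_all)
  moreover have "icomp E A f g = M f g" if "composable E A f g" for f g
    using comp[of f g] that unfolding icomp_def by simp
  ultimately show thesis using that[of A] by simp
qed

section \<open>Identity-on-objects functors on generalized elements\<close>

abbreviation ifun :: "'m icat \<Rightarrow> 'm icat \<Rightarrow> 'm \<Rightarrow> bool" where
  "ifun \<equiv> internal_functor E"

lemma ifun_simps:
  assumes F: "ifun A B F" and A: "icat A" and B: "icat B"
  shows "F \<in> ar E" "src E F = arr_ob E A" "trg E F = arr_ob E B"
    "idom B \<cdot> F = idom A" "icod B \<cdot> F = icod A" "F \<cdot> iunit A = iunit B"
    "\<And>f. f \<in> ar E \<Longrightarrow> trg E f = arr_ob E A \<Longrightarrow> idom B \<cdot> (F \<cdot> f) = idom A \<cdot> f"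
    "\<And>f. f \<in> ar E \<Longrightarrow> trg E f = arr_ob E A \<Longrightarrow> icod B \<cdot> (F \<cdot> f) = icod A \<cdot> f"
    "\<And>x. x \<in> ar E \<Longrightarrow> trg E x = X \<Longrightarrow> F \<cdot> (iunit A \<cdot> x) = iunit B \<cdot> x"
    "\<And>f g. composable E A f g \<Longrightarrow> F \<cdot> icomp E A f g = icomp E B (F \<cdot> f) (F \<cdot> g)"
proof -
  show ty: "F \<in> ar E" "src E F = arr_ob E A" "trg E F = arr_ob E B"
    "idom B \<cdot> F = idom A" "icod B \<cdot> F = icod A" "F \<cdot> iunit A = iunit B"
    using F unfolding internal_functor_def by simp_all
  show g: "idom B \<cdot> (F \<cdot> f) = idom A \<cdot> f" "icod B \<cdot> (F \<cdot> f) = icod A \<cdot> f"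
    if "f \<in> ar E" "trg E f = arr_ob E A" for f
    using that ty(1-3) B by (simp_all add: cmp_reassoc[OF ty(4)] cmp_reassoc[OF ty(5)])
  show "F \<cdot> (iunit A \<cdot> x) = iunit B \<cdot> x" if "x \<in> ar E" "trg E x = X" for x
    using that ty(1-3) A by (simp add: cmp_reassoc[OF ty(6)])
  fix f g assume c: "composable E A f g"
  have law: "F \<cdot> icmp A = icomp E B (F \<cdot> cp0 E A) (F \<cdot> cp1 E A)"
    using F unfolding internal_functor_def icomp_def by simp
  have "icod A \<cdot> cp0 E A = idom A \<cdot> cp1 E A" using A by (simp add: pb_commute0)
  then have "composable E B (F \<cdot> cp0 E A) (F \<cdot> cp1 E A)" using A ty(1-3) g by simp
  then have "icomp E B (F \<cdot> cp0 E A) (F \<cdot> cp1 E A) \<cdot> cpair E A f g = icomp E B (F \<cdot> f) (F \<cdot> g)"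
    using B A c ty(1-3) by simp
  then show "F \<cdot> icomp E A f g = icomp E B (F \<cdot> f) (F \<cdot> g)"
    using A c ty(1-3) by (simp add: icomp_def[of _ A] cmp_reassoc[OF law])
qed

text \<open>Preservation of composites for all elements is specialized to the generic composable
  pair \<open>(cp0, cp1)\<close>, whose classifying arrow is the identity; that instance is the
  defining law.\<close>

lemma ifunI:
  assumes A: "icat A" and B: "icat B" and F: "F \<in> hom E (arr_ob E A) (arr_ob E B)"
    and dF: "idom B \<cdot> F = idom A" and cF: "icod B \<cdot> F = icod A" and iF: "F \<cdot> iunit A = iunit B"
    and mF: "\<And>f g. composable E A f g \<Longrightarrow> F \<cdot> icomp E A f g = icomp E B (F \<cdot> f) (F \<cdot> g)"
  shows "ifun A B F"
proof -
  have c: "icod A \<cdot> cp0 E A = idom A \<cdot> cp1 E A" using A by (simp add: pb_commute0)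
  have "cpair E A (cp0 E A) (cp1 E A) = idt E (src E (cp0 E A))"
    using A c by (intro pb_pair_unique) simp_all
  then have "icomp E A (cp0 E A) (cp1 E A) = icmp A"
    using A unfolding icomp_def by simp
  then show ?thesis
    using mF[of "cp0 E A" "cp1 E A"] A B F dF cF iF c unfolding internal_functor_def
    by (simp add: icomp_def[of _ B])
qed

lemma ifun_idt: "icat A \<Longrightarrow> ifun A A (idt E (arr_ob E A))"
  by (rule ifunI) simp_all

lemma ifun_cmp:
  assumes F: "ifun A B F" and G: "ifun B D G" and ABD: "icat A" "icat B" "icat D"
  shows "ifun A D (G \<cdot> F)"
proof -
  note f = ifun_simps[OF F ABD(1,2)] and g = ifun_simps[OF G ABD(2,3)]
  show ?thesis by (rule ifunI) (use ABD in \<open>simp_all add: f g\<close>)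
qed

text \<open>Domain and codomain of \<open>F\<close> are read off after \<open>p\<close>, as
  \<open>p\<close> is the identity on objects. The unit and composition laws hold after
  \<open>p\<close> and after \<open>q\<close>, and joint monicity removes these. This is how an
  arrow of \<open>E\<close> induced by a universal property is recognized as a functor.\<close>

lemma ifun_lift:
  assumes ABD: "icat A" "icat W" "icat B" "icat D"
    and p: "ifun W B p" and q: "ifun W D q" and pq: "jointly_monic E p q"
    and F: "F \<in> hom E (arr_ob E A) (arr_ob E W)"
    and pF: "ifun A B (p \<cdot> F)" and qF: "ifun A D (q \<cdot> F)"
  shows "ifun A W F"
proof (rule ifunI)
  note p = ifun_simps[OF p ABD(2,3)] and q = ifun_simps[OF q ABD(2,4)]
  note pF = ifun_simps[OF pF ABD(1,3)] and qF = ifun_simps[OF qF ABD(1,4)]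
  have ty: "F \<in> ar E" "src E F = arr_ob E A" "trg E F = arr_ob E W" using F by simp_all
  have pF': "p \<cdot> (F \<cdot> x) = (p \<cdot> F) \<cdot> x" "q \<cdot> (F \<cdot> x) = (q \<cdot> F) \<cdot> x" if "x \<in> ar E" "trg E x = arr_ob E A" for x
    using that ty p(1-3) q(1-3) by simp_all
  have pF4: "idom B \<cdot> (p \<cdot> F) = idom A" "icod B \<cdot> (p \<cdot> F) = icod A" using pF(4,5) by simp_all
  show dF: "idom W \<cdot> F = idom A" using pF4(1) p(7)[of F] ty by simp
  show cF: "icod W \<cdot> F = icod A" using pF4(2) p(8)[of F] ty by simp
  have cW: "icod W \<cdot> (F \<cdot> f) = icod A \<cdot> f" if "f \<in> ar E" "trg E f = arr_ob E A" for f
    using that ABD ty by (simp add: cmp_reassoc[OF cF])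
  have dW: "idom W \<cdot> (F \<cdot> f) = idom A \<cdot> f" if "f \<in> ar E" "trg E f = arr_ob E A" for f
    using that ABD ty by (simp add: cmp_reassoc[OF dF])
  show "F \<cdot> iunit A = iunit W"
    by (rule jointly_monicD[OF pq]) (use ABD ty in \<open>simp_all add: pF' pF(6) qF(6) p(1-3,6) q(1-3,6) del: assoc\<close>)
  fix f g assume c: "composable E A f g"
  have 1: "p \<cdot> (F \<cdot> icomp E A f g) = p \<cdot> icomp E W (F \<cdot> f) (F \<cdot> g)"
    using c ABD ty p(1-3) by (simp add: pF' pF(10) p(10) cW dW del: assoc)
  have 2: "q \<cdot> (F \<cdot> icomp E A f g) = q \<cdot> icomp E W (F \<cdot> f) (F \<cdot> g)"
    using c ABD ty q(1-3) by (simp add: pF' qF(10) q(10) cW dW del: assoc)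
  show "F \<cdot> icomp E A f g = icomp E W (F \<cdot> f) (F \<cdot> g)"
    by (rule jointly_monicD[OF pq _ _ _ _ _ 1 2]) (use c ABD ty p(1-3) in \<open>simp_all add: cW dW\<close>)
qed (use assms in simp_all)

end

section \<open>Groupoids in a Mal'tsev category\<close>

context maltsev_category
begin

lemma reflexive_symD:
  assumes R: "is_reflexive C X (d0, d1)" and z: "z \<in> ar C" "trg C z = src C d0"
  obtains z' where "z' \<in> ar C" "src C z' = src C z" "trg C z' = src C d0" "d0 \<cdot> z' = d1 \<cdot> z" "d1 \<cdot> z' = d0 \<cdot> z"
proof -
  have ty: "d0 \<in> ar C" "d1 \<in> ar C" "src C d1 = src C d0"
    using R unfolding is_reflexive_def is_relation_def by auto
  have "is_symmetric C X (d0, d1)" using reflexive_imp_equivalence[OF R] unfolding is_equivalence_def by simp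
  then obtain t where t: "t \<in> ar C" "src C t = src C d0" "trg C t = src C d0" "d0 \<cdot> t = d1" "d1 \<cdot> t = d0"
    unfolding is_symmetric_def by auto
  show thesis
    by (rule that[of "t \<cdot> z"]) (use t z ty in \<open>simp_all add: cmp_reassoc[OF t(4)] cmp_reassoc[OF t(5)]\<close>)
qed

lemma reflexive_transD:
  assumes R: "is_reflexive C X (d0, d1)"
    and zw: "z \<in> ar C" "trg C z = src C d0" "w \<in> ar C" "trg C w = src C d0" "src C z = src C w" "d1 \<cdot> z = d0 \<cdot> w"
  obtains v where "v \<in> ar C" "src C v = src C w" "trg C v = src C d0" "d0 \<cdot> v = d0 \<cdot> z" "d1 \<cdot> v = d1 \<cdot> w"
proof -
  have ty: "d0 \<in> ar C" "d1 \<in> ar C" "src C d1 = src C d0" "trg C d0 = X" "trg C d1 = X"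
    using R unfolding is_reflexive_def is_relation_def by auto
  have "is_transitive C X (d0, d1)" using reflexive_imp_equivalence[OF R] unfolding is_equivalence_def by simp
  then obtain t where t: "t \<in> ar C" "src C t = src C (pb0 C d1 d0)" "trg C t = src C d0"
    "d0 \<cdot> t = d0 \<cdot> pb0 C d1 d0" "d1 \<cdot> t = d1 \<cdot> pb1 C d1 d0"
    unfolding is_transitive_def by auto
  show thesis
    by (rule that[of "t \<cdot> pb_pair C d1 d0 z w"])
      (use t(1-3) zw ty in \<open>simp_all add: cmp_reassoc[OF t(4)] cmp_reassoc[OF t(5)]\<close>)
qed

text \<open>Symmetry is applied to the reflexive relation on the object \<open>R\<close> of a relation \<open>(a, b)\<close> under which
  \<open>r\<close> is related to \<open>r'\<close> when \<open>(a r', b r)\<close> belongs to \<open>R\<close>.\<close>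

lemma difunctional:
  assumes ab: "a \<in> ar C" "b \<in> ar C" "src C b = src C a" and jm: "jointly_monic C a b"
    and rst: "r \<in> ar C" "s \<in> ar C" "t \<in> ar C" "src C s = src C r" "src C t = src C r"
      "trg C r = src C a" "trg C s = src C a" "trg C t = src C a"
    and eq: "b \<cdot> r = b \<cdot> s" "a \<cdot> s = a \<cdot> t"
  obtains v where "v \<in> ar C" "src C v = src C r" "trg C v = src C a" "a \<cdot> v = a \<cdot> r" "b \<cdot> v = b \<cdot> t"
proof -
  \<comment> \<open>An element of the object built here is a triple \<open>(w, r', r)\<close> with
    \<open>a w = a r'\<close> and \<open>b w = b r\<close>. Thus \<open>w\<close> is the element of
    \<open>R\<close> witnessing that \<open>(a r', b r)\<close> belongs to it; the legs are
    \<open>?d0 = r\<close> and \<open>?d1 = r'\<close>. They are jointly monic because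
    \<open>a\<close> and \<open>b\<close> determine \<open>w\<close>.\<close>
  let ?p0 = "pb0 C a a" and ?p1 = "pb1 C a a"
  let ?q0 = "pb0 C (b \<cdot> ?p0) b" and ?q1 = "pb1 C (b \<cdot> ?p0) b"
  let ?w = "?p0 \<cdot> ?q0" and ?d0 = "?q1" and ?d1 = "?p1 \<cdot> ?q0"
  have R: "src C a \<in> ob C" using ab by simp
  have aw: "a \<cdot> (?p0 \<cdot> z) = a \<cdot> (?p1 \<cdot> z)" if "z \<in> ar C" "trg C z = src C ?p0" for z
    using pb_commute[of a a z] that ab by simp
  have bw: "b \<cdot> (?p0 \<cdot> (?q0 \<cdot> z)) = b \<cdot> (?q1 \<cdot> z)" if "z \<in> ar C" "trg C z = src C ?q0" for z
    using pb_commute[of "b \<cdot> ?p0" b z] that ab by simp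
  have "is_relation C (src C a) (?d0, ?d1)"
    unfolding is_relation_def prod.case
  proof (intro conjI allI impI)
    fix Z x y
    assume "x \<in> hom C Z (src C ?d0) \<and> y \<in> hom C Z (src C ?d0) \<and> ?d0 \<cdot> x = ?d0 \<cdot> y \<and> ?d1 \<cdot> x = ?d1 \<cdot> y"
    then have xy: "x \<in> ar C" "y \<in> ar C" "src C x = src C y" "trg C x = src C ?q0" "trg C y = src C ?q0"
      "?q1 \<cdot> x = ?q1 \<cdot> y" "?p1 \<cdot> (?q0 \<cdot> x) = ?p1 \<cdot> (?q0 \<cdot> y)" using ab by auto
    have 1: "a \<cdot> (?p0 \<cdot> (?q0 \<cdot> x)) = a \<cdot> (?p0 \<cdot> (?q0 \<cdot> y))" using aw[of "?q0 \<cdot> x"] aw[of "?q0 \<cdot> y"] xy ab by simp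
    have 2: "b \<cdot> (?p0 \<cdot> (?q0 \<cdot> x)) = b \<cdot> (?p0 \<cdot> (?q0 \<cdot> y))" using bw[of x] bw[of y] xy by simp
    have 3: "?p0 \<cdot> (?q0 \<cdot> x) = ?p0 \<cdot> (?q0 \<cdot> y)"
      by (rule jointly_monicD[OF jm _ _ _ _ _ 1 2]) (use xy ab in simp_all)
    have 4: "?q0 \<cdot> x = ?q0 \<cdot> y"
      by (rule pb_eqI[of a a, OF _ _ _ _ _ _ _ _ 3 xy(7)]) (use xy ab in simp_all)
    show "x = y"
      by (rule pb_eqI[of "b \<cdot> ?p0" b, OF _ _ _ _ _ _ _ _ 4 xy(6)]) (use xy ab in simp_all)
  qed (use ab R in simp_all)
  moreover define e where "e = pb_pair C (b \<cdot> ?p0) b (pb_pair C a a (idt C (src C a)) (idt C (src C a))) (idt C (src C a))"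
  have "e \<in> hom C (src C a) (src C ?d0)" "?d0 \<cdot> e = idt C (src C a)" "?d1 \<cdot> e = idt C (src C a)"
    unfolding e_def using ab R by simp_all
  ultimately have refl: "is_reflexive C (src C a) (?d0, ?d1)" unfolding is_reflexive_def by auto
  \<comment> \<open>The hypotheses make \<open>s\<close> a witness that \<open>r\<close> is related
    to \<open>t\<close>. The witness that \<open>t\<close> is related to \<open>r\<close>, supplied
    by symmetry, is the required \<open>v\<close>.\<close>
  define z where "z = pb_pair C (b \<cdot> ?p0) b (pb_pair C a a s t) r"
  have z: "z \<in> ar C" "src C z = src C r" "trg C z = src C ?d0" "?q0 \<cdot> z = pb_pair C a a s t" "?q1 \<cdot> z = r"
    unfolding z_def using ab rst eq by simp_all
  obtain z' where z': "z' \<in> ar C" "src C z' = src C z" "trg C z' = src C ?d0" "?d0 \<cdot> z' = ?d1 \<cdot> z" "?d1 \<cdot> z' = ?d0 \<cdot> z"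
    using reflexive_symD[OF refl z(1,3)] by blast
  have tz: "trg C z = src C ?q0" "trg C z' = src C ?q0" using z(3) z'(3) ab by simp_all
  have z'': "?q1 \<cdot> z' = t" "?p1 \<cdot> (?q0 \<cdot> z') = r"
    using z'(4,5) z(1,4,5) z'(1) tz ab rst eq by simp_all
  show thesis
  proof (rule that[of "?w \<cdot> z'"])
    show "a \<cdot> (?w \<cdot> z') = a \<cdot> r" using aw[of "?q0 \<cdot> z'"] z'(1) z'' tz ab by simp
    show "b \<cdot> (?w \<cdot> z') = b \<cdot> t" using bw[of z'] z'(1) z'' tz ab by simp
  qed (use ab z' z tz in simp_all)
qed

end

section \<open>Internal categories cut out by jointly monic legs\<close>

context fixed_objects
begin

lemma cpair_cp:
  assumes A: "icat A" and v: "v \<in> ar E" "trg E v = src E (cp0 E A)"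
  shows "icomp E A (cp0 E A \<cdot> v) (cp1 E A \<cdot> v) = icmp A \<cdot> v"
proof -
  have "icod A \<cdot> (cp0 E A \<cdot> v) = idom A \<cdot> (cp1 E A \<cdot> v)" using A v by (simp add: pb_commute)
  then have "cpair E A (cp0 E A \<cdot> v) (cp1 E A \<cdot> v) = v"
    by (intro pb_pair_unique) (use A v in simp_all)
  then show ?thesis unfolding icomp_def by simp
qed

lemma composable_cp:
  assumes A: "icat A" and v: "v \<in> ar E" "trg E v = src E (cp0 E A)"
  shows "composable E A (cp0 E A \<cdot> v) (cp1 E A \<cdot> v)"
  using A v by (simp add: pb_commute)

text \<open>Joint monicity makes the composite in \<open>W\<close> unique once it exists, and every
  law of a category holds in \<open>W\<close> because it holds after \<open>p\<close> in
  \<open>A\<close> and after \<open>q\<close> in \<open>B\<close>. Pullbacks use this with two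
  different legs, subobjects with the same monomorphism taken twice.\<close>

lemma icat_of_legs:
  assumes AB: "icat A" "icat B" and p: "p \<in> hom E W (arr_ob E A)" and q: "q \<in> hom E W (arr_ob E B)"
    and jm: "jointly_monic E p q"
    and dq: "idom B \<cdot> q = idom A \<cdot> p" and cq: "icod B \<cdot> q = icod A \<cdot> p"
    and e: "e \<in> hom E X W" "p \<cdot> e = iunit A" "q \<cdot> e = iunit B"
    and lift: "\<And>x y. x \<in> ar E \<Longrightarrow> y \<in> ar E \<Longrightarrow> trg E x = W \<Longrightarrow> trg E y = W \<Longrightarrow> src E x = src E y \<Longrightarrow>
      icod A \<cdot> (p \<cdot> x) = idom A \<cdot> (p \<cdot> y) \<Longrightarrow> icod B \<cdot> (q \<cdot> x) = idom B \<cdot> (q \<cdot> y) \<Longrightarrow>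
      \<exists>z \<in> hom E (src E x) W. p \<cdot> z = icomp E A (p \<cdot> x) (p \<cdot> y) \<and> q \<cdot> z = icomp E B (q \<cdot> x) (q \<cdot> y)"
  obtains D where "icat D" "idom D = idom A \<cdot> p" "icod D = icod A \<cdot> p" "iunit D = e" "arr_ob E D = W"
    "ifun D A p" "ifun D B q"
proof -
  have ty: "p \<in> ar E" "src E p = W" "trg E p = arr_ob E A" "q \<in> ar E" "src E q = W" "trg E q = arr_ob E B"
    "e \<in> ar E" "src E e = X" "trg E e = W" using p q e by simp_all
  \<comment> \<open>An arbitrary choice is harmless here: the two equations determine the composite,
    and for the same reason \<open>M\<close> is natural.\<close>
  define M where "M x y = (SOME z. z \<in> hom E (src E x) W \<and> p \<cdot> z = icomp E A (p \<cdot> x) (p \<cdot> y) \<and>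
    q \<cdot> z = icomp E B (q \<cdot> x) (q \<cdot> y))" for x y
  have q': "idom B \<cdot> (q \<cdot> x) = idom A \<cdot> (p \<cdot> x)" "icod B \<cdot> (q \<cdot> x) = icod A \<cdot> (p \<cdot> x)"
    if "x \<in> ar E" "trg E x = W" for x
    using that ty AB by (simp_all add: cmp_reassoc[OF dq] cmp_reassoc[OF cq])
  have e': "p \<cdot> (e \<cdot> x) = iunit A \<cdot> x" "q \<cdot> (e \<cdot> x) = iunit B \<cdot> x"
    if "x \<in> ar E" "trg E x = X" for x
    using that ty AB by (simp_all add: cmp_reassoc[OF e(2)] cmp_reassoc[OF e(3)])
  have M: "M x y \<in> ar E" "src E (M x y) = src E y" "trg E (M x y) = W" "p \<cdot> M x y = icomp E A (p \<cdot> x) (p \<cdot> y)"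
    "q \<cdot> M x y = icomp E B (q \<cdot> x) (q \<cdot> y)"
    if h: "x \<in> ar E" "y \<in> ar E" "trg E x = W" "trg E y = W" "src E x = src E y"
      "icod A \<cdot> (p \<cdot> x) = idom A \<cdot> (p \<cdot> y)" for x y
  proof -
    have "icod B \<cdot> (q \<cdot> x) = idom B \<cdot> (q \<cdot> y)" using h q' by simp
    from lift[OF h this]
    have "\<exists>z. z \<in> hom E (src E x) W \<and> p \<cdot> z = icomp E A (p \<cdot> x) (p \<cdot> y) \<and> q \<cdot> z = icomp E B (q \<cdot> x) (q \<cdot> y)"
      by blast
    from someI_ex[OF this] h(5) show "M x y \<in> ar E" "src E (M x y) = src E y" "trg E (M x y) = W"
      "p \<cdot> M x y = icomp E A (p \<cdot> x) (p \<cdot> y)" "q \<cdot> M x y = icomp E B (q \<cdot> x) (q \<cdot> y)"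
      unfolding M_def by simp_all
  qed
  have eqI: "x = y" if h: "x \<in> ar E" "y \<in> ar E" "src E x = src E y" "trg E x = W" "trg E y = W"
    "p \<cdot> x = p \<cdot> y" "q \<cdot> x = q \<cdot> y" for x y
    by (rule jointly_monicD[OF jm]) (use h ty in simp_all)
  have de: "(idom A \<cdot> p) \<cdot> e = idt E X" "(icod A \<cdot> p) \<cdot> e = idt E X"
    using AB ty e(2) by simp_all
  obtain D where D: "icat D" "idom D = idom A \<cdot> p" "icod D = icod A \<cdot> p" "iunit D = e"
    "\<And>x y. composable E D x y \<Longrightarrow> icomp E D x y = M x y"
  proof (rule internal_category_ofI[of "idom A \<cdot> p" W "icod A \<cdot> p" e M])
    fix f g
    assume h: "f \<in> ar E" "g \<in> ar E" "trg E f = W" "trg E g = W" "src E f = src E g"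
      and c: "(icod A \<cdot> p) \<cdot> f = (idom A \<cdot> p) \<cdot> g"
    have c': "icod A \<cdot> (p \<cdot> f) = idom A \<cdot> (p \<cdot> g)" using c h ty AB by simp
    note Mfg = M[OF h c']
    show "M f g \<in> hom E (src E f) W \<and> (idom A \<cdot> p) \<cdot> M f g = (idom A \<cdot> p) \<cdot> f \<and>
        (icod A \<cdot> p) \<cdot> M f g = (icod A \<cdot> p) \<cdot> g"
      using Mfg h ty AB c' by simp
    have c2: "icod B \<cdot> (q \<cdot> f) = idom B \<cdot> (q \<cdot> g)" using h q' c' by simp
    {
      fix k assume k: "k \<in> ar E" "trg E k = src E f"
      have ck: "icod A \<cdot> (p \<cdot> (f \<cdot> k)) = idom A \<cdot> (p \<cdot> (g \<cdot> k))"
        using composable_natural[of A "p \<cdot> f" "p \<cdot> g" k] AB h ty c' k by simp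
      show "M f g \<cdot> k = M (f \<cdot> k) (g \<cdot> k)"
        by (rule eqI) (use Mfg h k ck c' c2 ty AB in \<open>simp_all add: M cmp_reassoc[OF Mfg(4)] cmp_reassoc[OF Mfg(5)]\<close>)
    }
    fix u
    assume h': "u \<in> ar E" "trg E u = W" "src E g = src E u" and cu: "(icod A \<cdot> p) \<cdot> g = (idom A \<cdot> p) \<cdot> u"
    have cu': "icod A \<cdot> (p \<cdot> g) = idom A \<cdot> (p \<cdot> u)" using cu h h' ty AB by simp
    have cu2: "icod B \<cdot> (q \<cdot> g) = idom B \<cdot> (q \<cdot> u)" using h h' q' cu' by simp
    note Mgu = M[OF h(2) h'(1) h(4) h'(2,3) cu']
    have m1: "icod A \<cdot> (p \<cdot> M f g) = idom A \<cdot> (p \<cdot> u)" using Mfg(1-4) h h' ty AB c' cu' by simp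
    have m2: "icod A \<cdot> (p \<cdot> f) = idom A \<cdot> (p \<cdot> M g u)" using Mgu(1-4) h h' ty AB c' cu' by simp
    have s1: "src E (M f g) = src E u" "src E f = src E (M g u)" using Mfg(2) Mgu(2) h h' by simp_all
    note n1 = M[OF Mfg(1) h'(1) Mfg(3) h'(2) s1(1) m1] and n2 = M[OF h(1) Mgu(1) h(3) Mgu(3) s1(2) m2]
    have a: "icomp E A (icomp E A (p \<cdot> f) (p \<cdot> g)) (p \<cdot> u) = icomp E A (p \<cdot> f) (icomp E A (p \<cdot> g) (p \<cdot> u))"
      by (rule icomp_assoc) (use AB h h' ty c' cu' in simp_all)
    have b: "icomp E B (icomp E B (q \<cdot> f) (q \<cdot> g)) (q \<cdot> u) = icomp E B (q \<cdot> f) (icomp E B (q \<cdot> g) (q \<cdot> u))"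
      by (rule icomp_assoc) (use AB h h' ty c2 cu2 in simp_all)
    show "M (M f g) u = M f (M g u)"
      by (rule eqI) (use n1 n2 Mfg Mgu a b s1 in simp_all)
  next
    fix f assume h: "f \<in> ar E" "trg E f = W"
    show "M (e \<cdot> ((idom A \<cdot> p) \<cdot> f)) f = f"
      by (rule eqI) (use h ty AB q' in \<open>simp_all add: M e' icomp_iunit_left\<close>)
    show "M f (e \<cdot> ((icod A \<cdot> p) \<cdot> f)) = f"
      by (rule eqI) (use h ty AB q' in \<open>simp_all add: M e' icomp_iunit_right\<close>)
  qed (use ty AB de in simp_all)
  have Wo: "arr_ob E D = W" using D ty AB by simp
  have c: "icomp E D x y = M x y \<and> icod A \<cdot> (p \<cdot> x) = idom A \<cdot> (p \<cdot> y) \<and>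
      x \<in> ar E \<and> y \<in> ar E \<and> trg E x = W \<and> trg E y = W \<and> src E x = src E y" if "composable E D x y" for x y
  proof -
    have h: "x \<in> ar E" "y \<in> ar E" "trg E x = W" "trg E y = W" "src E x = src E y"
      "(icod A \<cdot> p) \<cdot> x = (idom A \<cdot> p) \<cdot> y" using that D(2,3) Wo by simp_all
    then have "icod A \<cdot> (p \<cdot> x) = idom A \<cdot> (p \<cdot> y)" using ty AB by simp
    with h(1-5) D(5)[OF that] show ?thesis by blast
  qed
  have p_fun: "ifun D A p"
  proof (rule ifunI)
    fix f g assume fg: "composable E D f g"
    have "p \<cdot> M f g = icomp E A (p \<cdot> f) (p \<cdot> g)" by (rule M(4)) (use c[OF fg] in blast)+
    with c[OF fg] show "p \<cdot> icomp E D f g = icomp E A (p \<cdot> f) (p \<cdot> g)" by simp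
  qed (use D(1-4) Wo AB ty e in simp_all)
  have q_fun: "ifun D B q"
  proof (rule ifunI)
    fix f g assume fg: "composable E D f g"
    have "q \<cdot> M f g = icomp E B (q \<cdot> f) (q \<cdot> g)" by (rule M(5)) (use c[OF fg] in blast)+
    with c[OF fg] show "q \<cdot> icomp E D f g = icomp E B (q \<cdot> f) (q \<cdot> g)" by simp
  qed (use D(1-4) Wo AB ty e dq cq in simp_all)
  show thesis by (rule that[OF D(1-4) Wo p_fun q_fun])
qed

end

section \<open>Cancellation, inverses and closure under composition\<close>

locale maltsev_fixed_objects = fixed_objects E X + maltsev_category E
  for E :: "('o, 'm) cat_data" (structure) and X
begin

text \<open>A composable pair \<open>(f, g)\<close> with composite \<open>h\<close> is regarded as
  relating the pair \<open>(f, h)\<close> to \<open>g\<close>. Difunctionality of this relation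
  turns the equality of the two composites into a triangle whose first side is an identity, whose
  second side is \<open>g'\<close> and whose composite is \<open>g\<close>.\<close>

lemma icomp_right_cancel:
  assumes A: "icat A" and fg: "composable E A f g" and fg': "composable E A f g'"
    and eq: "icomp E A f g = icomp E A f g'"
  shows "g = g'"
proof -
  let ?a = "prod_pair E (cp0 E A) (icmp A)" and ?b = "cp1 E A"
  let ?O = "arr_ob E A" and ?x = "idom A \<cdot> g"
  let ?i = "iunit A \<cdot> ?x"
  have c: "icod A \<cdot> cp0 E A = idom A \<cdot> cp1 E A" using A by (simp add: pb_commute0)
  have jm: "jointly_monic E ?a ?b"
    unfolding jointly_monic_def
  proof (intro allI impI)
    fix Z x y assume "x \<in> hom E Z (src E ?a) \<and> y \<in> hom E Z (src E ?a) \<and> ?a \<cdot> x = ?a \<cdot> y \<and> ?b \<cdot> x = ?b \<cdot> y"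
    then have xy: "x \<in> ar E" "y \<in> ar E" "src E x = src E y" "trg E x = src E (cp0 E A)" "trg E y = src E (cp0 E A)"
      "?a \<cdot> x = ?a \<cdot> y" "?b \<cdot> x = ?b \<cdot> y" using A by auto
    have "pr0 E ?O ?O \<cdot> (?a \<cdot> x) = pr0 E ?O ?O \<cdot> (?a \<cdot> y)" using xy(6) by simp
    then have 1: "cp0 E A \<cdot> x = cp0 E A \<cdot> y" using xy(1-5) A by simp
    show "x = y" by (rule pb_eqI[of "icod A" "idom A", OF _ _ _ _ _ _ _ _ 1 xy(7)]) (use xy A in simp_all)
  qed
  have i: "icomp E A ?i g = g" "icomp E A ?i g' = g'" using A fg fg' by (simp_all add: icomp_iunit_left)
  have icm: "icmp A \<cdot> cpair E A x y = icomp E A x y" for x y unfolding icomp_def by simp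
  \<comment> \<open>With \<open>?i\<close> the identity at the domain of \<open>g\<close>:
    \<open>?r\<close> and \<open>?s\<close> share the second side \<open>g\<close>, while
    \<open>?s\<close> and \<open>?t\<close> share the first side \<open>f\<close> and, by
    hypothesis, the composite. The resulting element has the first side and composite
    \<open>(?i, g)\<close> of \<open>?r\<close> and the second side \<open>g'\<close> of
    \<open>?t\<close>.\<close>
  let ?r = "cpair E A ?i g" and ?s = "cpair E A f g" and ?t = "cpair E A f g'"
  have dg: "idom A \<cdot> g' = ?x" using fg fg' by simp
  have e: "?a \<cdot> ?r = prod_pair E ?i g" "?a \<cdot> ?s = ?a \<cdot> ?t"
    using A fg fg' i eq dg by (simp_all add: prod_pair_natural icm)
  obtain v where v: "v \<in> ar E" "src E v = src E ?r" "trg E v = src E ?a" "?a \<cdot> v = ?a \<cdot> ?r" "?b \<cdot> v = ?b \<cdot> ?t"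
    by (rule difunctional[OF _ _ _ jm, of ?r ?s ?t]) (use A fg fg' e(2) in simp_all)
  have v3: "trg E v = src E (cp0 E A)" using v A by simp
  have "pr0 E ?O ?O \<cdot> (?a \<cdot> v) = ?i" unfolding v(4) e(1) using A fg by simp
  then have 0: "cp0 E A \<cdot> v = ?i" using v(1) v3 A by simp
  have "pr1 E ?O ?O \<cdot> (?a \<cdot> v) = g" unfolding v(4) e(1) using A fg by simp
  then have 1: "icmp A \<cdot> v = g" using v(1) v3 A by simp
  have "cp1 E A \<cdot> v = g'" using v(5) fg fg' A dg by simp
  with 0 1 cpair_cp[OF A v(1) v3] i(2) show ?thesis by simp
qed

text \<open>By cancellation the first side and the composite of a triangle determine the second
  side, so they form a relation. Difunctionality is applied to \<open>f\<close> followed by an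
  identity, an identity followed by \<open>f\<close>, and an identity followed by itself. The first
  two have composite \<open>f\<close> and the last two have an identity as first side, so there is a
  triangle with first side \<open>f\<close> whose composite is an identity.\<close>

lemma left_inverse_exists:
  assumes A: "icat A" and f: "f \<in> ar E" "trg E f = arr_ob E A"
  obtains g where "composable E A f g" "icomp E A f g = iunit A \<cdot> (idom A \<cdot> f)"
proof -
  let ?a = "cp0 E A" and ?b = "icmp A"
  have jm: "jointly_monic E ?a ?b"
    unfolding jointly_monic_def
  proof (intro allI impI)
    fix Z x y assume xy': "x \<in> hom E Z (src E ?a) \<and> y \<in> hom E Z (src E ?a) \<and> ?a \<cdot> x = ?a \<cdot> y \<and> ?b \<cdot> x = ?b \<cdot> y"
    then have xy: "x \<in> ar E" "y \<in> ar E" "src E x = src E y" "trg E x = src E ?a" "trg E y = src E ?a" by auto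
    have "cp1 E A \<cdot> x = cp1 E A \<cdot> y"
      by (rule icomp_right_cancel[OF A, of "?a \<cdot> x"])
        (use xy' xy composable_cp[OF A, of x] composable_cp[OF A, of y] cpair_cp[OF A, of x] cpair_cp[OF A, of y] in auto)
    with xy xy' A show "x = y" by - (rule pb_eqI[of "icod A" "idom A"], simp_all)
  qed
  let ?i = "iunit A \<cdot> (idom A \<cdot> f)" and ?j = "iunit A \<cdot> (icod A \<cdot> f)"
  have icm: "icmp A \<cdot> cpair E A x y = icomp E A x y" for x y unfolding icomp_def by simp
  obtain v where v: "v \<in> ar E" "src E v = src E (cpair E A f ?j)" "trg E v = src E ?a"
    "?a \<cdot> v = ?a \<cdot> cpair E A f ?j" "?b \<cdot> v = ?b \<cdot> cpair E A ?i ?i"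
    by (rule difunctional[OF _ _ _ jm, of "cpair E A f ?j" "cpair E A ?i f" "cpair E A ?i ?i"])
      (use A f in \<open>simp_all add: icm icomp_iunit_left icomp_iunit_right\<close>)
  have 1: "cp0 E A \<cdot> v = f" using v(4) A f by simp
  have 2: "icmp A \<cdot> v = ?i" using v(5) A f by (simp add: icm icomp_iunit_left)
  show thesis
    using that[of "cp1 E A \<cdot> v"] composable_cp[OF A v(1,3)] cpair_cp[OF A v(1,3)] unfolding 1 2 by blast
qed

text \<open>The usual argument for monoids: \<open>g\<close> is a left inverse of \<open>f\<close>
  and \<open>h\<close> one of \<open>g\<close>; associativity gives \<open>h = f\<close>, so
  \<open>g\<close> is inverse to \<open>f\<close> on both sides.\<close>

lemma inverse_exists:
  assumes A: "icat A" and f: "f \<in> ar E" "trg E f = arr_ob E A"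
  obtains g where "composable E A f g" "composable E A g f"
    "icomp E A f g = iunit A \<cdot> (idom A \<cdot> f)" "icomp E A g f = iunit A \<cdot> (icod A \<cdot> f)"
proof -
  obtain g where g: "composable E A f g" "icomp E A f g = iunit A \<cdot> (idom A \<cdot> f)"
    using left_inverse_exists[OF A f] by blast
  obtain h where h: "composable E A g h" "icomp E A g h = iunit A \<cdot> (idom A \<cdot> g)"
    using left_inverse_exists[OF A, of g] g by blast
  have cg: "icod A \<cdot> g = idom A \<cdot> f" using icod_icomp[OF A g(1)] g(2) A f by simp
  have "icomp E A (icomp E A f g) h = icomp E A f (icomp E A g h)" by (rule icomp_assoc[OF A g(1) h(1)])
  then have "h = f"
    using A f g(1) h(1) cg unfolding g(2) h(2) by (simp add: icomp_iunit_left icomp_iunit_right)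
  with g h cg f that[of g] show thesis by simp
qed

text \<open>The inverse of the generic arrow, that is, of the identity on the object of arrows, is
  the inversion map.\<close>

lemma internal_category_is_groupoid:
  assumes A: "icat A"
  shows "internal_groupoid E X A"
proof -
  let ?o = "idt E (arr_ob E A)"
  have o: "?o \<in> ar E" "trg E ?o = arr_ob E A" using A by simp_all
  obtain j where j: "composable E A ?o j" "composable E A j ?o"
    "icomp E A ?o j = iunit A \<cdot> (idom A \<cdot> ?o)" "icomp E A j ?o = iunit A \<cdot> (icod A \<cdot> ?o)"
    using inverse_exists[OF A o] by metis
  have t: "j \<in> ar E" "src E j = arr_ob E A" "trg E j = arr_ob E A" "icod A = idom A \<cdot> j" "icod A \<cdot> j = idom A"
    using j(1,2) A by simp_all
  have "icmp A \<cdot> cpair E A ?o j = iunit A \<cdot> idom A" "icmp A \<cdot> cpair E A j ?o = iunit A \<cdot> icod A"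
    using j(3,4) A unfolding icomp_def by simp_all
  with A t(1-3,5) t(4)[symmetric] show ?thesis unfolding internal_groupoid_def by (intro conjI bexI[of _ j]) simp_all
qed

text \<open>The composable pairs whose composite factors through \<open>w\<close> form a relation
  between first and second sides. It contains \<open>w x\<close> followed by an identity, an
  identity followed by itself, and an identity followed by \<open>w y\<close>; difunctionality then
  puts the pair \<open>(w x, w y)\<close> in it.\<close>

lemma monic_closed_under_icomp:
  assumes A: "icat A" and w: "monic E w" "trg E w = arr_ob E A"
    and e: "e \<in> ar E" "src E e = X" "trg E e = src E w" "w \<cdot> e = iunit A"
    and xy: "x \<in> ar E" "y \<in> ar E" "trg E x = src E w" "trg E y = src E w" "src E x = src E y"
      "icod A \<cdot> (w \<cdot> x) = idom A \<cdot> (w \<cdot> y)"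
  obtains z where "z \<in> ar E" "src E z = src E x" "trg E z = src E w" "w \<cdot> z = icomp E A (w \<cdot> x) (w \<cdot> y)"
proof -
  have wa: "w \<in> ar E" using w unfolding monic_def by simp
  let ?q0 = "pb0 E (icmp A) w" and ?q1 = "pb1 E (icmp A) w"
  let ?a = "cp0 E A \<cdot> ?q0" and ?b = "cp1 E A \<cdot> ?q0"
  have com: "icmp A \<cdot> (?q0 \<cdot> v) = w \<cdot> (?q1 \<cdot> v)" if "v \<in> ar E" "trg E v = src E ?q0" for v
    using that A w wa by (simp add: pb_commute)
  have jm: "jointly_monic E ?a ?b"
    unfolding jointly_monic_def
  proof (intro allI impI)
    fix Z u v assume "u \<in> hom E Z (src E ?a) \<and> v \<in> hom E Z (src E ?a) \<and> ?a \<cdot> u = ?a \<cdot> v \<and> ?b \<cdot> u = ?b \<cdot> v"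
    then have uv: "u \<in> ar E" "v \<in> ar E" "src E u = src E v" "trg E u = src E ?q0" "trg E v = src E ?q0"
      "cp0 E A \<cdot> (?q0 \<cdot> u) = cp0 E A \<cdot> (?q0 \<cdot> v)" "cp1 E A \<cdot> (?q0 \<cdot> u) = cp1 E A \<cdot> (?q0 \<cdot> v)" using A w wa by auto
    have 1: "?q0 \<cdot> u = ?q0 \<cdot> v"
      by (rule pb_eqI[of "icod A" "idom A", OF _ _ _ _ _ _ _ _ uv(6,7)]) (use uv(1-5) A w wa in simp_all)
    have "w \<cdot> (?q1 \<cdot> u) = w \<cdot> (?q1 \<cdot> v)" using com[of u] com[of v] 1 uv(1-5) by simp
    then have 2: "?q1 \<cdot> u = ?q1 \<cdot> v" by - (rule monicD[OF w(1)], use uv(1-5) A w wa in simp_all)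
    show "u = v" by (rule pb_eqI[of "icmp A" w, OF _ _ _ _ _ _ _ _ 1 2]) (use uv(1-5) A w wa in simp_all)
  qed
  let ?m = "icod A \<cdot> (w \<cdot> x)"
  let ?i = "iunit A \<cdot> ?m"
  have e': "w \<cdot> (e \<cdot> k) = iunit A \<cdot> k" if "k \<in> ar E" "trg E k = X" for k
    using that e wa by (simp add: cmp_reassoc[OF e(4)])
  have icm: "icmp A \<cdot> cpair E A x y = icomp E A x y" for x y unfolding icomp_def by simp
  have ii: "icomp E A (w \<cdot> x) ?i = w \<cdot> x" "icomp E A ?i ?i = ?i" "icomp E A ?i (w \<cdot> y) = w \<cdot> y"
    using A w wa xy by (simp_all add: icomp_iunit_left icomp_iunit_right)
  \<comment> \<open>The middle element \<open>s\<close> is where \<open>e\<close> enters: the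
    identity at the common object has to factor through \<open>w\<close>. Consecutive elements share
    a side equal to this identity, namely the second side for \<open>r\<close> and \<open>s\<close>
    and the first side for \<open>s\<close> and \<open>t\<close>.\<close>
  define r s t where "r = pb_pair E (icmp A) w (cpair E A (w \<cdot> x) ?i) x"
    and "s = pb_pair E (icmp A) w (cpair E A ?i ?i) (e \<cdot> ?m)"
    and "t = pb_pair E (icmp A) w (cpair E A ?i (w \<cdot> y)) y"
  have r: "r \<in> ar E" "src E r = src E x" "trg E r = src E ?q0" "?q0 \<cdot> r = cpair E A (w \<cdot> x) ?i"
    unfolding r_def using A w wa xy(1-5) ii by (simp_all add: icm)
  have s: "s \<in> ar E" "src E s = src E x" "trg E s = src E ?q0" "?q0 \<cdot> s = cpair E A ?i ?i"
    unfolding s_def using A w wa xy(1-5) e(1-3) ii by (simp_all add: icm e')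
  have t: "t \<in> ar E" "src E t = src E x" "trg E t = src E ?q0" "?q0 \<cdot> t = cpair E A ?i (w \<cdot> y)"
    unfolding t_def using A w wa xy ii by (simp_all add: icm)
  obtain v where v: "v \<in> ar E" "src E v = src E r" "trg E v = src E ?a" "?a \<cdot> v = ?a \<cdot> r" "?b \<cdot> v = ?b \<cdot> t"
    by (rule difunctional[OF _ _ _ jm, of r s t]) (use A w wa xy r s t in simp_all)
  have v3: "trg E v = src E ?q0" using v A w wa by simp
  have "cp0 E A \<cdot> (?q0 \<cdot> v) = w \<cdot> x" using v(1,4) v3 r A w wa xy by simp
  moreover have "cp1 E A \<cdot> (?q0 \<cdot> v) = w \<cdot> y" using v(1,5) v3 t A w wa xy by simp
  ultimately have "icmp A \<cdot> (?q0 \<cdot> v) = icomp E A (w \<cdot> x) (w \<cdot> y)"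
    using cpair_cp[OF A, of "?q0 \<cdot> v"] v(1) v3 A w wa by simp
  with com[OF v(1) v3] v v3 r A w wa show thesis by (intro that[of "?q1 \<cdot> v"]) simp_all
qed

end

section \<open>The fibre of internal categories\<close>

abbreviation mor :: "'m icat \<times> 'm \<times> 'm icat \<Rightarrow> 'm" where
  "mor f \<equiv> fst (snd f)"

lemma src_Cat [simp]: "src (Cat E X) f = fst f"
  and trg_Cat [simp]: "trg (Cat E X) f = snd (snd f)"
  and idt_Cat [simp]: "idt (Cat E X) A = (A, idt E (arr_ob E A), A)"
  and cmp_Cat [simp]: "g \<cdot>\<^bsub>Cat E X\<^esub> f = (fst f, mor g \<cdot>\<^bsub>E\<^esub> mor f, snd (snd g))"
  and ob_Cat [simp]: "A \<in> ob (Cat E X) \<longleftrightarrow> internal_category E X A"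
  and ar_Cat [simp]: "f \<in> ar (Cat E X) \<longleftrightarrow> internal_category E X (fst f) \<and> internal_category E X (snd (snd f)) \<and>
    internal_functor E (fst f) (snd (snd f)) (mor f)"
  by (simp_all add: Cat_def split: prod.splits)

lemma Cat_eqI: "fst f = fst g \<Longrightarrow> mor f = mor g \<Longrightarrow> snd (snd f) = snd (snd g) \<Longrightarrow> f = g"
  by (simp add: prod_eq_iff)

context fixed_objects
begin

lemma Cat_mor:
  assumes "f \<in> ar (Cat E X)"
  shows "mor f \<in> ar E" "src E (mor f) = arr_ob E (fst f)" "trg E (mor f) = arr_ob E (snd (snd f))"
    "icat (fst f)" "icat (snd (snd f))" "ifun (fst f) (snd (snd f)) (mor f)"
  using assms ifun_simps(1-3)[of "fst f" "snd (snd f)" "mor f"] by simp_all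

abbreviation cmp_fibre (infixr "\<bullet>" 75) where
  "g \<bullet> f \<equiv> g \<cdot>\<^bsub>Cat E X\<^esub> f"

lemma category_Cat: "category (Cat E X)"
proof
  fix f :: "'m icat \<times> 'm \<times> 'm icat" and A B
  assume "f \<in> hom (Cat E X) A B"
  then have f: "f \<in> ar (Cat E X)" "fst f = A" "snd (snd f) = B" by (simp_all only: hom_iff src_Cat trg_Cat)
  note m = Cat_mor[OF f(1)]
  show "f \<bullet> idt (Cat E X) A = f" "idt (Cat E X) B \<bullet> f = f"
    by (rule Cat_eqI; use m f(2,3) in simp)+
  fix g D assume "g \<in> hom (Cat E X) B D"
  then have g: "g \<in> ar (Cat E X)" "fst g = B" "snd (snd g) = D" by (simp_all only: hom_iff src_Cat trg_Cat)
  note n = Cat_mor[OF g(1)]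
  show "g \<bullet> f \<in> hom (Cat E X) A D"
    using m n f g ifun_cmp[of A B "mor f" D "mor g"] by simp
  fix h F assume "h \<in> hom (Cat E X) D F"
  then have h: "h \<in> ar (Cat E X)" "fst h = D" "snd (snd h) = F" by (simp_all only: hom_iff src_Cat trg_Cat)
  note k = Cat_mor[OF h(1)]
  show "h \<bullet> (g \<bullet> f) = (h \<bullet> g) \<bullet> f"
    by (rule Cat_eqI) (use m n k f(2,3) g(2,3) h(2,3) in simp_all)
qed (simp_all add: ifun_idt)

section \<open>Limits in the fibre\<close>

interpretation Cat: category "Cat E X"
  by (rule category_Cat)

text \<open>In the indiscrete category the arrows are pairs of objects, \<open>(x, y)\<close>
  followed by \<open>(y, z)\<close> is \<open>(x, z)\<close>, and each law is checked on the two
  projections. It provides the terminal object of the fibre.\<close>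

lemma indiscrete_exists:
  obtains N where "icat N" "idom N = pr0 E X X" "icod N = pr1 E X X"
proof -
  let ?W = "src E (pr0 E X X)" and ?p = "pr0 E X X" and ?q = "pr1 E X X"
  let ?M = "\<lambda>f g. prod_pair E (?p \<cdot> f) (?q \<cdot> g)"
  have W: "?W \<in> ob E" by simp
  have eqI: "f = g" if "f \<in> ar E" "g \<in> ar E" "src E f = src E g" "trg E f = ?W" "trg E g = ?W"
    "?p \<cdot> f = ?p \<cdot> g" "?q \<cdot> f = ?q \<cdot> g" for f g
    by (rule prod_eqI[of X X]) (use that in simp_all)
  show thesis
  proof (rule internal_category_ofI[of ?p ?W ?q "prod_pair E (idt E X) (idt E X)" ?M])
    fix f g k assume "f \<in> ar E" "g \<in> ar E" "trg E f = ?W" "trg E g = ?W" "src E f = src E g" "k \<in> ar E" "trg E k = src E f"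
    then show "?M f g \<cdot> k = ?M (f \<cdot> k) (g \<cdot> k)" by (simp add: prod_pair_natural)
  next
    fix f assume f: "f \<in> ar E" "trg E f = ?W"
    show "?M (prod_pair E (idt E X) (idt E X) \<cdot> (?p \<cdot> f)) f = f"
      by (rule eqI) (use f in simp_all)
    show "?M f (prod_pair E (idt E X) (idt E X) \<cdot> (?q \<cdot> f)) = f"
      by (rule eqI) (use f in simp_all)
  qed (use that in simp_all)
qed

text \<open>A functor into the indiscrete category has to be the pair of \<open>idom\<close> and
  \<open>icod\<close>, and it preserves units and composites because arrows there are determined by
  their ends. The explicit form of this arrow is what later exhibits products of the fibre as
  pullbacks over \<open>X \<times> X\<close>.\<close>

lemma Cat_terminal_exists:
  obtains N where "Cat.is_terminal N" "icat N" "idom N = pr0 E X X" "icod N = pr1 E X X"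
    "\<And>A. icat A \<Longrightarrow> (A, prod_pair E (idom A) (icod A), N) \<in> hom (Cat E X) A N"
proof -
  obtain N where N: "icat N" "idom N = pr0 E X X" "icod N = pr1 E X X" by (rule indiscrete_exists)
  have eqI: "f = g" if "f \<in> ar E" "g \<in> ar E" "src E f = src E g" "trg E f = arr_ob E N" "trg E g = arr_ob E N"
    "idom N \<cdot> f = idom N \<cdot> g" "icod N \<cdot> f = icod N \<cdot> g" for f g
    by (rule prod_eqI[of X X]) (use that N in simp_all)
  have F: "ifun A N (prod_pair E (idom A) (icod A))" if A: "icat A" for A
  proof -
    let ?F = "prod_pair E (idom A) (icod A)"
    have ty: "?F \<in> ar E" "src E ?F = arr_ob E A" "trg E ?F = arr_ob E N" using A N by simp_all
    have dc: "idom N \<cdot> ?F = idom A" "icod N \<cdot> ?F = icod A" using A N by simp_all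
    have dc': "idom N \<cdot> (?F \<cdot> x) = idom A \<cdot> x" "icod N \<cdot> (?F \<cdot> x) = icod A \<cdot> x"
      if "x \<in> ar E" "trg E x = arr_ob E A" for x
      using that ty N(1) by (simp_all add: cmp_reassoc[OF dc(1)] cmp_reassoc[OF dc(2)])
    show ?thesis
    proof (rule ifunI)
      show "?F \<cdot> iunit A = iunit N" by (rule eqI) (use ty A N(1) in \<open>simp_all add: dc'\<close>)
      fix f g assume c: "composable E A f g"
      then show "?F \<cdot> icomp E A f g = icomp E N (?F \<cdot> f) (?F \<cdot> g)"
        by - (rule eqI, use ty A N(1) in \<open>simp_all add: dc'\<close>)
    qed (use A N(1) ty dc in simp_all)
  qed
  have h: "(A, prod_pair E (idom A) (icod A), N) \<in> hom (Cat E X) A N" if "icat A" for A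
    using F[OF that] N(1) that by simp
  have "Cat.is_terminal N"
    unfolding Cat.is_terminal_def
  proof (intro conjI ballI)
    show "N \<in> ob (Cat E X)" using N by simp
    fix A assume "A \<in> ob (Cat E X)"
    then have A: "icat A" by simp
    show "\<exists>!t. t \<in> hom (Cat E X) A N"
    proof (rule ex1I)
      show "(A, prod_pair E (idom A) (icod A), N) \<in> hom (Cat E X) A N" by (rule h[OF A])
      fix t assume t: "t \<in> hom (Cat E X) A N"
      then have t': "fst t = A" "snd (snd t) = N" "ifun A N (mor t)" by auto
      note s = ifun_simps[OF t'(3) A N(1)] and k = ifun_simps[OF F[OF A] A N(1)]
      have "mor t = prod_pair E (idom A) (icod A)"
        by (rule eqI) (simp_all add: s(1-5) k(1-5))
      with t' show "t = (A, prod_pair E (idom A) (icod A), N)" by (simp add: prod_eq_iff)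
    qed
  qed
  then show thesis using that[OF _ N h] by blast
qed

lemma Cat_liftI:
  assumes Z: "Z \<in> ar (Cat E X)" "snd (snd Z) = B" and Y: "Y \<in> ar (Cat E X)" "snd (snd Y) = D" "fst Y = fst Z"
    and p: "p \<in> ar (Cat E X)" "snd (snd p) = B" and q: "q \<in> ar (Cat E X)" "snd (snd q) = D" "fst q = fst p"
    and jm: "jointly_monic E (mor p) (mor q)"
    and h: "h \<in> ar E" "src E h = arr_ob E (fst Z)" "trg E h = arr_ob E (fst p)"
      "mor p \<cdot> h = mor Z" "mor q \<cdot> h = mor Y"
  shows "(fst Z, h, fst p) \<in> ar (Cat E X)"
proof -
  note z = Cat_mor[OF Z(1)] and y = Cat_mor[OF Y(1)] and p' = Cat_mor[OF p(1)] and q' = Cat_mor[OF q(1)]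
  have "ifun (fst Z) (fst p) h"
    by (rule ifun_lift[of "fst Z" "fst p" B D "mor p" "mor q"]) (use z y p' q' jm Z(2) Y(2,3) p(2) q(2,3) h in simp_all)
  then show ?thesis using z p' by simp
qed

text \<open>The pullback of the base carries the structure: composites of compatible pairs, taken in
  each component, are again compatible because both functors preserve composition. The two pullback
  properties are stated together so that the one in \<open>E\<close> can be transported to other
  pullbacks of the fibre.\<close>

lemma Cat_pullback_exists:
  assumes f: "f \<in> ar (Cat E X)" and g: "g \<in> ar (Cat E X)" and fg: "snd (snd f) = snd (snd g)"
  obtains p q where "is_pullback (Cat E X) f g p q" "is_pullback E (mor f) (mor g) (mor p) (mor q)"
proof -
  let ?A = "fst f" and ?B = "fst g" and ?F = "mor f" and ?G = "mor g" and ?D = "snd (snd g)"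
  note mf = Cat_mor[OF f] and mg = Cat_mor[OF g]
  have F: "ifun ?A ?D ?F" "icat ?D" using mf fg by simp_all
  note sF = ifun_simps[OF F(1) mf(4) F(2)] and sG = ifun_simps[OF mg(6,4,5)]
  let ?p = "pb0 E ?F ?G" and ?q = "pb1 E ?F ?G"
  have ty: "?F \<in> ar E" "?G \<in> ar E" "trg E ?F = trg E ?G" using sF sG by simp_all
  note pb = pb_is_pullback[OF ty]
  have o: "icat ?A" "icat ?B" using mf mg by simp_all
  have tp: "?p \<in> ar E" "?q \<in> ar E" "src E ?q = src E ?p" "trg E ?p = arr_ob E ?A" "trg E ?q = arr_ob E ?B"
    using ty sF(2) sG(2) by simp_all
  have com: "?F \<cdot> (?p \<cdot> x) = ?G \<cdot> (?q \<cdot> x)" if "x \<in> ar E" "trg E x = src E ?p" for x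
    using pb_commute[OF ty] that by simp
  have com0: "?F \<cdot> ?p = ?G \<cdot> ?q" using pb_commute0[OF ty] .
  have dq: "idom ?B \<cdot> ?q = idom ?A \<cdot> ?p" "icod ?B \<cdot> ?q = icod ?A \<cdot> ?p"
    using sF(7)[of ?p] sG(7)[of ?q] sF(8)[of ?p] sG(8)[of ?q] tp com0 by simp_all
  define e where "e = pb_pair E ?F ?G (iunit ?A) (iunit ?B)"
  have e: "e \<in> ar E" "src E e = X" "trg E e = src E ?p" "?p \<cdot> e = iunit ?A" "?q \<cdot> e = iunit ?B"
    unfolding e_def using ty o sF(2,6) sG(2,6) by simp_all
  obtain D where D: "icat D" "idom D = idom ?A \<cdot> ?p" "icod D = icod ?A \<cdot> ?p" "iunit D = e" "arr_ob E D = src E ?p"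
    "ifun D ?A ?p" "ifun D ?B ?q"
  proof (rule icat_of_legs[of ?A ?B ?p "src E ?p" ?q e])
    show "jointly_monic E ?p ?q" by (rule is_pullback_jointly_monic[OF pb])
    fix x y assume h: "x \<in> ar E" "y \<in> ar E" "trg E x = src E ?p" "trg E y = src E ?p" "src E x = src E y"
      "icod ?A \<cdot> (?p \<cdot> x) = idom ?A \<cdot> (?p \<cdot> y)" "icod ?B \<cdot> (?q \<cdot> x) = idom ?B \<cdot> (?q \<cdot> y)"
    have "?F \<cdot> icomp E ?A (?p \<cdot> x) (?p \<cdot> y) = ?G \<cdot> icomp E ?B (?q \<cdot> x) (?q \<cdot> y)"
      using h tp o com by (simp add: sF(10) sG(10))
    then show "\<exists>z \<in> hom E (src E x) (src E ?p). ?p \<cdot> z = icomp E ?A (?p \<cdot> x) (?p \<cdot> y) \<and>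
        ?q \<cdot> z = icomp E ?B (?q \<cdot> x) (?q \<cdot> y)"
      by (intro bexI[of _ "pb_pair E ?F ?G (icomp E ?A (?p \<cdot> x) (?p \<cdot> y)) (icomp E ?B (?q \<cdot> x) (?q \<cdot> y))"])
        (use h tp o ty sF(2) sG(2) in simp_all)
  qed (use o tp dq e that in simp_all)
  let ?P = "(D, ?p, ?A)" and ?Q = "(D, ?q, ?B)"
  have PQ: "?P \<in> ar (Cat E X)" "?Q \<in> ar (Cat E X)" using D o by simp_all
  have jm: "jointly_monic E ?p ?q" by (rule is_pullback_jointly_monic[OF pb])
  have "is_pullback (Cat E X) f g ?P ?Q"
  proof (rule is_pullbackI[where P = D])
    show "f \<bullet> ?P = g \<bullet> ?Q" by (simp only: cmp_Cat fst_conv snd_conv com0 fg)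
    show "jointly_monic (Cat E X) ?P ?Q"
      unfolding jointly_monic_def
    proof (intro allI impI)
      fix Z a b assume h: "a \<in> hom (Cat E X) Z (src (Cat E X) ?P) \<and> b \<in> hom (Cat E X) Z (src (Cat E X) ?P) \<and>
        ?P \<bullet> a = ?P \<bullet> b \<and> ?Q \<bullet> a = ?Q \<bullet> b"
      then have ab: "a \<in> ar (Cat E X)" "b \<in> ar (Cat E X)" "fst a = Z" "fst b = Z" "snd (snd a) = D" "snd (snd b) = D"
        "?p \<cdot> mor a = ?p \<cdot> mor b" "?q \<cdot> mor a = ?q \<cdot> mor b"
        by (simp_all only: hom_iff src_Cat trg_Cat cmp_Cat prod.inject fst_conv snd_conv)
      note ma = Cat_mor[OF ab(1)] and mb = Cat_mor[OF ab(2)]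
      have "mor a = mor b"
        by (rule jointly_monicD[OF jm _ _ _ _ _ ab(7,8)]) (use ma mb ab(3-6) D(5) in simp_all)
      then show "a = b" using ab by (intro Cat_eqI) simp_all
    qed
    fix Z a b assume h: "a \<in> hom (Cat E X) Z (src (Cat E X) f)" "b \<in> hom (Cat E X) Z (src (Cat E X) g)"
      "f \<bullet> a = g \<bullet> b"
    then have ab: "a \<in> ar (Cat E X)" "b \<in> ar (Cat E X)" "fst a = Z" "fst b = Z" "snd (snd a) = ?A" "snd (snd b) = ?B"
        "?F \<cdot> mor a = ?G \<cdot> mor b"
      by (simp_all only: hom_iff src_Cat trg_Cat cmp_Cat prod.inject)
    note ma = Cat_mor[OF ab(1)] and mb = Cat_mor[OF ab(2)]
    define k where "k = pb_pair E ?F ?G (mor a) (mor b)"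
    have k: "k \<in> ar E" "src E k = arr_ob E Z" "trg E k = src E ?p" "?p \<cdot> k = mor a" "?q \<cdot> k = mor b"
      unfolding k_def using ma mb ab(3-7) ty sF(2) sG(2) by simp_all
    have "(fst a, k, fst ?P) \<in> ar (Cat E X)"
      by (rule Cat_liftI[of a ?A b ?B ?P ?Q]) (use ab(1-6) PQ jm k D(5) in \<open>simp_all del: ar_Cat\<close>)
    then have "(Z, k, D) \<in> ar (Cat E X)" using ab(3) by simp
    moreover have "?P \<bullet> (Z, k, D) = a" "?Q \<bullet> (Z, k, D) = b"
      using k ab by (simp_all add: prod_eq_iff)
    ultimately show "\<exists>h. h \<in> hom (Cat E X) Z D \<and> ?P \<bullet> h = a \<and> ?Q \<bullet> h = b"
      by (intro exI[of _ "(Z, k, D)"]) simp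
  qed (use f g fg PQ in simp_all)
  then show thesis using that[of ?P ?Q] pb by simp
qed

lemma finitely_complete_Cat: "finitely_complete_category (Cat E X)"
proof -
  obtain N where "Cat.is_terminal N" by (rule Cat_terminal_exists)
  moreover have "\<exists>p q. is_pullback (Cat E X) f g p q"
    if "f \<in> ar (Cat E X)" "g \<in> ar (Cat E X)" "trg (Cat E X) f = trg (Cat E X) g" for f g
    using Cat_pullback_exists[of f g] that by (metis trg_Cat)
  ultimately show ?thesis by (rule Cat.finitely_complete_categoryI)
qed

end

sublocale fixed_objects \<subseteq> Cat: finitely_complete_category "Cat E X"
  by (rule finitely_complete_Cat)

section \<open>Isomorphisms on elements and isomorphisms of points\<close>

context category
begin

text \<open>Surjectivity at the generic element, the identity of the target, gives a section of
  \<open>h\<close>; a monomorphism with a section is invertible.\<close>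

lemma isoI_elements:
  assumes h: "monic C h" and ex: "\<And>z. z \<in> ar C \<Longrightarrow> trg C z = trg C h \<Longrightarrow>
    \<exists>y. y \<in> ar C \<and> src C y = src C z \<and> trg C y = src C h \<and> h \<cdot> y = z"
  shows "iso C h"
proof -
  have ha: "h \<in> ar C" using h unfolding monic_def by simp
  have o: "trg C h \<in> ob C" "src C h \<in> ob C" using ha by simp_all
  obtain y where y: "y \<in> ar C" "src C y = trg C h" "trg C y = src C h" "h \<cdot> y = idt C (trg C h)"
    using ex[of "idt C (trg C h)"] o by auto
  have "y \<cdot> h = idt C (src C h)"
    by (rule monicD[OF h]) (use y ha o in \<open>simp_all add: cmp_reassoc[OF y(4)]\<close>)
  with y ha show ?thesis unfolding iso_def by auto
qed

lemma iso_monic: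
  assumes "iso C h"
  shows "monic C h"
  unfolding monic_def
proof (intro conjI allI impI)
  obtain g where h: "h \<in> ar C" and g: "g \<in> ar C" "src C g = trg C h" "trg C g = src C h" "g \<cdot> h = idt C (src C h)"
    using assms unfolding iso_def by auto
  show "h \<in> ar C" by (rule h)
  fix Z a b assume ab: "a \<in> hom C Z (src C h) \<and> b \<in> hom C Z (src C h) \<and> h \<cdot> a = h \<cdot> b"
  then have "g \<cdot> (h \<cdot> a) = g \<cdot> (h \<cdot> b)" by simp
  moreover have "a \<in> hom C Z (src C h)" "b \<in> hom C Z (src C h)" using ab by blast+
  ultimately show "a = b" using h g(1-3) by (simp add: cmp_reassoc[OF g(4)])
qed

lemma iso_Pt_imp_iso:
  assumes "iso (Pt C Y) (P, h, Q)"
  shows "iso C h"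
proof -
  obtain g where pt: "(P, h, Q) \<in> ar (Pt C Y)" and g: "g \<in> hom (Pt C Y) Q P"
    and gh: "g \<cdot>\<^bsub>Pt C Y\<^esub> (P, h, Q) = idt (Pt C Y) P" "(P, h, Q) \<cdot>\<^bsub>Pt C Y\<^esub> g = idt (Pt C Y) Q"
    using assms unfolding iso_def by (auto simp: Pt_def)
  obtain k where k: "g = (Q, k, P)" using g by (cases g) (simp add: Pt_def)
  have h: "h \<in> ar C" "src C h = src C (fst P)" "trg C h = src C (fst Q)" using pt by (auto simp: Pt_def)
  have k': "k \<in> ar C" "src C k = src C (fst Q)" "trg C k = src C (fst P)" using g k by (auto simp: Pt_def)
  have "k \<cdot> h = idt C (src C (fst P))" "h \<cdot> k = idt C (src C (fst Q))" using gh k by (simp_all add: Pt_def)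
  with h k' show ?thesis unfolding iso_def by auto
qed

text \<open>The inverse of \<open>h\<close> commutes with projections and sections automatically, so
  nothing beyond the invertibility of the underlying arrow has to be shown.\<close>

lemma iso_imp_iso_Pt:
  assumes pt: "(P, h, Q) \<in> ar (Pt C Y)" and "iso C h"
  shows "iso (Pt C Y) (P, h, Q)"
proof -
  have h: "h \<in> ar C" "src C h = src C (fst P)" "trg C h = src C (fst Q)"
    "fst Q \<cdot> h = fst P" "h \<cdot> snd P = snd Q" and P: "is_point C Y P" and Q: "is_point C Y Q"
    using pt by (auto simp: Pt_def)
  obtain k where k: "k \<in> ar C" "src C k = src C (fst Q)" "trg C k = src C (fst P)"
    "k \<cdot> h = idt C (src C (fst P))" "h \<cdot> k = idt C (src C (fst Q))"
    using assms(2) h unfolding iso_def by auto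
  have PQ: "snd P \<in> ar C" "trg C (snd P) = src C (fst P)" "fst Q \<in> ar C"
    using P Q by (auto simp: is_point_def)
  have "fst P \<cdot> k = fst Q"
  proof -
    have "fst P \<cdot> k = (fst Q \<cdot> h) \<cdot> k" by (simp add: h(4))
    then show ?thesis using h(1-3) k PQ by simp
  qed
  moreover have "k \<cdot> snd Q = snd P"
  proof -
    have "k \<cdot> snd Q = k \<cdot> (h \<cdot> snd P)" by (simp add: h(5))
    then show ?thesis using h(1-3) k(1-3) PQ by (simp add: cmp_reassoc[OF k(4)])
  qed
  ultimately have "(Q, k, P) \<in> hom (Pt C Y) Q P" using P Q k by (simp add: Pt_def)
  moreover have "(Q, k, P) \<cdot>\<^bsub>Pt C Y\<^esub> (P, h, Q) = idt (Pt C Y) P" "(P, h, Q) \<cdot>\<^bsub>Pt C Y\<^esub> (Q, k, P) = idt (Pt C Y) Q"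
    using k by (simp_all add: Pt_def)
  moreover have "src (Pt C Y) (P, h, Q) = P" "trg (Pt C Y) (P, h, Q) = Q" by (simp_all add: Pt_def)
  ultimately show ?thesis using pt unfolding iso_def by metis
qed

end

section \<open>Comparison of the fibre with the base\<close>

context fixed_objects
begin

lemma Cat_iso_mor:
  assumes "iso (Cat E X) t"
  shows "iso E (mor t)"
proof -
  obtain s where s': "t \<in> ar (Cat E X)" "s \<in> hom (Cat E X) (trg (Cat E X) t) (src (Cat E X) t)"
    "s \<bullet> t = idt (Cat E X) (src (Cat E X) t)" "t \<bullet> s = idt (Cat E X) (trg (Cat E X) t)"
    using assms unfolding iso_def by blast
  then have s: "t \<in> ar (Cat E X)" "s \<in> ar (Cat E X)" "fst s = snd (snd t)" "snd (snd s) = fst t"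
    "mor s \<cdot> mor t = idt E (arr_ob E (fst t))" "mor t \<cdot> mor s = idt E (arr_ob E (snd (snd t)))"
    by (simp_all only: hom_iff src_Cat trg_Cat cmp_Cat idt_Cat prod.inject)
  note mt = Cat_mor[OF s(1)] and ms = Cat_mor[OF s(2)]
  show ?thesis
    unfolding iso_def using mt ms s(3-6) by (intro conjI bexI[of _ "mor s"]) simp_all
qed

text \<open>The inverse arrow \<open>s\<close> is a functor by \<open>ifun_lift\<close> with both
  legs equal to \<open>mor t\<close>: its composite with \<open>mor t\<close> is an identity, hence
  a functor.\<close>

lemma Cat_isoI:
  assumes t: "t \<in> ar (Cat E X)" and i: "iso E (mor t)"
  shows "iso (Cat E X) t"
proof -
  note mt = Cat_mor[OF t]
  obtain s where s: "s \<in> ar E" "src E s = arr_ob E (snd (snd t))" "trg E s = arr_ob E (fst t)"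
    "s \<cdot> mor t = idt E (arr_ob E (fst t))" "mor t \<cdot> s = idt E (arr_ob E (snd (snd t)))"
    using i mt(2,3) unfolding iso_def by auto
  have jm: "jointly_monic E (mor t) (mor t)"
    using iso_monic[OF i] unfolding monic_def jointly_monic_def by blast
  have "ifun (snd (snd t)) (fst t) s"
    by (rule ifun_lift[OF mt(5,4,5,5,6,6) jm]) (use s mt(5) in \<open>simp_all add: ifun_idt\<close>)
  then have "(snd (snd t), s, fst t) \<in> hom (Cat E X) (snd (snd t)) (fst t)" using mt by simp
  moreover have "(snd (snd t), s, fst t) \<bullet> t = idt (Cat E X) (src (Cat E X) t)"
    "t \<bullet> (snd (snd t), s, fst t) = idt (Cat E X) (trg (Cat E X) t)" using s by simp_all
  ultimately show ?thesis using t unfolding iso_def by (simp only: src_Cat trg_Cat) blast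
qed

text \<open>An arbitrary pullback of the fibre, in particular one picked by \<open>pb\<close>,
  differs from the constructed one by an isomorphism. This has an invertible underlying arrow, along
  which the pullback property in \<open>E\<close> is transported.\<close>

lemma Cat_is_pullback_mor:
  assumes "is_pullback (Cat E X) f g p q"
  shows "is_pullback E (mor f) (mor g) (mor p) (mor q)"
proof -
  note ty = is_pullback_typing[OF assms]
  obtain p' q' where p': "is_pullback (Cat E X) f g p' q'" "is_pullback E (mor f) (mor g) (mor p') (mor q')"
    by (rule Cat_pullback_exists[OF ty(1,2)]) (use ty(3) in simp_all)
  obtain t where t: "iso (Cat E X) t" "fst t = fst p" "snd (snd t) = fst p'"
    "p' \<bullet> t = p" "q' \<bullet> t = q"
    using Cat.is_pullback_iso_apex[OF p'(1) assms] by (simp only: src_Cat trg_Cat) blast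
  have m: "mor p = mor p' \<cdot> mor t" "mor q = mor q' \<cdot> mor t" using t(4,5) by auto
  have ta: "t \<in> ar (Cat E X)" and pa: "p' \<in> ar (Cat E X)" using t(1) is_pullback_typing[OF p'(1)] unfolding iso_def by auto
  show ?thesis
    unfolding m by (rule is_pullback_transport[OF p'(2) Cat_iso_mor[OF t(1)]])
      (use Cat_mor[OF ta] Cat_mor[OF pa] t(3) in simp)
qed

text \<open>A product of the fibre is a pullback over its terminal object, the indiscrete category.
  Its elements are thus the pairs of parallel arrows, which is the reason for the conditions on
  \<open>idom\<close> and \<open>icod\<close> in \<open>Cat_product_ex\<close>.\<close>

lemma Cat_is_product_mor:
  assumes "is_product (Cat E X) A B p q" "icat A" "icat B"
  shows "is_pullback E (prod_pair E (idom A) (icod A)) (prod_pair E (idom B) (icod B)) (mor p) (mor q)"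
proof -
  obtain N where N: "Cat.is_terminal N"
    "\<And>A. icat A \<Longrightarrow> (A, prod_pair E (idom A) (icod A), N) \<in> hom (Cat E X) A N"
    using Cat_terminal_exists by metis
  show ?thesis
    using Cat_is_pullback_mor[OF iffD1[OF Cat.is_product_iff_is_pullback[OF N(1) N(2) N(2)] assms(1)]] assms(2,3)
    by simp
qed

lemma Cat_product_ex:
  assumes P: "is_product (Cat E X) A B p q" and AB: "icat A" "icat B"
    and ab: "a \<in> ar E" "b \<in> ar E" "src E a = src E b" "trg E a = arr_ob E A" "trg E b = arr_ob E B"
      "idom A \<cdot> a = idom B \<cdot> b" "icod A \<cdot> a = icod B \<cdot> b"
  obtains h where "h \<in> ar E" "src E h = src E b" "trg E h = arr_ob E (fst p)" "mor p \<cdot> h = a" "mor q \<cdot> h = b"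
proof -
  have "prod_pair E (idom A) (icod A) \<cdot> a = prod_pair E (idom B) (icod B) \<cdot> b"
    using AB ab by (simp add: prod_pair_natural)
  then obtain h where h: "h \<in> ar E" "src E h = src E b" "trg E h = src E (mor p)" "mor p \<cdot> h = a" "mor q \<cdot> h = b"
    by (rule is_pullback_ex[OF Cat_is_product_mor[OF P AB] ab(1,2,3), rotated 2]) (use ab AB in simp_all)
  have "p \<in> ar (Cat E X)" using Cat.is_product_typing(1)[OF P] .
  from Cat_mor(2)[OF this] h that show thesis by simp
qed

text \<open>A monomorphism has a kernel pair with equal projections, and a kernel pair in the fibre
  has as underlying arrows a kernel pair in the base.\<close>

lemma Cat_monic_mor:
  assumes u: "monic (Cat E X) u"
  shows "monic E (mor u)"
  unfolding monic_def
proof (intro conjI allI impI)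
  have ua: "u \<in> ar (Cat E X)" using u unfolding monic_def by blast
  note mu = Cat_mor[OF ua]
  show "mor u \<in> ar E" by (rule mu)
  obtain p q where pq: "is_pullback (Cat E X) u u p q" "is_pullback E (mor u) (mor u) (mor p) (mor q)"
    using Cat_pullback_exists[OF ua ua] by metis
  note ty = is_pullback_typing[OF pq(1)]
  have "p = q" by (rule monicD[OF u]) (use ty in \<open>simp_all only:\<close>)
  fix Z a b assume ab: "a \<in> hom E Z (src E (mor u)) \<and> b \<in> hom E Z (src E (mor u)) \<and> mor u \<cdot> a = mor u \<cdot> b"
  then obtain h where "mor p \<cdot> h = a" "mor q \<cdot> h = b" using is_pullback_ex[OF pq(2), of a b] by auto
  with \<open>p = q\<close> show "a = b" by simp
qed

text \<open>The legs of a relation are the composites of a monomorphism \<open>m\<close> of the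
  fibre with the projections of a product. Both \<open>m\<close> and the pair of projections keep
  their cancellation property in the base.\<close>

lemma Cat_relation_mor:
  assumes R: "is_relation (Cat E X) B (d0, d1)"
  shows "jointly_monic E (mor d0) (mor d1)"
proof -
  have B: "B \<in> ob (Cat E X)" and d: "d0 \<in> ar (Cat E X)" "d1 \<in> ar (Cat E X)" "fst d1 = fst d0"
    "snd (snd d0) = B" "snd (snd d1) = B"
    using R unfolding is_relation_def prod.case by (simp_all only: hom_iff src_Cat trg_Cat)
  have R': "jointly_monic (Cat E X) d0 d1"
    using R unfolding is_relation_def jointly_monic_def prod.case by blast
  note P = Cat.chosen_prod_is_product[OF B B]
  let ?p = "pr0 (Cat E X) B B" and ?q = "pr1 (Cat E X) B B"
  obtain m where m: "m \<in> ar (Cat E X)" "fst m = fst d1" "snd (snd m) = fst ?p"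
    "?p \<bullet> m = d0" "?q \<bullet> m = d1"
    using Cat.is_product_ex[OF P d(1,2)] d(3-5) by (simp only: src_Cat trg_Cat) metis
  have pt: "?p \<in> ar (Cat E X)" "?q \<in> ar (Cat E X)" "fst ?q = fst ?p"
    using Cat.is_product_typing[OF P] by (simp_all only: src_Cat)
  have "monic (Cat E X) m"
    unfolding monic_def
  proof (intro conjI allI impI)
    show "m \<in> ar (Cat E X)" by (rule m)
    fix Z a b assume "a \<in> hom (Cat E X) Z (src (Cat E X) m) \<and> b \<in> hom (Cat E X) Z (src (Cat E X) m) \<and>
      m \<bullet> a = m \<bullet> b"
    then have ab: "a \<in> ar (Cat E X)" "b \<in> ar (Cat E X)" "fst a = Z" "fst b = Z" "snd (snd a) = fst m" "snd (snd b) = fst m"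
      and eq: "m \<bullet> a = m \<bullet> b" by (simp_all only: hom_iff src_Cat trg_Cat)
    have c: "(?p \<bullet> m) \<bullet> z = ?p \<bullet> (m \<bullet> z)"
      "(?q \<bullet> m) \<bullet> z = ?q \<bullet> (m \<bullet> z)"
      if "z \<in> ar (Cat E X)" "snd (snd z) = fst m" for z
      by (rule Cat.assoc; use that m pt in \<open>simp only: src_Cat trg_Cat\<close>)+
    have "d0 \<bullet> a = d0 \<bullet> b" "d1 \<bullet> a = d1 \<bullet> b"
      using c[OF ab(1,5)] c[OF ab(2,6)] unfolding m(4,5) eq by simp_all
    then show "a = b"
      by - (rule jointly_monicD[OF R'], use ab m(2) d(3) in \<open>simp_all only: src_Cat trg_Cat\<close>)
  qed
  from Cat_monic_mor[OF this] have mm: "monic E (mor m)" .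
  have B': "icat B" using B by simp
  have jp: "jointly_monic E (mor ?p) (mor ?q)"
    by (rule is_pullback_jointly_monic[OF Cat_is_product_mor[OF P B' B']])
  have e: "mor ?p \<cdot> mor m = mor d0" "mor ?q \<cdot> mor m = mor d1" using m(4,5) by (metis cmp_Cat fst_conv snd_conv)+
  note mp = Cat_mor[OF pt(1)] and mq = Cat_mor[OF pt(2)] and mo = Cat_mor[OF m(1)] and md = Cat_mor[OF d(1)]
  show ?thesis
    unfolding jointly_monic_def
  proof (intro allI impI)
    fix Z a b assume h: "a \<in> hom E Z (src E (mor d0)) \<and> b \<in> hom E Z (src E (mor d0)) \<and>
      mor d0 \<cdot> a = mor d0 \<cdot> b \<and> mor d1 \<cdot> a = mor d1 \<cdot> b"
    then have ab: "a \<in> ar E" "b \<in> ar E" "src E a = Z" "src E b = Z" "trg E a = arr_ob E (fst m)" "trg E b = arr_ob E (fst m)"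
      using md m(2) d(3) by simp_all
    have ty: "mor ?p \<in> ar E" "mor ?q \<in> ar E" "mor m \<in> ar E" "src E (mor ?p) = arr_ob E (fst ?p)" "src E (mor ?q) = arr_ob E (fst ?p)"
      "src E (mor m) = arr_ob E (fst m)" "trg E (mor m) = arr_ob E (fst ?p)"
      using mp mq mo m(3) pt(3) by simp_all
    have "mor m \<cdot> a = mor m \<cdot> b"
      by (rule jointly_monicD[OF jp]) (use ab ty h in \<open>simp_all add: cmp_reassoc[OF e(1)] cmp_reassoc[OF e(2)]\<close>)
    then show "a = b"
      by - (rule monicD[OF mm], use ab ty in simp_all)
  qed
qed

end

section \<open>The Mal'tsev property of the fibre\<close>

context maltsev_fixed_objects
begin

lemma Cat_reflexive_mor:
  assumes R: "is_reflexive (Cat E X) B (d0, d1)"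
  shows "is_reflexive E (arr_ob E B) (mor d0, mor d1)"
proof -
  have rel: "is_relation (Cat E X) B (d0, d1)" using R unfolding is_reflexive_def by simp
  have B: "B \<in> ob (Cat E X)" and d: "d0 \<in> ar (Cat E X)" "d1 \<in> ar (Cat E X)" "fst d1 = fst d0"
    "snd (snd d0) = B" "snd (snd d1) = B"
    using rel unfolding is_relation_def prod.case by (simp_all only: hom_iff src_Cat trg_Cat)
  note m0 = Cat_mor[OF d(1)] and m1 = Cat_mor[OF d(2)]
  have jm: "jointly_monic E (mor d0) (mor d1)" by (rule Cat_relation_mor[OF rel])
  have rE: "is_relation E (arr_ob E B) (mor d0, mor d1)"
    unfolding is_relation_def prod.case
  proof (intro conjI)
    show "\<forall>Z a b. a \<in> hom E Z (src E (mor d0)) \<and> b \<in> hom E Z (src E (mor d0)) \<and>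
      mor d0 \<cdot> a = mor d0 \<cdot> b \<and> mor d1 \<cdot> a = mor d1 \<cdot> b \<longrightarrow> a = b"
      using jm unfolding jointly_monic_def by blast
  qed (use m0 m1 d(3-5) in simp_all)
  obtain s where s': "s \<in> hom (Cat E X) B (src (Cat E X) d0)"
    "d0 \<bullet> s = idt (Cat E X) B" "d1 \<bullet> s = idt (Cat E X) B"
    using R unfolding is_reflexive_def prod.case by blast
  then have s: "s \<in> ar (Cat E X)" "fst s = B" "snd (snd s) = fst d0"
    "mor d0 \<cdot> mor s = idt E (arr_ob E B)" "mor d1 \<cdot> mor s = idt E (arr_ob E B)"
    by (simp_all only: hom_iff src_Cat trg_Cat cmp_Cat idt_Cat prod.inject)
  have "mor s \<in> hom E (arr_ob E B) (src E (mor d0))" using Cat_mor[OF s(1)] m0(2) s(2,3) by simp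
  with rE s(4,5) show ?thesis unfolding is_reflexive_def prod.case by blast
qed

text \<open>The underlying relation in \<open>E\<close> is reflexive, hence symmetric and transitive
  there. The arrows of \<open>E\<close> expressing this are compatible with the jointly monic legs,
  so \<open>Cat_liftI\<close> makes them functors.\<close>

lemma maltsev_Cat: "maltsev_category (Cat E X)"
proof
  fix B R
  assume R': "is_reflexive (Cat E X) B R"
  obtain d0 d1 where R_eq: "R = (d0, d1)" by (cases R)
  note R = R'[unfolded R_eq]
  have rel: "is_relation (Cat E X) B (d0, d1)" using R unfolding is_reflexive_def by simp
  have d: "d0 \<in> ar (Cat E X)" "d1 \<in> ar (Cat E X)" "fst d1 = fst d0" "snd (snd d0) = B" "snd (snd d1) = B"
    using rel unfolding is_relation_def prod.case by (simp_all only: hom_iff src_Cat trg_Cat)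
  note m0 = Cat_mor[OF d(1)] and m1 = Cat_mor[OF d(2)]
  have jm: "jointly_monic E (mor d0) (mor d1)" by (rule Cat_relation_mor[OF rel])
  note rE = Cat_reflexive_mor[OF R]
  have "is_symmetric (Cat E X) B (d0, d1)"
  proof -
    let ?o = "idt E (arr_ob E (fst d0))"
    have o: "?o \<in> ar E" "trg E ?o = src E (mor d0)" using m0 by simp_all
    obtain z where z: "z \<in> ar E" "src E z = src E ?o" "trg E z = src E (mor d0)"
      "mor d0 \<cdot> z = mor d1 \<cdot> ?o" "mor d1 \<cdot> z = mor d0 \<cdot> ?o"
      by (rule reflexive_symD[OF rE o])
    have z': "mor d0 \<cdot> z = mor d1" "mor d1 \<cdot> z = mor d0" using z(4,5) m0 m1 d(3) by simp_all
    have "(fst d1, z, fst d0) \<in> ar (Cat E X)"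
      by (rule Cat_liftI[of d1 B d0 B d0 d1]) (use z(1-3) m0 m1 z' jm d in \<open>simp_all del: ar_Cat\<close>)
    then have "(fst d0, z, fst d0) \<in> hom (Cat E X) (src (Cat E X) d0) (src (Cat E X) d0)"
      using d(3) by (simp only: hom_iff src_Cat trg_Cat) simp
    moreover have "d0 \<bullet> (fst d0, z, fst d0) = d1" "d1 \<bullet> (fst d0, z, fst d0) = d0"
      by (rule Cat_eqI; use z' d(3-5) in simp)+
    ultimately show ?thesis using rel unfolding is_symmetric_def prod.case by blast
  qed
  moreover have "is_transitive (Cat E X) B (d0, d1)"
  proof -
    let ?p = "pb0 (Cat E X) d1 d0" and ?q = "pb1 (Cat E X) d1 d0"
    have "trg (Cat E X) d1 = trg (Cat E X) d0" using d by (simp only: trg_Cat)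
    note ty = is_pullback_typing[OF Cat.pb_is_pullback[OF d(2,1) this]]
    have pq: "?p \<in> ar (Cat E X)" "?q \<in> ar (Cat E X)" "fst ?q = fst ?p" "snd (snd ?p) = fst d1" "snd (snd ?q) = fst d0"
      using ty(4-8) by (simp_all only: src_Cat trg_Cat)
    have e: "mor d1 \<cdot> mor ?p = mor d0 \<cdot> mor ?q" using ty(9) by (simp only: cmp_Cat prod.inject)
    note mp = Cat_mor[OF pq(1)] and mq = Cat_mor[OF pq(2)]
    have t: "trg E (mor ?p) = src E (mor d0)" "trg E (mor ?q) = src E (mor d0)" "src E (mor ?p) = src E (mor ?q)"
      using mp mq m0 m1 pq(3-5) d(3) by simp_all
    obtain v where v: "v \<in> ar E" "src E v = src E (mor ?q)" "trg E v = src E (mor d0)"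
      "mor d0 \<cdot> v = mor d0 \<cdot> mor ?p" "mor d1 \<cdot> v = mor d1 \<cdot> mor ?q"
      by (rule reflexive_transD[OF rE mp(1) t(1) mq(1) t(2,3) e])
    let ?Z = "d0 \<bullet> ?p" and ?Y = "d1 \<bullet> ?q"
    have ZY: "?Z \<in> ar (Cat E X)" "?Y \<in> ar (Cat E X)"
      by (rule Cat.cmp_ar; use d pq in \<open>simp only: src_Cat trg_Cat\<close>)+
    have zy: "fst ?Z = fst ?p" "snd (snd ?Z) = B" "fst ?Y = fst ?p" "snd (snd ?Y) = B"
      "mor ?Z = mor d0 \<cdot> mor ?p" "mor ?Y = mor d1 \<cdot> mor ?q"
      using d pq by (simp_all only: cmp_Cat fst_conv snd_conv)
    have "(fst ?Z, v, fst d0) \<in> ar (Cat E X)"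
      by (rule Cat_liftI[OF ZY(1) zy(2) ZY(2) zy(4) _ d(1,4,2,5,3) jm]) (use v t zy mp mq m0 m1 pq in simp_all)
    then have "(fst ?p, v, fst d0) \<in> hom (Cat E X) (src (Cat E X) ?p) (src (Cat E X) d0)"
      by (simp only: zy(1) hom_iff src_Cat trg_Cat fst_conv snd_conv)
    moreover have "d0 \<bullet> (fst ?p, v, fst d0) = d0 \<bullet> ?p"
      "d1 \<bullet> (fst ?p, v, fst d0) = d1 \<bullet> ?q"
      using v(4,5) pq(3) by (simp_all only: cmp_Cat fst_conv snd_conv)
    ultimately show ?thesis using rel unfolding is_transitive_def prod.case by blast
  qed
  ultimately show "is_equivalence (Cat E X) B R" using R' unfolding is_equivalence_def R_eq by blast
qed

section \<open>Protomodularity\<close>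

text \<open>Every arrow \<open>c\<close> of \<open>D\<close> factors as \<open>s (p c)\<close> followed by an arrow of the kernel of \<open>p\<close>.\<close>

lemma iso_of_kernel_iso:
  assumes icats: "icat D" "icat D'" "icat B"
    and p: "ifun D B p" and s: "ifun B D s" and p': "ifun D' B p'" and s': "ifun B D' s'" and h: "ifun D D' h"
    and eqs: "p' \<cdot> h = p" "h \<cdot> s = s'" "p \<cdot> s = idt E (arr_ob E B)" "p' \<cdot> s' = idt E (arr_ob E B)"
    and inj: "\<And>k l x. k \<in> ar E \<Longrightarrow> l \<in> ar E \<Longrightarrow> src E k = src E l \<Longrightarrow> trg E k = arr_ob E D \<Longrightarrow> trg E l = arr_ob E D \<Longrightarrow>
      x \<in> ar E \<Longrightarrow> src E x = src E l \<Longrightarrow> trg E x = X \<Longrightarrow> p \<cdot> k = iunit B \<cdot> x \<Longrightarrow> p \<cdot> l = iunit B \<cdot> x \<Longrightarrow>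
      h \<cdot> k = h \<cdot> l \<Longrightarrow> k = l"
    and surj: "\<And>k x. k \<in> ar E \<Longrightarrow> trg E k = arr_ob E D' \<Longrightarrow> x \<in> ar E \<Longrightarrow> src E x = src E k \<Longrightarrow> trg E x = X \<Longrightarrow>
      p' \<cdot> k = iunit B \<cdot> x \<Longrightarrow>
      \<exists>l. l \<in> ar E \<and> src E l = src E k \<and> trg E l = arr_ob E D \<and> p \<cdot> l = iunit B \<cdot> x \<and> h \<cdot> l = k"
  shows "iso E h"
proof -
  note p = ifun_simps[OF p icats(1,3)] and s = ifun_simps[OF s icats(3,1)]
    and p' = ifun_simps[OF p' icats(2,3)] and s' = ifun_simps[OF s' icats(3,2)] and h = ifun_simps[OF h icats(1,2)]
  have ph: "p' \<cdot> (h \<cdot> z) = p \<cdot> z" if "z \<in> ar E" "trg E z = arr_ob E D" for z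
    using that p'(1-3) h(1-3) by (simp add: cmp_reassoc[OF eqs(1)])
  have hs: "h \<cdot> (s \<cdot> z) = s' \<cdot> z" and ps: "p \<cdot> (s \<cdot> z) = z" and ps': "p' \<cdot> (s' \<cdot> z) = z"
    if "z \<in> ar E" "trg E z = arr_ob E B" for z
    using that s(1-3) h(1-3) p(1-3) p'(1-3) s'(1-3)
    by (simp_all add: cmp_reassoc[OF eqs(2)] cmp_reassoc[OF eqs(3)] cmp_reassoc[OF eqs(4)])
  \<comment> \<open>The inverse of \<open>s b\<close> in the groupoid \<open>D\<close>; the two
    composites are written as identities at the ends of \<open>b\<close> itself, since
    \<open>s\<close> is the identity on objects.\<close>
  have key: "\<exists>g. composable E D (s \<cdot> b) g \<and> composable E D g (s \<cdot> b) \<and> icomp E D g (s \<cdot> b) = iunit D \<cdot> (icod B \<cdot> b) \<and>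
      icomp E D (s \<cdot> b) g = iunit D \<cdot> (idom B \<cdot> b)"
    if b: "b \<in> ar E" "trg E b = arr_ob E B" for b
  proof -
    have sb: "s \<cdot> b \<in> ar E" "trg E (s \<cdot> b) = arr_ob E D" using b s(1-3) by simp_all
    obtain g where g: "composable E D (s \<cdot> b) g" "composable E D g (s \<cdot> b)"
      "icomp E D (s \<cdot> b) g = iunit D \<cdot> (idom D \<cdot> (s \<cdot> b))" "icomp E D g (s \<cdot> b) = iunit D \<cdot> (icod D \<cdot> (s \<cdot> b))"
      using inverse_exists[OF icats(1) sb] by metis
    with b s(7,8)[of b] show ?thesis by metis
  qed
  have "monic E h"
    unfolding monic_def
  proof (intro conjI allI impI)
    show "h \<in> ar E" by (rule h)
    fix Z c1 c2 assume c12: "c1 \<in> hom E Z (src E h) \<and> c2 \<in> hom E Z (src E h) \<and> h \<cdot> c1 = h \<cdot> c2"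
    then have c: "c1 \<in> ar E" "src E c1 = Z" "trg E c1 = arr_ob E D" "c2 \<in> ar E" "src E c2 = Z" "trg E c2 = arr_ob E D"
      and hc: "h \<cdot> c1 = h \<cdot> c2" using h(2) by simp_all
    define b where "b = p \<cdot> c1"
    have b2: "p \<cdot> c2 = b" using ph[of c1] ph[of c2] c hc unfolding b_def by simp
    have b: "b \<in> ar E" "src E b = Z" "trg E b = arr_ob E B" using c p(1-3) unfolding b_def by simp_all
    obtain g where g: "composable E D (s \<cdot> b) g" "composable E D g (s \<cdot> b)"
      "icomp E D g (s \<cdot> b) = iunit D \<cdot> (icod B \<cdot> b)" "icomp E D (s \<cdot> b) g = iunit D \<cdot> (idom B \<cdot> b)"
      using key[OF b(1,3)] by blast
    have gs: "src E g = Z" using g(1) b s(1-3) by simp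
    have dc: "idom D \<cdot> c1 = idom B \<cdot> b" "idom D \<cdot> c2 = idom B \<cdot> b"
      using p(7)[of c1] p(7)[of c2] c b2 b_def by simp_all
    have cg: "icod D \<cdot> g = idom B \<cdot> b" "icod B \<cdot> b = idom D \<cdot> g" using g(1,2) b s(7,8)[of b] by simp_all
    have comp: "composable E D g c1" "composable E D g c2" using g(1) c gs dc cg by simp_all
    have pg: "p \<cdot> icomp E D g c1 = iunit B \<cdot> (icod B \<cdot> b)" "p \<cdot> icomp E D g c2 = iunit B \<cdot> (icod B \<cdot> b)"
    proof -
      \<comment> \<open>\<open>c1\<close>, \<open>c2\<close> and \<open>s b\<close> all lie over
        \<open>b\<close>. Preceded by \<open>g\<close> they therefore lie over one and the same
        arrow, and for \<open>s b\<close> this is the identity at the codomain of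
        \<open>b\<close>.\<close>
      have "iunit B \<cdot> (icod B \<cdot> b) = p \<cdot> icomp E D g (s \<cdot> b)"
        unfolding g(3) using p(9)[of "icod B \<cdot> b"] b icats by simp
      also have "\<dots> = icomp E B (p \<cdot> g) b" using p(10)[OF g(2)] ps[OF b(1,3)] by simp
      finally show "p \<cdot> icomp E D g c1 = iunit B \<cdot> (icod B \<cdot> b)" "p \<cdot> icomp E D g c2 = iunit B \<cdot> (icod B \<cdot> b)"
        using p(10)[OF comp(1)] p(10)[OF comp(2)] b2 b_def by simp_all
    qed
    have hk: "h \<cdot> icomp E D g c1 = h \<cdot> icomp E D g c2" using h(10)[OF comp(1)] h(10)[OF comp(2)] hc by simp
    have k: "icomp E D g c1 = icomp E D g c2"
      by (rule inj[OF _ _ _ _ _ _ _ _ pg hk]) (use icats comp c gs b in simp_all)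
    have r: "c = icomp E D (s \<cdot> b) (icomp E D g c)" if "composable E D g c" "idom D \<cdot> c = idom B \<cdot> b" for c
      using icomp_assoc[OF icats(1) g(1) that(1)] that icats(1) unfolding g(4) by (simp add: icomp_iunit_left)
    show "c1 = c2" using r[OF comp(1) dc(1)] r[OF comp(2) dc(2)] k by simp
  qed
  then show ?thesis
  proof (rule isoI_elements)
    fix c assume "c \<in> ar E" "trg E c = trg E h"
    then have c: "c \<in> ar E" "trg E c = arr_ob E D'" using h(3) by simp_all
    define b where "b = p' \<cdot> c"
    have b: "b \<in> ar E" "src E b = src E c" "trg E b = arr_ob E B" using c p'(1-3) unfolding b_def by simp_all
    obtain g where g: "composable E D (s \<cdot> b) g" "composable E D g (s \<cdot> b)"
      "icomp E D g (s \<cdot> b) = iunit D \<cdot> (icod B \<cdot> b)" "icomp E D (s \<cdot> b) g = iunit D \<cdot> (idom B \<cdot> b)"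
      using key[OF b(1,3)] by blast
    have gs: "g \<in> ar E" "src E g = src E c" "trg E g = arr_ob E D" using g(1) b s(1-3) by simp_all
    have dc: "idom D' \<cdot> c = idom B \<cdot> b" using p'(7)[of c] c b_def by simp
    have cg: "icod D \<cdot> g = idom B \<cdot> b" "icod B \<cdot> b = idom D \<cdot> g" using g(1,2) b s(7,8)[of b] by simp_all
    have hg: "composable E D' (h \<cdot> g) c" "composable E D' (s' \<cdot> b) (h \<cdot> g)"
      using gs c dc cg b h(1-3,7,8) s'(1-3,8) by simp_all
    have pk: "p' \<cdot> icomp E D' (h \<cdot> g) c = iunit B \<cdot> (icod B \<cdot> b)"
    proof -
      have "iunit B \<cdot> (icod B \<cdot> b) = p \<cdot> icomp E D g (s \<cdot> b)"
        unfolding g(3) using p(9)[of "icod B \<cdot> b"] b icats by simp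
      also have "\<dots> = icomp E B (p \<cdot> g) b" using p(10)[OF g(2)] ps[OF b(1,3)] by simp
      finally show ?thesis using p'(10)[OF hg(1)] ph[of g] gs b_def by simp
    qed
    have kt: "icomp E D' (h \<cdot> g) c \<in> ar E" "trg E (icomp E D' (h \<cdot> g) c) = arr_ob E D'"
      "src E (icomp E D' (h \<cdot> g) c) = src E c" "idom D' \<cdot> icomp E D' (h \<cdot> g) c = icod B \<cdot> b"
      using icats hg(1) gs h(1-3) h(7)[of g] cg(2) by simp_all
    have bt: "icod B \<cdot> b \<in> ar E" "src E (icod B \<cdot> b) = src E (icomp E D' (h \<cdot> g) c)" "trg E (icod B \<cdot> b) = X"
      using b icats kt(3) by simp_all
    \<comment> \<open>\<open>h g\<close> is inverse to \<open>s' b\<close>, so \<open>c\<close>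
      preceded by it lies over an identity and has a preimage \<open>k\<close> by
      \<open>surj\<close>. Then \<open>s b\<close> followed by \<open>k\<close> is the preimage of
      \<open>c\<close>.\<close>
    obtain k where k: "k \<in> ar E" "src E k = src E (icomp E D' (h \<cdot> g) c)" "trg E k = arr_ob E D"
      "p \<cdot> k = iunit B \<cdot> (icod B \<cdot> b)" "h \<cdot> k = icomp E D' (h \<cdot> g) c"
      using surj[OF kt(1,2) bt pk] by blast
    have dk: "idom D \<cdot> k = icod B \<cdot> b" using h(7)[of k] k(1,3,5) kt(4) by simp
    have sk: "composable E D (s \<cdot> b) k" using b s(1-3) s(8)[of b] k(1-3) kt(3) dk by simp
    have hsb: "icomp E D' (s' \<cdot> b) (h \<cdot> g) = iunit D' \<cdot> (idom B \<cdot> b)"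
    proof -
      have "h \<cdot> icomp E D (s \<cdot> b) g = icomp E D' (s' \<cdot> b) (h \<cdot> g)" using h(10)[OF g(1)] hs[OF b(1,3)] by simp
      then show ?thesis unfolding g(4) using h(9)[of "idom B \<cdot> b"] b icats by simp
    qed
    have "h \<cdot> icomp E D (s \<cdot> b) k = icomp E D' (s' \<cdot> b) (icomp E D' (h \<cdot> g) c)"
      using h(10)[OF sk] hs[OF b(1,3)] k(5) by simp
    also have "\<dots> = icomp E D' (icomp E D' (s' \<cdot> b) (h \<cdot> g)) c"
      by (rule icomp_assoc[symmetric, OF icats(2) hg(2,1)])
    also have "\<dots> = c" unfolding hsb by (rule icomp_iunit_left[OF icats(2) c dc])
    finally have "h \<cdot> icomp E D (s \<cdot> b) k = c" .
    moreover have "icomp E D (s \<cdot> b) k \<in> ar E" "src E (icomp E D (s \<cdot> b) k) = src E c"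
      "trg E (icomp E D (s \<cdot> b) k) = src E h" using sk icats b s(1-3) h(2) by simp_all
    ultimately show "\<exists>y. y \<in> ar E \<and> src E y = src E c \<and> trg E y = src E h \<and> h \<cdot> y = c" by blast
  qed
qed

text \<open>Let \<open>f\<close> go from \<open>A\<close> to \<open>B\<close>. As \<open>f\<close>
  preserves identities, an arrow lying over an identity of \<open>B\<close> forms, together with the
  identity of \<open>A\<close> at the same object, an element of the pullback along
  \<open>f\<close>. An invertible base change is therefore bijective on such arrows, which is what
  \<open>iso_of_kernel_iso\<close> asks for.\<close>

lemma protomodular_Cat: "protomodular_category (Cat E X)"
proof
  fix f assume f: "f \<in> ar (Cat E X)"
  show "reflects_isos (Pt (Cat E X) (trg (Cat E X) f)) (Pt (Cat E X) (src (Cat E X) f)) (base_change_ar (Cat E X) f)"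
    unfolding reflects_isos_def
  proof (intro ballI impI)
    fix hh assume hh: "hh \<in> ar (Pt (Cat E X) (trg (Cat E X) f))"
      and iso: "iso (Pt (Cat E X) (src (Cat E X) f)) (base_change_ar (Cat E X) f hh)"
    obtain p s h p' s' where hh_eq: "hh = ((p, s), h, (p', s'))" by (metis prod.collapse)
    have pt: "is_point (Cat E X) (trg (Cat E X) f) (p, s)" "is_point (Cat E X) (trg (Cat E X) f) (p', s')"
      and h': "h \<in> hom (Cat E X) (src (Cat E X) p) (src (Cat E X) p')" "p' \<bullet> h = p" "h \<bullet> s = s'"
      using hh unfolding hh_eq Pt_def by (simp_all only: cat_data.simps mem_Collect_eq prod.case fst_conv snd_conv)
    have p: "p \<in> ar (Cat E X)" "snd (snd p) = snd (snd f)" and s: "s \<in> ar (Cat E X)" "fst s = snd (snd f)" "snd (snd s) = fst p"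
      and ps: "mor p \<cdot> mor s = idt E (arr_ob E (snd (snd f)))"
      using pt(1) unfolding is_point_def prod.case by (simp_all only: hom_iff src_Cat trg_Cat cmp_Cat idt_Cat prod.inject)
    have p': "p' \<in> ar (Cat E X)" "snd (snd p') = snd (snd f)" and s': "s' \<in> ar (Cat E X)" "fst s' = snd (snd f)" "snd (snd s') = fst p'"
      and ps': "mor p' \<cdot> mor s' = idt E (arr_ob E (snd (snd f)))"
      using pt(2) unfolding is_point_def prod.case by (simp_all only: hom_iff src_Cat trg_Cat cmp_Cat idt_Cat prod.inject)
    have h: "h \<in> ar (Cat E X)" "fst h = fst p" "snd (snd h) = fst p'" using h'(1) by (simp_all only: hom_iff src_Cat trg_Cat)
    have ph: "mor p' \<cdot> mor h = mor p" and hs: "mor h \<cdot> mor s = mor s'"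
      using arg_cong[OF h'(2), of mor] arg_cong[OF h'(3), of mor] by (simp_all only: cmp_Cat fst_conv snd_conv)
    \<comment> \<open>The arrow underlying the base change of \<open>h\<close>; on elements of the
      pullback it sends \<open>(i, k)\<close> to \<open>(i, h k)\<close>.\<close>
    define \<phi> where "\<phi> = pb_pair (Cat E X) f p' (pb0 (Cat E X) f p) (h \<bullet> pb1 (Cat E X) f p)"
    have "iso (Cat E X) \<phi>"
      using iso unfolding hh_eq base_change_ar_def prod.case fst_conv \<phi>_def[symmetric]
      by (rule Cat.iso_Pt_imp_iso)
    then have \<phi>: "iso E (mor \<phi>)" by (rule Cat_iso_mor)
    let ?a0 = "pb0 (Cat E X) f p" and ?a1 = "pb1 (Cat E X) f p"
      and ?b0 = "pb0 (Cat E X) f p'" and ?b1 = "pb1 (Cat E X) f p'"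
    have "trg (Cat E X) f = trg (Cat E X) p" "trg (Cat E X) f = trg (Cat E X) p'" using p(2) p'(2) by (simp_all only: trg_Cat)
    note pbp = Cat.pb_is_pullback[OF f p(1) this(1)] and pbp' = Cat.pb_is_pullback[OF f p'(1) this(2)]
      and fp' = this(2)
    note tyP = is_pullback_typing[OF pbp] and tyP' = is_pullback_typing[OF pbp']
    have com: "f \<bullet> ?a0 = p' \<bullet> (h \<bullet> ?a1)"
    proof -
      have "p' \<bullet> (h \<bullet> ?a1) = p \<bullet> ?a1"
        by (rule Cat.cmp_reassoc[OF h'(2)]) (use p'(1) h tyP(5,8) in \<open>simp_all only: src_Cat trg_Cat\<close>)
      with tyP(9) show ?thesis by simp
    qed
    have ha: "h \<bullet> ?a1 \<in> ar (Cat E X)" "src (Cat E X) (h \<bullet> ?a1) = src (Cat E X) ?a1"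
      "trg (Cat E X) (h \<bullet> ?a1) = src (Cat E X) p'"
      using Cat.cmp_ar[OF h(1) tyP(5)] h(2,3) tyP(8) by (simp_all only: src_Cat trg_Cat cmp_Cat fst_conv snd_conv)
    have "\<phi> \<in> hom (Cat E X) (src (Cat E X) ?a0) (src (Cat E X) ?b0) \<and>
        ?b0 \<bullet> \<phi> = ?a0 \<and> ?b1 \<bullet> \<phi> = h \<bullet> ?a1"
      unfolding \<phi>_def
      by (rule Cat.pb_pair_props[OF f p'(1) fp' tyP(4) ha(1) _ tyP(7) ha(3) com]) (use ha(2) tyP(6) in simp)
    then have phi: "\<phi> \<in> hom (Cat E X) (src (Cat E X) ?a0) (src (Cat E X) ?b0)" "?b0 \<bullet> \<phi> = ?a0"
      "?b1 \<bullet> \<phi> = h \<bullet> ?a1" by blast+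
    have ph_ar: "\<phi> \<in> ar (Cat E X)" "fst \<phi> = fst ?a0" "snd (snd \<phi>) = fst ?b0"
      and phi_eq: "mor ?b0 \<cdot> mor \<phi> = mor ?a0" "mor ?b1 \<cdot> mor \<phi> = mor h \<cdot> mor ?a1"
      using phi(1) arg_cong[OF phi(2), of mor] arg_cong[OF phi(3), of mor]
      by (simp_all only: hom_iff src_Cat trg_Cat cmp_Cat fst_conv snd_conv)
    let ?A = "fst f" and ?B = "snd (snd f)"
    note mf = Cat_mor[OF f] and mp = Cat_mor[OF p(1)] and mp' = Cat_mor[OF p'(1)] and mh = Cat_mor[OF h(1)]
      and m\<phi> = Cat_mor[OF ph_ar(1)]
    note pbE = Cat_is_pullback_mor[OF pbp] and pbE' = Cat_is_pullback_mor[OF pbp']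
    note tyE = is_pullback_typing[OF pbE] and tyE' = is_pullback_typing[OF pbE']
    have ty\<phi>: "src E (mor \<phi>) = src E (mor ?a0)" "trg E (mor \<phi>) = src E (mor ?b0)"
      using m\<phi>(2,3) ph_ar(2,3) Cat_mor(2)[OF tyP(4)] Cat_mor(2)[OF tyP'(4)] by simp_all
    have b0\<phi>: "mor ?b0 \<cdot> (mor \<phi> \<cdot> z) = mor ?a0 \<cdot> z" and b1\<phi>: "mor ?b1 \<cdot> (mor \<phi> \<cdot> z) = mor h \<cdot> (mor ?a1 \<cdot> z)"
      if "z \<in> ar E" "trg E z = src E (mor ?a0)" for z
    proof -
      show "mor ?b0 \<cdot> (mor \<phi> \<cdot> z) = mor ?a0 \<cdot> z"
        using that tyE'(4) m\<phi>(1) ty\<phi> by (simp add: cmp_reassoc[OF phi_eq(1)])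
      have "trg E (mor ?a1) = src E (mor h)" using tyE(8) mp(2) mh(2) h(2) by simp
      then show "mor ?b1 \<cdot> (mor \<phi> \<cdot> z) = mor h \<cdot> (mor ?a1 \<cdot> z)"
        using that tyE'(5,6) m\<phi>(1) mh(1) tyE(5,6) ty\<phi> by (simp add: cmp_reassoc[OF phi_eq(2)])
    qed
    note sf = ifun_simps[OF mf(6,4,5)]
    have "iso E (mor h)"
    proof (rule iso_of_kernel_iso[of "fst p" "fst p'" ?B "mor p" "mor s" "mor p'" "mor s'"])
      show "icat (fst p)" "icat (fst p')" "icat ?B" by (rule mp mp' mf)+
      show "ifun (fst p) ?B (mor p)" "ifun (fst p') ?B (mor p')" using mp(6) mp'(6) p(2) p'(2) by simp_all
      show "ifun ?B (fst p) (mor s)" "ifun ?B (fst p') (mor s')" using Cat_mor(6)[OF s(1)] Cat_mor(6)[OF s'(1)] s(2,3) s'(2,3) by simp_all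
      show "ifun (fst p) (fst p') (mor h)" using mh(6) h(2,3) by simp
      show "mor p' \<cdot> mor h = mor p" "mor h \<cdot> mor s = mor s'" "mor p \<cdot> mor s = idt E (arr_ob E ?B)"
        "mor p' \<cdot> mor s' = idt E (arr_ob E ?B)" by (rule ph hs ps ps')+
    next
      fix k l x
      assume k: "k \<in> ar E" "l \<in> ar E" "src E k = src E l" "trg E k = arr_ob E (fst p)" "trg E l = arr_ob E (fst p)"
        "x \<in> ar E" "src E x = src E l" "trg E x = X" "mor p \<cdot> k = iunit ?B \<cdot> x" "mor p \<cdot> l = iunit ?B \<cdot> x" "mor h \<cdot> k = mor h \<cdot> l"
      let ?i = "iunit ?A \<cdot> x"
      have i: "?i \<in> ar E" "src E ?i = src E l" "trg E ?i = src E (mor f)" "mor f \<cdot> ?i = iunit ?B \<cdot> x" 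
        using k mf sf(9) by simp_all
      \<comment> \<open>\<open>z\<close> and \<open>w\<close> are the elements
        \<open>(?i, k)\<close> and \<open>(?i, l)\<close>. The hypothesis on \<open>h\<close> makes
        their images under \<open>\<phi>\<close> equal.\<close>
      obtain z where z: "z \<in> ar E" "src E z = src E k" "trg E z = src E (mor ?a0)" "mor ?a0 \<cdot> z = ?i" "mor ?a1 \<cdot> z = k"
        by (rule is_pullback_ex[OF pbE i(1) k(1)]) (use i k mp(2) in simp_all)
      obtain w where w: "w \<in> ar E" "src E w = src E l" "trg E w = src E (mor ?a0)" "mor ?a0 \<cdot> w = ?i" "mor ?a1 \<cdot> w = l"
        by (rule is_pullback_ex[OF pbE i(1) k(2)]) (use i k mp(2) in simp_all)
      have 0: "mor ?b0 \<cdot> (mor \<phi> \<cdot> z) = mor ?b0 \<cdot> (mor \<phi> \<cdot> w)"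
        unfolding b0\<phi>[OF z(1,3)] b0\<phi>[OF w(1,3)] z(4) w(4) by (rule refl)
      have 1: "mor ?b1 \<cdot> (mor \<phi> \<cdot> z) = mor ?b1 \<cdot> (mor \<phi> \<cdot> w)"
        unfolding b1\<phi>[OF z(1,3)] b1\<phi>[OF w(1,3)] z(5) w(5) by (rule k)
      have "mor \<phi> \<cdot> z = mor \<phi> \<cdot> w"
        by (rule jointly_monicD[OF is_pullback_jointly_monic[OF pbE'] _ _ _ _ _ 0 1]) (use z w m\<phi>(1) ty\<phi> k(3) in simp_all)
      then have "z = w" by - (rule monicD[OF iso_monic[OF \<phi>]], use z w ty\<phi> k(3) in simp_all)
      then show "k = l" using z(5) w(5) by simp
    next
      fix k x
      assume k: "k \<in> ar E" "trg E k = arr_ob E (fst p')" "x \<in> ar E" "src E x = src E k" "trg E x = X"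
        "mor p' \<cdot> k = iunit ?B \<cdot> x"
      let ?i = "iunit ?A \<cdot> x"
      have i: "?i \<in> ar E" "src E ?i = src E k" "trg E ?i = src E (mor f)" "mor f \<cdot> ?i = iunit ?B \<cdot> x" 
        using k mf sf(9) by simp_all
      \<comment> \<open>\<open>z\<close> is \<open>(?i, k)\<close> in the pullback of
        \<open>p'\<close>. Its preimage under \<open>\<phi>\<close> keeps the component
        \<open>?i\<close>, so the other component \<open>?l\<close> again lies over an
        identity.\<close>
      obtain z where z: "z \<in> ar E" "src E z = src E k" "trg E z = src E (mor ?b0)" "mor ?b0 \<cdot> z = ?i" "mor ?b1 \<cdot> z = k"
        by (rule is_pullback_ex[OF pbE' i(1) k(1)]) (use i k mp'(2) in simp_all)
      obtain g where g: "g \<in> ar E" "src E g = src E (mor ?b0)" "trg E g = src E (mor ?a0)" "mor \<phi> \<cdot> g = idt E (src E (mor ?b0))"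
        using \<phi> ty\<phi> unfolding iso_def by auto
      have gz: "g \<cdot> z \<in> ar E" "trg E (g \<cdot> z) = src E (mor ?a0)" "src E (g \<cdot> z) = src E k" "mor \<phi> \<cdot> (g \<cdot> z) = z"
        using g(1-3) z m\<phi>(1) ty\<phi> by (simp_all add: cmp_reassoc[OF g(4)])
      let ?l = "mor ?a1 \<cdot> (g \<cdot> z)"
      have a0: "mor ?a0 \<cdot> (g \<cdot> z) = ?i" using b0\<phi>[OF gz(1,2)] unfolding gz(4) z(4) by simp
      have a1: "mor h \<cdot> ?l = k" using b1\<phi>[OF gz(1,2)] unfolding gz(4) z(5) by simp
      have "mor p \<cdot> ?l = iunit ?B \<cdot> x"
        using is_pullback_commute[OF pbE gz(1,2)] unfolding a0 i(4) by simp
      moreover have "?l \<in> ar E" "src E ?l = src E k" "trg E ?l = arr_ob E (fst p)"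
        using gz(1-3) tyE(5,6,8) mp(2) g z by simp_all
      ultimately show "\<exists>l. l \<in> ar E \<and> src E l = src E k \<and> trg E l = arr_ob E (fst p) \<and> mor p \<cdot> l = iunit ?B \<cdot> x \<and> mor h \<cdot> l = k"
        using a1 by blast
    qed
    then have "iso (Cat E X) h" by (rule Cat_isoI[OF h(1)])
    then show "iso (Pt (Cat E X) (trg (Cat E X) f)) hh"
      unfolding hh_eq by (rule Cat.iso_imp_iso_Pt[OF hh[unfolded hh_eq]])
  qed
qed

end

section \<open>Inverse images of relations\<close>

context finitely_complete_category
begin

text \<open>Besides the defining pullback and its two squares, the projections of
  \<open>prod_map\<close> and \<open>prod_pair\<close> are recorded. They make it possible to pass
  to underlying arrows when the category is the fibre, whose chosen products differ from those of
  the base.\<close>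

lemma inv_image_props:
  assumes u: "u \<in> ar C" and t: "t0 \<in> ar C" "t1 \<in> ar C" "src C t1 = src C t0" "trg C t0 = trg C u" "trg C t1 = trg C u"
  shows "is_pullback C (prod_map C u u) (prod_pair C t0 t1)
      (pb0 C (prod_map C u u) (prod_pair C t0 t1)) (inv_image_map C u (t0, t1))"
    "inv_image_map C u (t0, t1) \<in> ar C" "src C (pb0 C (prod_map C u u) (prod_pair C t0 t1)) = src C (inv_image_map C u (t0, t1))"
    "trg C (inv_image_map C u (t0, t1)) = src C t0"
    "fst (inv_image_rel C u (t0, t1)) \<in> ar C" "src C (fst (inv_image_rel C u (t0, t1))) = src C (inv_image_map C u (t0, t1))"
    "trg C (fst (inv_image_rel C u (t0, t1))) = src C u"
    "snd (inv_image_rel C u (t0, t1)) \<in> ar C" "src C (snd (inv_image_rel C u (t0, t1))) = src C (inv_image_map C u (t0, t1))"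
    "trg C (snd (inv_image_rel C u (t0, t1))) = src C u"
    "u \<cdot> fst (inv_image_rel C u (t0, t1)) = t0 \<cdot> inv_image_map C u (t0, t1)"
    "u \<cdot> snd (inv_image_rel C u (t0, t1)) = t1 \<cdot> inv_image_map C u (t0, t1)"
    "pr0 C (trg C u) (trg C u) \<cdot> prod_map C u u = u \<cdot> pr0 C (src C u) (src C u)"
    "pr1 C (trg C u) (trg C u) \<cdot> prod_map C u u = u \<cdot> pr1 C (src C u) (src C u)"
    "pr0 C (trg C u) (trg C u) \<cdot> prod_pair C t0 t1 = t0"
    "pr1 C (trg C u) (trg C u) \<cdot> prod_pair C t0 t1 = t1"
proof -
  let ?uu = "prod_map C u u" and ?tt = "prod_pair C t0 t1"
  let ?m = "pb0 C ?uu ?tt" and ?j = "pb1 C ?uu ?tt"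
  have o: "src C u \<in> ob C" "trg C u \<in> ob C" using u by simp_all
  have uu: "?uu \<in> ar C" "src C ?uu = src C (pr0 C (src C u) (src C u))" "trg C ?uu = src C (pr0 C (trg C u) (trg C u))"
    and p0: "pr0 C (trg C u) (trg C u) \<cdot> ?uu = u \<cdot> pr0 C (src C u) (src C u)"
    and p1: "pr1 C (trg C u) (trg C u) \<cdot> ?uu = u \<cdot> pr1 C (src C u) (src C u)"
    using u o unfolding prod_map_def by simp_all
  have tt: "?tt \<in> ar C" "src C ?tt = src C t0" "trg C ?tt = src C (pr0 C (trg C u) (trg C u))"
    and q0: "pr0 C (trg C u) (trg C u) \<cdot> ?tt = t0" and q1: "pr1 C (trg C u) (trg C u) \<cdot> ?tt = t1"
    using t by simp_all
  have com: "?uu \<cdot> ?m = ?tt \<cdot> ?j" using pb_commute0[of ?uu ?tt] uu tt by simp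
  have mj: "?m \<in> ar C" "?j \<in> ar C" "src C ?j = src C ?m" "trg C ?m = src C (pr0 C (src C u) (src C u))" "trg C ?j = src C t0"
    using uu tt by simp_all
  have "pr0 C (trg C u) (trg C u) \<cdot> (?uu \<cdot> ?m) = u \<cdot> (pr0 C (src C u) (src C u) \<cdot> ?m)"
    "pr1 C (trg C u) (trg C u) \<cdot> (?uu \<cdot> ?m) = u \<cdot> (pr1 C (src C u) (src C u) \<cdot> ?m)"
    using u o uu mj by (simp_all add: cmp_reassoc[OF p0] cmp_reassoc[OF p1])
  moreover have "pr0 C (trg C u) (trg C u) \<cdot> (?tt \<cdot> ?j) = t0 \<cdot> ?j" "pr1 C (trg C u) (trg C u) \<cdot> (?tt \<cdot> ?j) = t1 \<cdot> ?j"
    using u o tt mj by (simp_all add: cmp_reassoc[OF q0] cmp_reassoc[OF q1])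
  ultimately show "u \<cdot> fst (inv_image_rel C u (t0, t1)) = t0 \<cdot> inv_image_map C u (t0, t1)"
    "u \<cdot> snd (inv_image_rel C u (t0, t1)) = t1 \<cdot> inv_image_map C u (t0, t1)"
    unfolding inv_image_rel_def inv_image_map_def fst_conv snd_conv com by simp_all
  show "is_pullback C ?uu ?tt ?m (inv_image_map C u (t0, t1))"
    unfolding inv_image_map_def fst_conv snd_conv by (rule pb_is_pullback) (use uu tt in simp_all)
qed (use assms in \<open>simp_all add: inv_image_rel_def inv_image_map_def prod_map_def\<close>)

end

context fixed_objects
begin

text \<open>On elements the inverse image consists of triples \<open>(v, w, z)\<close> with
  \<open>u v = t0 z\<close> and \<open>u w = t1 z\<close>. The definition runs through products of
  the fibre, whose elements are parallel pairs; \<open>v\<close> and \<open>w\<close> are parallel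
  because \<open>u\<close>, \<open>t0\<close> and \<open>t1\<close> are the identity on
  objects.\<close>

lemma Cat_inv_image:
  assumes u: "u \<in> ar (Cat E X)" and R: "is_relation (Cat E X) (snd (snd u)) (t0, t1)"
  obtains i0 i1 j where "inv_image_rel (Cat E X) u (t0, t1) = (i0, i1)" "inv_image_map (Cat E X) u (t0, t1) = j"
    "i0 \<in> ar (Cat E X)" "i1 \<in> ar (Cat E X)" "j \<in> ar (Cat E X)" "fst i0 = fst j" "fst i1 = fst j"
    "snd (snd i0) = fst u" "snd (snd i1) = fst u" "snd (snd j) = fst t0"
    "u \<bullet> i0 = t0 \<bullet> j" "mor u \<cdot> mor i1 = mor t1 \<cdot> mor j"
    "\<And>v w z. v \<in> ar E \<Longrightarrow> w \<in> ar E \<Longrightarrow> z \<in> ar E \<Longrightarrow> src E v = src E z \<Longrightarrow> src E w = src E z \<Longrightarrow>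
      trg E v = arr_ob E (fst u) \<Longrightarrow> trg E w = arr_ob E (fst u) \<Longrightarrow> trg E z = arr_ob E (fst t0) \<Longrightarrow>
      mor u \<cdot> v = mor t0 \<cdot> z \<Longrightarrow> mor u \<cdot> w = mor t1 \<cdot> z \<Longrightarrow>
      \<exists>h. h \<in> ar E \<and> src E h = src E z \<and> trg E h = arr_ob E (fst j) \<and> mor i0 \<cdot> h = v \<and> mor i1 \<cdot> h = w \<and> mor j \<cdot> h = z"
    "\<And>x y. x \<in> ar E \<Longrightarrow> y \<in> ar E \<Longrightarrow> src E x = src E y \<Longrightarrow> trg E x = arr_ob E (fst j) \<Longrightarrow> trg E y = arr_ob E (fst j) \<Longrightarrow>
      mor i0 \<cdot> x = mor i0 \<cdot> y \<Longrightarrow> mor i1 \<cdot> x = mor i1 \<cdot> y \<Longrightarrow> mor j \<cdot> x = mor j \<cdot> y \<Longrightarrow> x = y"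
proof -
  let ?U = "fst u" and ?A = "snd (snd u)"
  have t: "t0 \<in> ar (Cat E X)" "t1 \<in> ar (Cat E X)" "fst t1 = fst t0" "snd (snd t0) = ?A" "snd (snd t1) = ?A"
    using R unfolding is_relation_def prod.case by (simp_all only: hom_iff src_Cat trg_Cat)
  have s: "src (Cat E X) t1 = src (Cat E X) t0" "trg (Cat E X) t0 = trg (Cat E X) u" "trg (Cat E X) t1 = trg (Cat E X) u"
    using t by (simp_all only: src_Cat trg_Cat)
  note I = Cat.inv_image_props[OF u t(1,2) s]
  define i0 i1 j where "i0 = fst (inv_image_rel (Cat E X) u (t0, t1))" and "i1 = snd (inv_image_rel (Cat E X) u (t0, t1))"
    and "j = inv_image_map (Cat E X) u (t0, t1)"
  let ?uu = "prod_map (Cat E X) u u" and ?tt = "prod_pair (Cat E X) t0 t1"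
  let ?m = "pb0 (Cat E X) ?uu ?tt"
  let ?p = "pr0 (Cat E X) ?U ?U" and ?q = "pr1 (Cat E X) ?U ?U" and ?p' = "pr0 (Cat E X) ?A ?A" and ?q' = "pr1 (Cat E X) ?A ?A"
  note J = I[folded i0_def i1_def j_def, unfolded src_Cat trg_Cat]
  note mu = Cat_mor[OF u] and m0 = Cat_mor[OF t(1)] and m1 = Cat_mor[OF t(2)]
  have U: "?U \<in> ob (Cat E X)" and A: "?A \<in> ob (Cat E X)" using mu by simp_all
  note PU = Cat.chosen_prod_is_product[OF U U] and PA = Cat.chosen_prod_is_product[OF A A]
  note PEU = Cat_is_product_mor[OF PU mu(4,4)] and PEA = Cat_is_product_mor[OF PA mu(5,5)]
  note jU = is_pullback_jointly_monic[OF PEU] and jA = is_pullback_jointly_monic[OF PEA]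
  note pE = Cat_is_pullback_mor[OF J(1)]
  note tE = is_pullback_typing[OF pE] and tU = is_pullback_typing[OF PEU] and tA = is_pullback_typing[OF PEA]
  have i: "i0 = ?p \<bullet> ?m" "i1 = ?q \<bullet> ?m"
    unfolding i0_def i1_def inv_image_rel_def fst_conv snd_conv src_Cat by simp_all
  have im: "mor i0 = mor ?p \<cdot> mor ?m" "mor i1 = mor ?q \<cdot> mor ?m" unfolding i by simp_all
  have c: "mor ?p' \<cdot> mor ?uu = mor u \<cdot> mor ?p" "mor ?q' \<cdot> mor ?uu = mor u \<cdot> mor ?q"
    "mor ?p' \<cdot> mor ?tt = mor t0" "mor ?q' \<cdot> mor ?tt = mor t1"
    using arg_cong[OF J(13), of mor] arg_cong[OF J(14), of mor] arg_cong[OF J(15), of mor] arg_cong[OF J(16), of mor]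
    by (simp_all only: cmp_Cat fst_conv snd_conv)
  have ttm: "src E (mor ?tt) = arr_ob E (fst t0)" "trg E (mor ?tt) = src E (mor ?p')" "src E (mor ?uu) = src E (mor ?p)"
  proof -
    have pt: "?tt \<in> ar (Cat E X)" "src (Cat E X) ?tt = src (Cat E X) t0" "trg (Cat E X) ?tt = src (Cat E X) ?p'"
      using Cat.prod_pair_ar[OF t(1,2) s(1)[symmetric] s(2,3)] Cat.src_prod_pair[OF t(1,2) s(1)[symmetric] s(2,3)]
        Cat.trg_prod_pair[OF t(1,2) s(1)[symmetric] s(2,3)] by (simp_all only: trg_Cat)
    have "?p' \<in> ar (Cat E X)" using Cat.is_product_typing(1)[OF PA] .
    from Cat_mor[OF pt(1)] Cat_mor(2)[OF this] pt(2,3)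
    show "src E (mor ?tt) = arr_ob E (fst t0)" "trg E (mor ?tt) = src E (mor ?p')" by (simp_all only: src_Cat trg_Cat)
    have pt': "trg (Cat E X) ?m = src (Cat E X) ?uu" "?uu \<in> ar (Cat E X)" using is_pullback_typing[OF J(1)] by blast+
    have pp: "?p \<in> ar (Cat E X)" using Cat.is_product_typing(1)[OF PU] .
    have "src (Cat E X) ?uu = src (Cat E X) ?p"
    proof -
      let ?a = "u \<bullet> ?p" and ?b = "u \<bullet> ?q"
      have uo: "src (Cat E X) u = fst u" by (rule src_Cat)
      have sp: "src (Cat E X) u = trg (Cat E X) ?p" "src (Cat E X) u = trg (Cat E X) ?q"
        using Cat.is_product_typing[OF PU] uo by simp_all
      note pq = Cat.is_product_typing[OF PU]
      have "src (Cat E X) (prod_pair (Cat E X) ?a ?b) = src (Cat E X) ?a"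
        by (rule Cat.src_prod_pair[OF Cat.cmp_ar[OF u pq(1) sp(1)] Cat.cmp_ar[OF u pq(2) sp(2)] _ refl refl])
          (simp only: Cat.src_cmp[OF u pq(1) sp(1)] Cat.src_cmp[OF u pq(2) sp(2)] pq(3))
      then show ?thesis unfolding prod_map_def uo Cat.src_cmp[OF u pq(1) sp(1)] .
    qed
    with Cat_mor(2)[OF pt'(2)] Cat_mor(2)[OF pp] show "src E (mor ?uu) = src E (mor ?p)" by (simp only: src_Cat)
  qed
  have pty: "mor ?p \<in> ar E" "mor ?q \<in> ar E" "src E (mor ?q) = src E (mor ?p)" "trg E (mor ?p) = arr_ob E ?U" "trg E (mor ?q) = arr_ob E ?U"
    "mor ?p' \<in> ar E" "mor ?q' \<in> ar E" "src E (mor ?q') = src E (mor ?p')"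
    using tU tA mu(4) by simp_all
  have mty: "mor ?m \<in> ar E" "mor j \<in> ar E" "src E (mor ?m) = arr_ob E (fst j)" "src E (mor j) = arr_ob E (fst j)" "trg E (mor ?m) = src E (mor ?p)"
    using tE ttm Cat_mor(2)[OF J(2)] by simp_all
  have uuty: "mor ?uu \<in> ar E" "mor ?tt \<in> ar E" "trg E (mor ?uu) = src E (mor ?p')" using tE ttm by simp_all
  show thesis
  proof (rule that[of i0 i1 j])
    show "inv_image_rel (Cat E X) u (t0, t1) = (i0, i1)" "inv_image_map (Cat E X) u (t0, t1) = j"
      unfolding i0_def i1_def j_def by simp_all
    show "i0 \<in> ar (Cat E X)" "i1 \<in> ar (Cat E X)" "j \<in> ar (Cat E X)" "fst i0 = fst j" "fst i1 = fst j"
      "snd (snd i0) = fst u" "snd (snd i1) = fst u" "snd (snd j) = fst t0"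
      "u \<bullet> i0 = t0 \<bullet> j" by (rule J)+
    show "mor u \<cdot> mor i1 = mor t1 \<cdot> mor j" using J(12) by (simp only: cmp_Cat prod.inject)
  next
    fix v w z
    assume h: "v \<in> ar E" "w \<in> ar E" "z \<in> ar E" "src E v = src E z" "src E w = src E z"
      "trg E v = arr_ob E (fst u)" "trg E w = arr_ob E (fst u)" "trg E z = arr_ob E (fst t0)"
      "mor u \<cdot> v = mor t0 \<cdot> z" "mor u \<cdot> w = mor t1 \<cdot> z"
    have T: "ifun (fst t0) ?A (mor t0)" "ifun (fst t0) ?A (mor t1)" "icat (fst t0)" using m0 m1 t by simp_all
    note su = ifun_simps[OF mu(6,4,5)] and s0 = ifun_simps[OF T(1,3) mu(5)] and s1 = ifun_simps[OF T(2,3) mu(5)]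
    have "idom ?U \<cdot> v = idom ?U \<cdot> w" "icod ?U \<cdot> v = icod ?U \<cdot> w"
      using su(7)[of v] su(7)[of w] su(8)[of v] su(8)[of w] s0(7)[of z] s1(7)[of z] s0(8)[of z] s1(8)[of z] h by simp_all
    then obtain n where n: "n \<in> ar E" "src E n = src E w" "trg E n = arr_ob E (fst ?p)" "mor ?p \<cdot> n = v" "mor ?q \<cdot> n = w"
      by (rule Cat_product_ex[OF PU mu(4,4) h(1,2), rotated 3]) (use h in simp_all)
    have np: "trg E n = src E (mor ?p)" using n(3) Cat_mor(2)[OF Cat.is_product_typing(1)[OF PU]] by simp
    have "mor ?uu \<cdot> n = mor ?tt \<cdot> z"
      by (rule jointly_monicD[OF jA])
        (use n np h pty mty uuty ttm mu in \<open>simp_all add: cmp_reassoc[OF c(1)] cmp_reassoc[OF c(2)] cmp_reassoc[OF c(3)] cmp_reassoc[OF c(4)]\<close>)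
    then obtain k where k: "k \<in> ar E" "src E k = src E z" "trg E k = src E (mor ?m)" "mor ?m \<cdot> k = n" "mor j \<cdot> k = z"
      by (rule is_pullback_ex[OF pE n(1) h(3), rotated 3]) (use n np h ttm in simp_all)
    have "mor i0 \<cdot> k = v" "mor i1 \<cdot> k = w" unfolding im using k n pty mty by simp_all
    with k mty show "\<exists>h. h \<in> ar E \<and> src E h = src E z \<and> trg E h = arr_ob E (fst j) \<and> mor i0 \<cdot> h = v \<and> mor i1 \<cdot> h = w \<and> mor j \<cdot> h = z"
      by (intro exI[of _ k]) simp
  next
    fix x y
    assume h: "x \<in> ar E" "y \<in> ar E" "src E x = src E y" "trg E x = arr_ob E (fst j)" "trg E y = arr_ob E (fst j)"
      "mor i0 \<cdot> x = mor i0 \<cdot> y" "mor i1 \<cdot> x = mor i1 \<cdot> y" "mor j \<cdot> x = mor j \<cdot> y"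
    have e: "mor ?p \<cdot> (mor ?m \<cdot> x) = mor ?p \<cdot> (mor ?m \<cdot> y)" "mor ?q \<cdot> (mor ?m \<cdot> x) = mor ?q \<cdot> (mor ?m \<cdot> y)"
      using h(6,7) h(1-5) pty mty unfolding im by simp_all
    have "mor ?m \<cdot> x = mor ?m \<cdot> y"
      by (rule jointly_monicD[OF jU _ _ _ _ _ e]) (use h pty mty in simp_all)
    then show "x = y"
      by - (rule jointly_monicD[OF is_pullback_jointly_monic[OF pE] _ _ _ _ _ _ h(8)], use h pty mty in simp_all)
  qed
qed

end

section \<open>The largest saturated equivalence relation\<close>

context maltsev_fixed_objects
begin

text \<open>With \<open>K\<close> the object of arrows \<open>y\<close> of \<open>R\<close> whose second leg is an identity, \<open>T\<close> is cut out of the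
  product \<open>A \<times> A\<close> in the fibre by the condition that \<open>b\<close> after the inverse of \<open>a\<close> is \<open>u\<close> of the
  first leg of an arrow in \<open>K\<close>. As it contains the identities, it is closed under composition.\<close>

lemma quotient_relation_exists:
  assumes icats: "icat U" "icat A" "icat R" and u: "ifun U A u" "monic E u"
    and s: "ifun R U s0" "ifun R U s1" and jm: "jointly_monic E s0 s1"
    and r: "r \<in> ar E" "src E r = arr_ob E U" "trg E r = arr_ob E R" "s0 \<cdot> r = idt E (arr_ob E U)" "s1 \<cdot> r = idt E (arr_ob E U)"
  obtains T t0 t1 where "icat T" "ifun T A t0" "ifun T A t1" "jointly_monic E t0 t1"
    "\<And>z. z \<in> ar E \<Longrightarrow> trg E z = arr_ob E T \<Longrightarrow>
      \<exists>y x. y \<in> ar E \<and> src E y = src E z \<and> trg E y = arr_ob E R \<and> x \<in> ar E \<and> src E x = src E z \<and> trg E x = X \<and>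
        s1 \<cdot> y = iunit U \<cdot> x \<and> icod A \<cdot> (t0 \<cdot> z) = x \<and> t1 \<cdot> z = icomp E A (t0 \<cdot> z) (u \<cdot> (s0 \<cdot> y))"
    "\<And>a y x. a \<in> ar E \<Longrightarrow> trg E a = arr_ob E A \<Longrightarrow> y \<in> ar E \<Longrightarrow> src E y = src E a \<Longrightarrow> trg E y = arr_ob E R \<Longrightarrow>
      x \<in> ar E \<Longrightarrow> src E x = src E a \<Longrightarrow> trg E x = X \<Longrightarrow> s1 \<cdot> y = iunit U \<cdot> x \<Longrightarrow> icod A \<cdot> a = x \<Longrightarrow>
      \<exists>z. z \<in> ar E \<and> src E z = src E a \<and> trg E z = arr_ob E T \<and> t0 \<cdot> z = a \<and> t1 \<cdot> z = icomp E A a (u \<cdot> (s0 \<cdot> y))"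
proof -
  note su = ifun_simps[OF u(1) icats(1,2)] and s0 = ifun_simps[OF s(1) icats(3,1)] and s1 = ifun_simps[OF s(2) icats(3,1)]
  let ?iU = "iunit U"
  let ?k0 = "pb0 E s1 ?iU" and ?k1 = "pb1 E s1 ?iU"
  have kty: "?k0 \<in> ar E" "?k1 \<in> ar E" "src E ?k1 = src E ?k0" "trg E ?k0 = arr_ob E R" "trg E ?k1 = X"
    using s1(1-3) icats by simp_all
  have kcom: "s1 \<cdot> (?k0 \<cdot> z) = ?iU \<cdot> (?k1 \<cdot> z)" if "z \<in> ar E" "trg E z = src E ?k0" for z
    using pb_commute[of s1 ?iU z] that s1(1-3) icats by simp
  define \<kappa> where "\<kappa> = u \<cdot> (s0 \<cdot> ?k0)"
  have \<kappa>: "\<kappa> \<in> ar E" "src E \<kappa> = src E ?k0" "trg E \<kappa> = arr_ob E A" and \<kappa>z: "\<And>z. z \<in> ar E \<Longrightarrow> trg E z = src E ?k0 \<Longrightarrow> \<kappa> \<cdot> z = u \<cdot> (s0 \<cdot> (?k0 \<cdot> z))"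
    unfolding \<kappa>_def using kty su(1-3) s0(1-3) by simp_all
  have ends: "idom A \<cdot> (u \<cdot> (s0 \<cdot> y)) = x" "icod A \<cdot> (u \<cdot> (s0 \<cdot> y)) = x"
    if "y \<in> ar E" "trg E y = arr_ob E R" "x \<in> ar E" "trg E x = X" "s1 \<cdot> y = ?iU \<cdot> x" for y x
    using that su(7,8)[of "s0 \<cdot> y"] s0(1-3) s0(7,8)[of y] s1(7,8)[of y] icats by simp_all
  have \<kappa>dc: "idom A \<cdot> (\<kappa> \<cdot> z) = ?k1 \<cdot> z" "icod A \<cdot> (\<kappa> \<cdot> z) = ?k1 \<cdot> z" if z: "z \<in> ar E" "trg E z = src E ?k0" for z
    unfolding \<kappa>z[OF z] by (rule ends; use z kty kcom[OF z] in simp)+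
  \<comment> \<open>The object at which the loop \<open>\<kappa> z\<close> sits determines the
    second leg, an identity, and \<open>u\<close> being monic determines the first leg. The two legs
    determine the element of \<open>R\<close>.\<close>
  have \<kappa>m: "monic E \<kappa>"
    unfolding monic_def
  proof (intro conjI allI impI)
    fix Z a b assume "a \<in> hom E Z (src E \<kappa>) \<and> b \<in> hom E Z (src E \<kappa>) \<and> \<kappa> \<cdot> a = \<kappa> \<cdot> b"
    then have ab: "a \<in> ar E" "b \<in> ar E" "src E a = src E b" "trg E a = src E ?k0" "trg E b = src E ?k0" and e: "\<kappa> \<cdot> a = \<kappa> \<cdot> b"
      using \<kappa>(2) by simp_all
    have 1: "?k1 \<cdot> a = ?k1 \<cdot> b" using \<kappa>dc(1)[OF ab(1,4)] \<kappa>dc(1)[OF ab(2,5)] e by simp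
    have 2: "s0 \<cdot> (?k0 \<cdot> a) = s0 \<cdot> (?k0 \<cdot> b)"
      by (rule monicD[OF u(2)]) (use ab kty s0(1-3) su(1-3) e \<kappa>z[OF ab(1,4)] \<kappa>z[OF ab(2,5)] in simp_all)
    have 3: "s1 \<cdot> (?k0 \<cdot> a) = s1 \<cdot> (?k0 \<cdot> b)" using kcom[OF ab(1,4)] kcom[OF ab(2,5)] 1 by simp
    have 4: "?k0 \<cdot> a = ?k0 \<cdot> b" by (rule jointly_monicD[OF jm _ _ _ _ _ 2 3]) (use ab kty s0 in simp_all)
    show "a = b" by (rule pb_eqI[of s1 ?iU, OF _ _ _ _ _ _ _ _ 4 1]) (use ab s1(1-3) icats in simp_all)
  qed (rule \<kappa>)
  have Ao: "A \<in> ob (Cat E X)" using icats by simp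
  note P = Cat.chosen_prod_is_product[OF Ao Ao]
  let ?p = "pr0 (Cat E X) A A" and ?q = "pr1 (Cat E X) A A"
  define Q q0 q1 where "Q = fst ?p" and "q0 = mor ?p" and "q1 = mor ?q"
  have pq: "?p \<in> ar (Cat E X)" "?q \<in> ar (Cat E X)" "fst ?q = fst ?p" "snd (snd ?p) = A" "snd (snd ?q) = A"
    using Cat.is_product_typing[OF P] by (simp_all only: src_Cat trg_Cat)
  have Q: "icat Q" "ifun Q A q0" "ifun Q A q1"
    unfolding Q_def q0_def q1_def using Cat_mor(4,6)[OF pq(1)] Cat_mor(6)[OF pq(2)] pq(3-5) by simp_all
  have qj: "jointly_monic E q0 q1"
    unfolding q0_def q1_def by (rule is_pullback_jointly_monic[OF Cat_is_product_mor[OF P icats(2,2)]])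
  note f0 = ifun_simps[OF Q(2,1) icats(2)] and f1 = ifun_simps[OF Q(3,1) icats(2)]
  have q0t: "trg E q0 = arr_ob E A" by (rule f0)
  obtain g where g: "composable E A q0 g" "composable E A g q0"
    "icomp E A q0 g = iunit A \<cdot> (idom A \<cdot> q0)" "icomp E A g q0 = iunit A \<cdot> (icod A \<cdot> q0)"
    using inverse_exists[OF icats(2) f0(1) q0t] by metis
  have gty: "g \<in> ar E" "src E g = arr_ob E Q" "trg E g = arr_ob E A" using g(1) f0(2) by simp_all
  have cg: "icod A \<cdot> g = idom Q" "idom A \<cdot> g = icod Q" using g(1,2) f0(4,5) by simp_all
  have gq: "composable E A g q1" using gty f1(1-4) cg by simp
  define \<delta> where "\<delta> = icomp E A g q1"
  have \<delta>: "\<delta> \<in> ar E" "src E \<delta> = arr_ob E Q" "trg E \<delta> = arr_ob E A" and d\<delta>: "idom A \<cdot> \<delta> = icod Q"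
    unfolding \<delta>_def using icats(2) gq gty cg by simp_all
  have q\<delta>: "icomp E A q0 \<delta> = q1"
  proof -
    have "icomp E A q0 \<delta> = icomp E A (icomp E A q0 g) q1" unfolding \<delta>_def by (rule icomp_assoc[symmetric, OF icats(2) g(1) gq])
    also have "\<dots> = q1" unfolding g(3) by (rule icomp_iunit_left[OF icats(2) f1(1,3)]) (use f0(4) f1(4) in simp)
    finally show ?thesis .
  qed
  have com\<delta>: "composable E A (q0 \<cdot> z) (\<delta> \<cdot> z)" and q\<delta>z: "icomp E A (q0 \<cdot> z) (\<delta> \<cdot> z) = q1 \<cdot> z"
    if z: "z \<in> ar E" "trg E z = arr_ob E Q" for z
  proof -
    have c0: "composable E A q0 \<delta>" using f0(1-3,5) \<delta> d\<delta> by simp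
    then show "composable E A (q0 \<cdot> z) (\<delta> \<cdot> z)"
      using composable_natural[OF icats(2) c0 z(1)] z f0(1-3) \<delta> by simp
    show "icomp E A (q0 \<cdot> z) (\<delta> \<cdot> z) = q1 \<cdot> z"
      using icomp_natural[OF icats(2) c0 z(1)] z f0(2) q\<delta> by simp
  qed
  \<comment> \<open>By cancellation \<open>\<delta> z\<close> is the only arrow that leads from
    \<open>q0 z\<close> to \<open>q1 z\<close> by composition. Values of \<open>\<delta>\<close> are
    found in this way, without computing the inverse \<open>g\<close>.\<close>
  have \<delta>_eqI: "\<delta> \<cdot> z = d" if z: "z \<in> ar E" "trg E z = arr_ob E Q" "composable E A (q0 \<cdot> z) d" "icomp E A (q0 \<cdot> z) d = q1 \<cdot> z" for z d
    by (rule icomp_right_cancel[OF icats(2) com\<delta>[OF z(1,2)] z(3)]) (use q\<delta>z[OF z(1,2)] z(4) in simp)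
  \<comment> \<open>\<open>\<delta>\<close> and \<open>\<kappa>\<close> serve only as arrows of
    \<open>E\<close>, so this pullback is taken in \<open>E\<close> and yields a subobject
    \<open>?t\<close> of the object of arrows of \<open>Q\<close>, not yet a category.\<close>
  let ?t = "pb0 E \<delta> \<kappa>" and ?l = "pb1 E \<delta> \<kappa>"
  have d\<kappa>: "trg E \<delta> = trg E \<kappa>" using \<delta> \<kappa> by simp
  have tty: "?t \<in> ar E" "?l \<in> ar E" "src E ?l = src E ?t" "trg E ?t = arr_ob E Q" "trg E ?l = src E ?k0"
    using \<delta> \<kappa> by simp_all
  have tcom: "\<delta> \<cdot> (?t \<cdot> z) = \<kappa> \<cdot> (?l \<cdot> z)" if "z \<in> ar E" "trg E z = src E ?t" for z
    using pb_commute[OF \<delta>(1) \<kappa>(1) d\<kappa> that] .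
  have tm: "monic E ?t"
    unfolding monic_def
  proof (intro conjI allI impI)
    fix Z a b assume "a \<in> hom E Z (src E ?t) \<and> b \<in> hom E Z (src E ?t) \<and> ?t \<cdot> a = ?t \<cdot> b"
    then have ab: "a \<in> ar E" "b \<in> ar E" "src E a = src E b" "trg E a = src E ?t" "trg E b = src E ?t" and e: "?t \<cdot> a = ?t \<cdot> b"
      by simp_all
    have "\<kappa> \<cdot> (?l \<cdot> a) = \<kappa> \<cdot> (?l \<cdot> b)" using tcom[OF ab(1,4)] tcom[OF ab(2,5)] e by simp
    then have "?l \<cdot> a = ?l \<cdot> b" by - (rule monicD[OF \<kappa>m], use ab tty \<kappa>(2) in simp_all)
    with e show "a = b" by - (rule pb_eqI[OF \<delta>(1) \<kappa>(1) d\<kappa>], use ab in simp_all)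
  qed (rule tty)
  have riU: "r \<cdot> ?iU \<in> ar E" "src E (r \<cdot> ?iU) = X" "trg E (r \<cdot> ?iU) = arr_ob E R" using r(1-3) icats by simp_all
  have rk: "s0 \<cdot> (r \<cdot> z) = z" "s1 \<cdot> (r \<cdot> z) = z" if "z \<in> ar E" "trg E z = arr_ob E U" for z
    using that r(1-3) s0(1-3) s1(1-3) by (simp_all add: cmp_reassoc[OF r(4)] cmp_reassoc[OF r(5)])
  have ke: "\<exists>k. k \<in> ar E \<and> src E k = src E y \<and> trg E k = src E ?k0 \<and> ?k0 \<cdot> k = y \<and> ?k1 \<cdot> k = x"
    if "y \<in> ar E" "trg E y = arr_ob E R" "x \<in> ar E" "src E x = src E y" "trg E x = X" "s1 \<cdot> y = ?iU \<cdot> x" for y x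
    by (rule exI[of _ "pb_pair E s1 ?iU y x"]) (use that s1(1-3) icats in simp_all)
  \<comment> \<open>The reflexivity arrow \<open>r\<close> turns each identity of \<open>U\<close>
    into an element of the kernel object, which \<open>\<kappa>\<close> sends to the identity of
    \<open>A\<close>. The difference of an identity with itself is that identity, so
    \<open>?t\<close> contains the identities of \<open>Q\<close>.\<close>
  obtain eK where eK: "eK \<in> ar E" "src E eK = X" "trg E eK = src E ?k0" "?k0 \<cdot> eK = r \<cdot> ?iU"
    using ke[of "r \<cdot> ?iU" "idt E X"] riU rk(2)[of ?iU] icats by auto
  have \<kappa>e: "\<kappa> \<cdot> eK = iunit A" using \<kappa>z[OF eK(1,3)] eK(4) rk(1)[of ?iU] icats su(6) by simp
  have \<delta>i: "\<delta> \<cdot> iunit Q = \<kappa> \<cdot> eK"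
    unfolding \<kappa>e by (rule \<delta>_eqI) (use Q(1) icats f0(6) f1(6) icomp_iunit_left[OF icats(2), of "iunit A" "idt E X"] in simp_all)
  define e where "e = pb_pair E \<delta> \<kappa> (iunit Q) eK"
  have e: "e \<in> ar E" "src E e = X" "trg E e = src E ?t" "?t \<cdot> e = iunit Q"
    unfolding e_def using \<delta> \<kappa> Q(1) eK \<delta>i by simp_all
  obtain T where T: "icat T" "arr_ob E T = src E ?t" "ifun T Q ?t"
  \<comment> \<open>Both legs are \<open>?t\<close>, so joint monicity is monicity of
    \<open>?t\<close>, and the composites are provided by
    \<open>monic_closed_under_icomp\<close>.\<close>
  proof (rule icat_of_legs[OF Q(1,1), of ?t "src E ?t" ?t e])
    show "jointly_monic E ?t ?t" using tm unfolding jointly_monic_def monic_def by blast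
    fix x y assume h: "x \<in> ar E" "y \<in> ar E" "trg E x = src E ?t" "trg E y = src E ?t" "src E x = src E y"
      "icod Q \<cdot> (?t \<cdot> x) = idom Q \<cdot> (?t \<cdot> y)"
    obtain z where "z \<in> ar E" "src E z = src E x" "trg E z = src E ?t" "?t \<cdot> z = icomp E Q (?t \<cdot> x) (?t \<cdot> y)"
      by (rule monic_closed_under_icomp[OF Q(1) tm tty(4) e h])
    then show "\<exists>z \<in> hom E (src E x) (src E ?t). ?t \<cdot> z = icomp E Q (?t \<cdot> x) (?t \<cdot> y) \<and> ?t \<cdot> z = icomp E Q (?t \<cdot> x) (?t \<cdot> y)"
      by (intro bexI[of _ z]) simp_all
  qed (use that e tty in simp_all)
  have tT: "trg E z = src E ?t" if "trg E z = arr_ob E T" for z using that T(2) by simp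
  show thesis
  proof (rule that[of T "q0 \<cdot> ?t" "q1 \<cdot> ?t"])
    show "icat T" by (rule T)
    show "ifun T A (q0 \<cdot> ?t)" "ifun T A (q1 \<cdot> ?t)"
      by (rule ifun_cmp[OF T(3) Q(2) T(1) Q(1) icats(2)] ifun_cmp[OF T(3) Q(3) T(1) Q(1) icats(2)])+
    show "jointly_monic E (q0 \<cdot> ?t) (q1 \<cdot> ?t)"
      unfolding jointly_monic_def
    proof (intro allI impI)
      fix Z a b assume "a \<in> hom E Z (src E (q0 \<cdot> ?t)) \<and> b \<in> hom E Z (src E (q0 \<cdot> ?t)) \<and>
        (q0 \<cdot> ?t) \<cdot> a = (q0 \<cdot> ?t) \<cdot> b \<and> (q1 \<cdot> ?t) \<cdot> a = (q1 \<cdot> ?t) \<cdot> b"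
      then have ab: "a \<in> ar E" "b \<in> ar E" "src E a = src E b" "trg E a = src E ?t" "trg E b = src E ?t"
        and e: "(q0 \<cdot> ?t) \<cdot> a = (q0 \<cdot> ?t) \<cdot> b" "(q1 \<cdot> ?t) \<cdot> a = (q1 \<cdot> ?t) \<cdot> b"
        using f0(1-3) tty by simp_all
      have "?t \<cdot> a = ?t \<cdot> b"
        by (rule jointly_monicD[OF qj]) (use ab e f0(1-3) f1(1-3) tty in simp_all)
      then show "a = b" by - (rule monicD[OF tm], use ab in simp_all)
    qed
  next
    fix z assume z: "z \<in> ar E" "trg E z = arr_ob E T"
    note z' = z(1) tT[OF z(2)]
    let ?y = "?k0 \<cdot> (?l \<cdot> z)" and ?x = "?k1 \<cdot> (?l \<cdot> z)"
    have tz: "?t \<cdot> z \<in> ar E" "trg E (?t \<cdot> z) = arr_ob E Q" using z' tty by simp_all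
    have lz: "?l \<cdot> z \<in> ar E" "trg E (?l \<cdot> z) = src E ?k0" "src E (?l \<cdot> z) = src E z" using z' tty by simp_all
    have d: "\<delta> \<cdot> (?t \<cdot> z) = u \<cdot> (s0 \<cdot> ?y)" using tcom[OF z'] \<kappa>z[OF lz(1,2)] by simp
    have "icod A \<cdot> (q0 \<cdot> (?t \<cdot> z)) = idom A \<cdot> (\<delta> \<cdot> (?t \<cdot> z))" using com\<delta>[OF tz] by simp
    also have "\<dots> = ?x" using tcom[OF z'] \<kappa>dc(1)[OF lz(1,2)] by simp
    finally have x: "icod A \<cdot> (q0 \<cdot> (?t \<cdot> z)) = ?x" .
    have "q1 \<cdot> (?t \<cdot> z) = icomp E A (q0 \<cdot> (?t \<cdot> z)) (u \<cdot> (s0 \<cdot> ?y))"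
      using q\<delta>z[OF tz] unfolding d by simp
    then show "\<exists>y x. y \<in> ar E \<and> src E y = src E z \<and> trg E y = arr_ob E R \<and> x \<in> ar E \<and> src E x = src E z \<and> trg E x = X \<and>
        s1 \<cdot> y = iunit U \<cdot> x \<and> icod A \<cdot> ((q0 \<cdot> ?t) \<cdot> z) = x \<and> (q1 \<cdot> ?t) \<cdot> z = icomp E A ((q0 \<cdot> ?t) \<cdot> z) (u \<cdot> (s0 \<cdot> y))"
      using lz kty kcom[OF lz(1,2)] x z' tty f0(1-3) f1(1-3) by (intro exI[of _ ?y] exI[of _ ?x]) simp
  next
    fix a y x
    assume h: "a \<in> ar E" "trg E a = arr_ob E A" "y \<in> ar E" "src E y = src E a" "trg E y = arr_ob E R"
      "x \<in> ar E" "src E x = src E a" "trg E x = X" "s1 \<cdot> y = iunit U \<cdot> x" "icod A \<cdot> a = x"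
    note en = ends[OF h(3,5,6,8,9)]
    let ?d = "u \<cdot> (s0 \<cdot> y)"
    have d: "?d \<in> ar E" "trg E ?d = arr_ob E A" "src E ?d = src E a" using h su(1-3) s0(1-3) by simp_all
    have ad: "composable E A a ?d" using h d en by simp
    let ?b = "icomp E A a ?d"
    have b: "?b \<in> ar E" "trg E ?b = arr_ob E A" "src E a = src E ?b" "idom A \<cdot> a = idom A \<cdot> ?b" "icod A \<cdot> a = icod A \<cdot> ?b"
      using ad icats(2) en h(10) by simp_all
    obtain w where w': "w \<in> ar E" "src E w = src E ?b" "trg E w = arr_ob E (fst ?p)" "mor ?p \<cdot> w = a" "mor ?q \<cdot> w = ?b"
      by (rule Cat_product_ex[OF P icats(2,2) h(1) b(1,3) h(2) b(2,4,5)])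
    have w: "w \<in> ar E" "src E w = src E a" "trg E w = arr_ob E Q" "q0 \<cdot> w = a" "q1 \<cdot> w = ?b"
      using w' b(3) unfolding Q_def q0_def q1_def by simp_all
    obtain k where k: "k \<in> ar E" "src E k = src E y" "trg E k = src E ?k0" "?k0 \<cdot> k = y"
      using ke[OF h(3,5,6) _ h(8,9)] h(4,7) by auto
    have "\<delta> \<cdot> w = ?d" by (rule \<delta>_eqI[OF w(1,3)]) (use ad w in simp_all)
    then have dk: "\<delta> \<cdot> w = \<kappa> \<cdot> k" using \<kappa>z[OF k(1,3)] k(4) by simp
    obtain z where z: "z \<in> ar E" "src E z = src E k" "trg E z = src E ?t" "?t \<cdot> z = w"
      by (rule is_pullback_ex[OF pb_is_pullback[OF \<delta>(1) \<kappa>(1) d\<kappa>] w(1) k(1) _ _ _ dk]) (use w k h(4) \<delta> \<kappa> in simp_all)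
    show "\<exists>z. z \<in> ar E \<and> src E z = src E a \<and> trg E z = arr_ob E T \<and> (q0 \<cdot> ?t) \<cdot> z = a \<and> (q1 \<cdot> ?t) \<cdot> z = icomp E A a (u \<cdot> (s0 \<cdot> y))"
      by (rule exI[of _ z]) (use z w k h(4) T(2) tty f0(1-3) f1(1-3) in simp)
  qed
qed

lemma equ_saturating_Cat: "equ_saturating_category (Cat E X)"
proof
  fix u S
  assume u: "monic (Cat E X) u" and S': "is_equivalence (Cat E X) (src (Cat E X) u) S"
  obtain s0 s1 where S_eq: "S = (s0, s1)" by (cases S)
  note S = S'[unfolded S_eq src_Cat]
  let ?U = "fst u" and ?A = "snd (snd u)" and ?R = "fst s0"
  have ua: "u \<in> ar (Cat E X)" using u unfolding monic_def by blast
  have um: "monic E (mor u)" by (rule Cat_monic_mor[OF u])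
  have S_refl: "is_reflexive (Cat E X) ?U (s0, s1)" using S unfolding is_equivalence_def by blast
  then have S_rel: "is_relation (Cat E X) ?U (s0, s1)" unfolding is_reflexive_def by simp
  have s: "s0 \<in> ar (Cat E X)" "s1 \<in> ar (Cat E X)" "fst s1 = ?R" "snd (snd s0) = ?U" "snd (snd s1) = ?U"
    using S_rel unfolding is_relation_def prod.case by (simp_all only: hom_iff src_Cat trg_Cat)
  note mu = Cat_mor[OF ua] and m0 = Cat_mor[OF s(1)] and m1 = Cat_mor[OF s(2)]
  note SE = Cat_reflexive_mor[OF S_refl]
  have sjm: "jointly_monic E (mor s0) (mor s1)" by (rule Cat_relation_mor[OF S_rel])
  obtain r where r: "r \<in> ar E" "src E r = arr_ob E ?U" "trg E r = arr_ob E ?R"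
    "mor s0 \<cdot> r = idt E (arr_ob E ?U)" "mor s1 \<cdot> r = idt E (arr_ob E ?U)"
    using SE m0(2) unfolding is_reflexive_def prod.case by auto
  have sfun: "ifun ?R ?U (mor s0)" "ifun ?R ?U (mor s1)" using m0 m1 s by simp_all
  obtain T t0 t1 where T: "icat T" "ifun T ?A t0" "ifun T ?A t1" and tjm: "jointly_monic E t0 t1"
    and T_elim: "\<And>z. z \<in> ar E \<Longrightarrow> trg E z = arr_ob E T \<Longrightarrow>
      \<exists>y x. y \<in> ar E \<and> src E y = src E z \<and> trg E y = arr_ob E ?R \<and> x \<in> ar E \<and> src E x = src E z \<and> trg E x = X \<and>
        mor s1 \<cdot> y = iunit ?U \<cdot> x \<and> icod ?A \<cdot> (t0 \<cdot> z) = x \<and> t1 \<cdot> z = icomp E ?A (t0 \<cdot> z) (mor u \<cdot> (mor s0 \<cdot> y))"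
    and T_intro: "\<And>a y x. a \<in> ar E \<Longrightarrow> trg E a = arr_ob E ?A \<Longrightarrow> y \<in> ar E \<Longrightarrow> src E y = src E a \<Longrightarrow> trg E y = arr_ob E ?R \<Longrightarrow>
      x \<in> ar E \<Longrightarrow> src E x = src E a \<Longrightarrow> trg E x = X \<Longrightarrow> mor s1 \<cdot> y = iunit ?U \<cdot> x \<Longrightarrow> icod ?A \<cdot> a = x \<Longrightarrow>
      \<exists>z. z \<in> ar E \<and> src E z = src E a \<and> trg E z = arr_ob E T \<and> t0 \<cdot> z = a \<and> t1 \<cdot> z = icomp E ?A a (mor u \<cdot> (mor s0 \<cdot> y))"
    by (rule quotient_relation_exists[OF mu(4,5) m0(4) mu(6) um sfun sjm r]) blast
  let ?t0 = "(T, t0, ?A)" and ?t1 = "(T, t1, ?A)"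
  note su = ifun_simps[OF mu(6,4,5)] and f0 = ifun_simps[OF sfun(1) m0(4) mu(4)] and f1 = ifun_simps[OF sfun(2) m0(4) mu(4)]
    and g0 = ifun_simps[OF T(2,1) mu(5)] and g1 = ifun_simps[OF T(3,1) mu(5)]
  have ends: "idom ?U \<cdot> (mor s0 \<cdot> y) = x" "icod ?U \<cdot> (mor s0 \<cdot> y) = x"
    if "y \<in> ar E" "trg E y = arr_ob E ?R" "x \<in> ar E" "trg E x = X" "mor s1 \<cdot> y = iunit ?U \<cdot> x" for y x
    using that f0(7,8)[of y] f1(7,8)[of y] mu(4) by simp_all
  have ta: "?t0 \<in> ar (Cat E X)" "?t1 \<in> ar (Cat E X)" using T mu(5) by simp_all
  have t_rel: "is_relation (Cat E X) ?A (?t0, ?t1)"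
    unfolding is_relation_def prod.case
  proof (intro conjI allI impI)
    show "?A \<in> ob (Cat E X)" "?t0 \<in> hom (Cat E X) (src (Cat E X) ?t0) ?A" "?t1 \<in> hom (Cat E X) (src (Cat E X) ?t0) ?A"
      using ta mu(5) by simp_all
    fix Z a b
    assume "a \<in> hom (Cat E X) Z (src (Cat E X) ?t0) \<and> b \<in> hom (Cat E X) Z (src (Cat E X) ?t0) \<and>
      ?t0 \<bullet> a = ?t0 \<bullet> b \<and> ?t1 \<bullet> a = ?t1 \<bullet> b"
    then have ab: "a \<in> ar (Cat E X)" "b \<in> ar (Cat E X)" "fst a = Z" "fst b = Z" "snd (snd a) = T" "snd (snd b) = T"
      and e: "t0 \<cdot> mor a = t0 \<cdot> mor b" "t1 \<cdot> mor a = t1 \<cdot> mor b"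
      by (simp_all only: hom_iff src_Cat trg_Cat cmp_Cat prod.inject fst_conv snd_conv)
    have "mor a = mor b"
      by (rule jointly_monicD[OF tjm _ _ _ _ _ e]) (use Cat_mor[OF ab(1)] Cat_mor[OF ab(2)] ab g0(2) in simp_all)
    then show "a = b" using ab by (intro Cat_eqI) simp_all
  qed
  have t_refl: "is_reflexive (Cat E X) ?A (?t0, ?t1)"
  proof -
    let ?o = "idt E (arr_ob E ?A)" and ?x = "icod ?A"
    \<comment> \<open>The difference of an arrow with itself is an identity, which \<open>S\<close>
      relates to itself through \<open>r\<close>.\<close>
    let ?y = "r \<cdot> (iunit ?U \<cdot> ?x)"
    have rz: "mor s0 \<cdot> ?y = iunit ?U \<cdot> ?x" "mor s1 \<cdot> ?y = iunit ?U \<cdot> ?x"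
      using r(1-3) mu(4,5) f0(1-3) f1(1-3) by (simp_all add: cmp_reassoc[OF r(4)] cmp_reassoc[OF r(5)])
    have "\<exists>z. z \<in> ar E \<and> src E z = src E ?o \<and> trg E z = arr_ob E T \<and> t0 \<cdot> z = ?o \<and> t1 \<cdot> z = icomp E ?A ?o (mor u \<cdot> (mor s0 \<cdot> ?y))"
      by (rule T_intro[of _ _ ?x]) (use r(1-3) mu(4,5) rz in simp_all)
    then obtain z where z: "z \<in> ar E" "src E z = arr_ob E ?A" "trg E z = arr_ob E T" "t0 \<cdot> z = ?o" 
      "t1 \<cdot> z = icomp E ?A ?o (mor u \<cdot> (iunit ?U \<cdot> ?x))" unfolding rz using mu(5) by auto
    have "t1 \<cdot> z = ?o"
      unfolding z(5) using mu(4,5) su(9)[of ?x] by (simp add: icomp_iunit_right)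
    note z = z(1-4) this
    let ?i = "idt (Cat E X) ?A"
    have i: "?i \<in> ar (Cat E X)" "snd (snd ?i) = ?A" using mu(5) by (simp_all add: ifun_idt)
    have "(fst ?i, z, fst ?t0) \<in> ar (Cat E X)"
      by (rule Cat_liftI[OF i i refl ta(1) _ ta(2)]) (use z tjm in \<open>simp_all del: ar_Cat\<close>)
    then have "(?A, z, T) \<in> hom (Cat E X) ?A (src (Cat E X) ?t0)" by simp
    moreover have "?t0 \<bullet> (?A, z, T) = idt (Cat E X) ?A" "?t1 \<bullet> (?A, z, T) = idt (Cat E X) ?A"
      using z by simp_all
    ultimately show ?thesis using t_rel unfolding is_reflexive_def prod.case by blast
  qed
  have t_equ: "is_equivalence (Cat E X) ?A (?t0, ?t1)"
    by (rule maltsev_category.reflexive_imp_equivalence[OF maltsev_Cat t_refl])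
  obtain i0 i1 j where I: "inv_image_rel (Cat E X) u (?t0, ?t1) = (i0, i1)" "inv_image_map (Cat E X) u (?t0, ?t1) = j"
    "i0 \<in> ar (Cat E X)" "i1 \<in> ar (Cat E X)" "j \<in> ar (Cat E X)" "fst i0 = fst j" "fst i1 = fst j"
    "snd (snd i0) = ?U" "snd (snd i1) = ?U" "snd (snd j) = fst ?t0"
    "u \<bullet> i0 = ?t0 \<bullet> j" "mor u \<cdot> mor i1 = mor ?t1 \<cdot> mor j"
    and I_ex: "\<And>v w z. v \<in> ar E \<Longrightarrow> w \<in> ar E \<Longrightarrow> z \<in> ar E \<Longrightarrow> src E v = src E z \<Longrightarrow> src E w = src E z \<Longrightarrow>
      trg E v = arr_ob E ?U \<Longrightarrow> trg E w = arr_ob E ?U \<Longrightarrow> trg E z = arr_ob E (fst ?t0) \<Longrightarrow>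
      mor u \<cdot> v = mor ?t0 \<cdot> z \<Longrightarrow> mor u \<cdot> w = mor ?t1 \<cdot> z \<Longrightarrow>
      \<exists>h. h \<in> ar E \<and> src E h = src E z \<and> trg E h = arr_ob E (fst j) \<and> mor i0 \<cdot> h = v \<and> mor i1 \<cdot> h = w \<and> mor j \<cdot> h = z"
    and I_eq: "\<And>x y. x \<in> ar E \<Longrightarrow> y \<in> ar E \<Longrightarrow> src E x = src E y \<Longrightarrow> trg E x = arr_ob E (fst j) \<Longrightarrow> trg E y = arr_ob E (fst j) \<Longrightarrow>
      mor i0 \<cdot> x = mor i0 \<cdot> y \<Longrightarrow> mor i1 \<cdot> x = mor i1 \<cdot> y \<Longrightarrow> mor j \<cdot> x = mor j \<cdot> y \<Longrightarrow> x = y"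
    by (rule Cat_inv_image[OF ua t_rel]) blast
  note n0 = Cat_mor[OF I(3)] and n1 = Cat_mor[OF I(4)] and nj = Cat_mor[OF I(5)]
  have nty: "src E (mor i0) = arr_ob E (fst j)" "trg E (mor i0) = arr_ob E ?U" "src E (mor i1) = arr_ob E (fst j)"
    "trg E (mor i1) = arr_ob E ?U" "trg E (mor j) = arr_ob E T" using n0 n1 nj I by simp_all
  have ui0: "mor u \<cdot> mor i0 = t0 \<cdot> mor j" using I(11) by (simp only: cmp_Cat prod.inject fst_conv snd_conv)
  have ui1: "mor u \<cdot> mor i1 = t1 \<cdot> mor j" using I(12) by simp
  \<comment> \<open>The leg \<open>i1\<close> is recovered from \<open>j\<close>, because
    \<open>u\<close> after \<open>i1\<close> is \<open>t1\<close> after \<open>j\<close> and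
    \<open>u\<close> is monic.\<close>
  have ijm: "jointly_monic E (mor i0) (mor j)"
    unfolding jointly_monic_def
  proof (intro allI impI)
    fix Z x y assume "x \<in> hom E Z (src E (mor i0)) \<and> y \<in> hom E Z (src E (mor i0)) \<and>
      mor i0 \<cdot> x = mor i0 \<cdot> y \<and> mor j \<cdot> x = mor j \<cdot> y"
    then have xy: "x \<in> ar E" "y \<in> ar E" "src E x = src E y" "trg E x = arr_ob E (fst j)" "trg E y = arr_ob E (fst j)"
      and e: "mor i0 \<cdot> x = mor i0 \<cdot> y" "mor j \<cdot> x = mor j \<cdot> y" using nty by simp_all
    have "mor u \<cdot> (mor i1 \<cdot> x) = t1 \<cdot> (mor j \<cdot> x)" "mor u \<cdot> (mor i1 \<cdot> y) = t1 \<cdot> (mor j \<cdot> y)"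
      using xy n1(1) nty nj(1,2) mu(1,2) g1(1-3) by (simp_all add: cmp_reassoc[OF ui1])
    then have "mor u \<cdot> (mor i1 \<cdot> x) = mor u \<cdot> (mor i1 \<cdot> y)" using e(2) by simp
    then have "mor i1 \<cdot> x = mor i1 \<cdot> y"
      by - (rule monicD[OF um], use xy n1(1) nty mu(2) in simp_all)
    with e show "x = y" by (intro I_eq[OF xy]) simp_all
  qed
  have t_sat: "saturated (Cat E X) u (?t0, ?t1)"
    unfolding saturated_def I fst_conv
  proof (rule is_pullbackI[where P = "fst j"])
    show "u \<in> ar (Cat E X)" "?t0 \<in> ar (Cat E X)" "trg (Cat E X) u = trg (Cat E X) ?t0" using ua ta by (simp_all only: trg_Cat snd_conv)
    show "i0 \<in> hom (Cat E X) (fst j) (src (Cat E X) u)" "j \<in> hom (Cat E X) (fst j) (src (Cat E X) ?t0)"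
      using I by (simp_all only: hom_iff src_Cat trg_Cat)
    show "u \<bullet> i0 = ?t0 \<bullet> j" by (rule I)
    show "jointly_monic (Cat E X) i0 j"
      unfolding jointly_monic_def
    proof (intro allI impI)
      fix Z a b
      assume "a \<in> hom (Cat E X) Z (src (Cat E X) i0) \<and> b \<in> hom (Cat E X) Z (src (Cat E X) i0) \<and>
        i0 \<bullet> a = i0 \<bullet> b \<and> j \<bullet> a = j \<bullet> b"
      then have ab: "a \<in> ar (Cat E X)" "b \<in> ar (Cat E X)" "fst a = Z" "fst b = Z" "snd (snd a) = fst i0" "snd (snd b) = fst i0"
        and e: "mor i0 \<cdot> mor a = mor i0 \<cdot> mor b" "mor j \<cdot> mor a = mor j \<cdot> mor b"
        by (simp_all only: hom_iff src_Cat trg_Cat cmp_Cat prod.inject)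
      have "mor a = mor b"
        by (rule jointly_monicD[OF ijm _ _ _ _ _ e]) (use Cat_mor[OF ab(1)] Cat_mor[OF ab(2)] ab n0(2) in simp_all)
      then show "a = b" using ab by (intro Cat_eqI) simp_all
    qed
    fix Z a b
    assume "a \<in> hom (Cat E X) Z (src (Cat E X) u)" "b \<in> hom (Cat E X) Z (src (Cat E X) ?t0)"
      "u \<bullet> a = ?t0 \<bullet> b"
    then have ab: "a \<in> ar (Cat E X)" "b \<in> ar (Cat E X)" "fst a = Z" "fst b = Z" "snd (snd a) = ?U" "snd (snd b) = T"
      and e: "mor u \<cdot> mor a = t0 \<cdot> mor b"
      by (simp_all only: hom_iff src_Cat trg_Cat cmp_Cat prod.inject fst_conv snd_conv)
    note ma = Cat_mor[OF ab(1)] and mb = Cat_mor[OF ab(2)]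
    have at: "trg E (mor a) = arr_ob E ?U" "src E (mor a) = src E (mor b)" "trg E (mor b) = arr_ob E T" using ma mb ab by simp_all
    obtain y x where y: "y \<in> ar E" "src E y = src E (mor b)" "trg E y = arr_ob E ?R" "x \<in> ar E" "src E x = src E (mor b)" "trg E x = X"
        "mor s1 \<cdot> y = iunit ?U \<cdot> x" "icod ?A \<cdot> (t0 \<cdot> mor b) = x" "t1 \<cdot> mor b = icomp E ?A (t0 \<cdot> mor b) (mor u \<cdot> (mor s0 \<cdot> y))"
      using T_elim[OF mb(1) at(3)] by blast
    note en = ends[OF y(1,3,4,6,7)]
    have ca: "icod ?U \<cdot> mor a = x" using su(8)[OF ma(1) at(1)] y(8) e by simp
    have c: "composable E ?U (mor a) (mor s0 \<cdot> y)" using ma(1) at y f0(1-3) en ca by simp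
    \<comment> \<open>The arrow that \<open>T\<close> relates to \<open>u a\<close> is
      \<open>u a\<close> followed by \<open>u (s0 y)\<close>, hence \<open>u\<close> of this
      composite. So both legs come from \<open>U\<close>, which is saturation.\<close>
    let ?w = "icomp E ?U (mor a) (mor s0 \<cdot> y)"
    have w: "?w \<in> ar E" "src E ?w = src E (mor b)" "trg E ?w = arr_ob E ?U" using c mu(4) at(2) by simp_all
    have "mor u \<cdot> ?w = t1 \<cdot> mor b" unfolding y(9) su(10)[OF c] e by (rule refl)
    then obtain h where h: "h \<in> ar E" "src E h = src E (mor b)" "trg E h = arr_ob E (fst j)" "mor i0 \<cdot> h = mor a" "mor j \<cdot> h = mor b"
      using I_ex[OF ma(1) w(1) mb(1) at(2) w(2) at(1) w(3)] at(3) e by auto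
    have "(fst a, h, fst i0) \<in> ar (Cat E X)"
      by (rule Cat_liftI[OF ab(1,5,2,6) _ I(3,8) I(5) _ _ ijm]) (use ab(3,4) I(6,10) h ma(2) at(2) in simp_all)
    then have "(Z, h, fst j) \<in> hom (Cat E X) Z (fst j)" using ab(3) I(6) by (simp only: hom_iff src_Cat trg_Cat fst_conv snd_conv)
    moreover have "i0 \<bullet> (Z, h, fst j) = a" "j \<bullet> (Z, h, fst j) = b"
      by (rule Cat_eqI; use h ab I in simp)+
    ultimately show "\<exists>h. h \<in> hom (Cat E X) Z (fst j) \<and> i0 \<bullet> h = a \<and> j \<bullet> h = b" by blast
  qed
  have t_le: "rel_le (Cat E X) (i0, i1) (s0, s1)"
  proof -
    obtain y x where y: "y \<in> ar E" "src E y = src E (mor j)" "trg E y = arr_ob E ?R" "x \<in> ar E" "src E x = src E (mor j)" "trg E x = X"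
        "mor s1 \<cdot> y = iunit ?U \<cdot> x" "icod ?A \<cdot> (t0 \<cdot> mor j) = x" "t1 \<cdot> mor j = icomp E ?A (t0 \<cdot> mor j) (mor u \<cdot> (mor s0 \<cdot> y))"
      using T_elim[OF nj(1) nty(5)] by blast
    note en = ends[OF y(1,3,4,6,7)]
    have ca: "icod ?U \<cdot> mor i0 = x" using su(8)[OF n0(1) nty(2)] y(8) ui0 by simp
    have c: "composable E ?U (mor i0) (mor s0 \<cdot> y)" using n0(1) nty nj(2) y f0(1-3) en ca by simp
    have "mor u \<cdot> mor i1 = mor u \<cdot> icomp E ?U (mor i0) (mor s0 \<cdot> y)"
      unfolding ui1 y(9) su(10)[OF c] ui0 by (rule refl)
    then have i1: "mor i1 = icomp E ?U (mor i0) (mor s0 \<cdot> y)"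
      by - (rule monicD[OF um], use c n1(1) nty mu(2,4) in simp_all)
    have ys: "trg E y = src E (mor s0)" using y(3) f0(2) by simp
    \<comment> \<open>\<open>y\<close> relates \<open>s0 y\<close> to an identity; its reverse
      \<open>y'\<close> relates the identity to \<open>s0 y\<close>. Preceded in the category
      \<open>?R\<close> by the reflexive pair on \<open>i0\<close>, it relates \<open>i0\<close> to
      \<open>i0\<close> followed by \<open>s0 y\<close>, which is \<open>i1\<close>.\<close>
    obtain y' where y': "y' \<in> ar E" "src E y' = src E y" "trg E y' = src E (mor s0)" "mor s0 \<cdot> y' = mor s1 \<cdot> y" "mor s1 \<cdot> y' = mor s0 \<cdot> y"
      by (rule reflexive_symD[OF SE y(1) ys])
    have ri: "r \<cdot> mor i0 \<in> ar E" "src E (r \<cdot> mor i0) = arr_ob E (fst j)" "trg E (r \<cdot> mor i0) = arr_ob E ?R"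
      "mor s0 \<cdot> (r \<cdot> mor i0) = mor i0" "mor s1 \<cdot> (r \<cdot> mor i0) = mor i0"
      using r(1-3) n0(1) nty f0(1-3) f1(1-3) by (simp_all add: cmp_reassoc[OF r(4)] cmp_reassoc[OF r(5)])
    have y't: "trg E y' = arr_ob E ?R" using y'(3) f0(2) by simp
    have "icod ?R \<cdot> (r \<cdot> mor i0) = x" using f0(8)[OF ri(1,3)] ri(4) ca by simp
    moreover have "idom ?R \<cdot> y' = x" using f1(7)[OF y'(1) y't] y'(5) en by simp
    ultimately have cr: "composable E ?R (r \<cdot> mor i0) y'" using ri y' y(2) y't nj(2) by simp
    let ?h = "icomp E ?R (r \<cdot> mor i0) y'"
    have h0: "mor s0 \<cdot> ?h = mor i0"
      unfolding f0(10)[OF cr] ri(4) y'(4) y(7) by (rule icomp_iunit_right[OF mu(4) n0(1) nty(2) ca])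
    have h1: "mor s1 \<cdot> ?h = mor i1" unfolding f1(10)[OF cr] ri(5) y'(5) i1 by (rule refl)
    have "(fst i0, ?h, fst s0) \<in> ar (Cat E X)"
      by (rule Cat_liftI[OF I(3,8) I(4,9) _ s(1,4,2,5,3) sjm _ _ _ h0 h1]) (use I(6,7) cr ri m0(4) in simp_all)
    then have "(fst i0, ?h, fst s0) \<in> hom (Cat E X) (src (Cat E X) i0) (src (Cat E X) s0)"
      by (simp only: hom_iff src_Cat trg_Cat fst_conv snd_conv)
    moreover have "s0 \<bullet> (fst i0, ?h, fst s0) = i0" "s1 \<bullet> (fst i0, ?h, fst s0) = i1"
      by (rule Cat_eqI; use h0 h1 I(6-9) s in simp)+
    ultimately show ?thesis unfolding rel_le_def prod.case by blast
  qed
  have cand: "equ_candidate (Cat E X) u S (?t0, ?t1)"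
    unfolding equ_candidate_def I S_eq using t_equ t_sat t_le by (simp only: trg_Cat simp_thms)
  moreover have "rel_le (Cat E X) T' (?t0, ?t1)" if T': "equ_candidate (Cat E X) u S T'" for T'
  proof -
    obtain v0 v1 where T'_eq: "T' = (v0, v1)" by (cases T')
    have v_equ: "is_equivalence (Cat E X) ?A (v0, v1)" and v_sat: "saturated (Cat E X) u (v0, v1)"
      and v_le: "rel_le (Cat E X) (inv_image_rel (Cat E X) u (v0, v1)) (s0, s1)"
      using T' unfolding equ_candidate_def T'_eq S_eq trg_Cat by blast+
    have v_refl: "is_reflexive (Cat E X) ?A (v0, v1)" using v_equ unfolding is_equivalence_def by blast
    then have v_rel: "is_relation (Cat E X) ?A (v0, v1)" unfolding is_reflexive_def by simp
    let ?V = "fst v0"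
    have v: "v0 \<in> ar (Cat E X)" "v1 \<in> ar (Cat E X)" "fst v1 = ?V" "snd (snd v0) = ?A" "snd (snd v1) = ?A"
      using v_rel unfolding is_relation_def prod.case by (simp_all only: hom_iff src_Cat trg_Cat)
    note w0 = Cat_mor[OF v(1)] and w1 = Cat_mor[OF v(2)]
    have vfun: "ifun ?V ?A (mor v0)" "ifun ?V ?A (mor v1)" using w0 w1 v by simp_all
    note e0 = ifun_simps[OF vfun(1) w0(4) mu(5)] and e1 = ifun_simps[OF vfun(2) w0(4) mu(5)]
    let ?a = "mor v0" and ?b = "mor v1"
    obtain \<rho> where \<rho>: "\<rho> \<in> ar E" "src E \<rho> = arr_ob E ?A" "trg E \<rho> = arr_ob E ?V"
      "?a \<cdot> \<rho> = idt E (arr_ob E ?A)" "?b \<cdot> \<rho> = idt E (arr_ob E ?A)"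
      using Cat_reflexive_mor[OF v_refl] w0(2) unfolding is_reflexive_def prod.case by auto
    obtain g where g: "composable E ?A ?a g" "composable E ?A g ?a"
      "icomp E ?A ?a g = iunit ?A \<cdot> (idom ?A \<cdot> ?a)" "icomp E ?A g ?a = iunit ?A \<cdot> (icod ?A \<cdot> ?a)"
      using inverse_exists[OF mu(5) e0(1,3)] by metis
    have gty: "g \<in> ar E" "src E g = arr_ob E ?V" "trg E g = arr_ob E ?A" using g(1) e0(2) by simp_all
    have \<rho>g: "\<rho> \<cdot> g \<in> ar E" "src E (\<rho> \<cdot> g) = arr_ob E ?V" "trg E (\<rho> \<cdot> g) = arr_ob E ?V" "?a \<cdot> (\<rho> \<cdot> g) = g" "?b \<cdot> (\<rho> \<cdot> g) = g"
      using \<rho>(1-3) gty e0(1-3) e1(1-3) by (simp_all add: cmp_reassoc[OF \<rho>(4)] cmp_reassoc[OF \<rho>(5)])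
    let ?o = "idt E (arr_ob E ?V)"
    have o: "?o \<in> ar E" "src E ?o = arr_ob E ?V" "trg E ?o = arr_ob E ?V" "?a \<cdot> ?o = ?a" "?b \<cdot> ?o = ?b" "idom ?V \<cdot> ?o = idom ?V"
      using w0(4) e0(1,2) e1(1,2) by simp_all
    have "icod ?V \<cdot> (\<rho> \<cdot> g) = idom ?V" using e0(8)[OF \<rho>g(1,3)] \<rho>g(4) g(2) e0(4) by simp
    then have c\<theta>: "composable E ?V (\<rho> \<cdot> g) ?o" using \<rho>g o by simp
    \<comment> \<open>The translation by the inverse \<open>g\<close> of \<open>?a\<close>:
      \<open>\<rho> g\<close> is the reflexive pair \<open>(g, g)\<close>, and followed by the
      generic pair \<open>(?a, ?b)\<close> it relates an identity to \<open>?b\<close> after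
      \<open>g\<close>.\<close>
    let ?\<theta> = "icomp E ?V (\<rho> \<cdot> g) ?o" and ?x = "icod ?A \<cdot> ?a"
    have \<theta>: "?\<theta> \<in> ar E" "src E ?\<theta> = arr_ob E ?V" "trg E ?\<theta> = arr_ob E ?V" using c\<theta> w0(4) \<rho>g(2) by simp_all
    have \<theta>0: "?a \<cdot> ?\<theta> = iunit ?A \<cdot> ?x" unfolding e0(10)[OF c\<theta>] \<rho>g(4) o(4) by (rule g(4))
    have \<theta>1: "?b \<cdot> ?\<theta> = icomp E ?A g ?b" unfolding e1(10)[OF c\<theta>] \<rho>g(5) o(5) by (rule refl)
    have x: "?x \<in> ar E" "src E ?x = arr_ob E ?V" "trg E ?x = X" using e0(1-3) mu(5) by simp_all
    obtain k0 k1 l where K: "inv_image_rel (Cat E X) u (v0, v1) = (k0, k1)" "inv_image_map (Cat E X) u (v0, v1) = l"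
      "k0 \<in> ar (Cat E X)" "k1 \<in> ar (Cat E X)" "l \<in> ar (Cat E X)" "fst k0 = fst l" "fst k1 = fst l"
      "snd (snd k0) = ?U" "snd (snd k1) = ?U" "snd (snd l) = ?V" "mor u \<cdot> mor k1 = ?b \<cdot> mor l"
      by (rule Cat_inv_image[OF ua v_rel]) blast
    have pbE: "is_pullback E (mor u) ?a (mor k0) (mor l)"
      by (rule Cat_is_pullback_mor) (use v_sat in \<open>simp only: saturated_def K fst_conv\<close>)
    note h0 = Cat_mor[OF K(3)] and h1 = Cat_mor[OF K(4)] and hl = Cat_mor[OF K(5)]
    have ix: "iunit ?U \<cdot> ?x \<in> ar E" "src E (iunit ?U \<cdot> ?x) = arr_ob E ?V" "trg E (iunit ?U \<cdot> ?x) = arr_ob E ?U"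
      "mor u \<cdot> (iunit ?U \<cdot> ?x) = iunit ?A \<cdot> ?x" using x mu(4) su(9)[of ?x] by simp_all
    \<comment> \<open>The first leg of \<open>?\<theta>\<close> is an identity and hence comes from
      \<open>U\<close>. Saturation places \<open>?\<theta>\<close> in the inverse image, so that its
      second leg comes from \<open>U\<close> as well.\<close>
    obtain h where h: "h \<in> ar E" "src E h = src E ?\<theta>" "trg E h = src E (mor k0)" "mor k0 \<cdot> h = iunit ?U \<cdot> ?x" "mor l \<cdot> h = ?\<theta>"
      by (rule is_pullback_ex[OF pbE ix(1) \<theta>(1)]) (use ix \<theta> \<theta>0 mu(2) e0(2) in simp_all)
    have kty: "src E (mor k0) = arr_ob E (fst l)" "src E (mor k1) = arr_ob E (fst l)" "trg E (mor k1) = arr_ob E ?U"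
      "src E (mor l) = arr_ob E (fst l)" "trg E (mor l) = arr_ob E ?V"
      using h0 h1 hl K by simp_all
    have uk: "mor u \<cdot> (mor k1 \<cdot> h) = icomp E ?A g ?b"
    proof -
      have "mor u \<cdot> (mor k1 \<cdot> h) = ?b \<cdot> (mor l \<cdot> h)"
        using h(1-3) kty h1(1) hl(1) mu(1,2) e1(1-3) by (simp add: cmp_reassoc[OF K(11)])
      then show ?thesis unfolding h(5) \<theta>1 .
    qed
    obtain i' where i': "i' \<in> hom (Cat E X) (src (Cat E X) k0) (src (Cat E X) s0)"
      "s0 \<bullet> i' = k0" "s1 \<bullet> i' = k1"
      using v_le unfolding K rel_le_def prod.case by blast
    have i: "i' \<in> ar (Cat E X)" "fst i' = fst l" "snd (snd i') = ?R" "mor s0 \<cdot> mor i' = mor k0" "mor s1 \<cdot> mor i' = mor k1"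
      using i'(1) arg_cong[OF i'(2), of mor] arg_cong[OF i'(3), of mor] K(6)
      by (simp_all only: hom_iff src_Cat trg_Cat cmp_Cat fst_conv snd_conv)
    note mi = Cat_mor[OF i(1)]
    have ih: "mor i' \<cdot> h \<in> ar E" "src E (mor i' \<cdot> h) = arr_ob E ?V" "trg E (mor i' \<cdot> h) = src E (mor s0)"
      "mor s0 \<cdot> (mor i' \<cdot> h) = iunit ?U \<cdot> ?x" "mor s1 \<cdot> (mor i' \<cdot> h) = mor k1 \<cdot> h"
      using mi i(2,3) h(1-3) \<theta>(2) kty f0(1-3) f1(1-3)
      by (simp_all add: cmp_reassoc[OF i(4)] cmp_reassoc[OF i(5)] h(4))
    \<comment> \<open>The inclusion in \<open>S\<close> relates the identity to the lifted
      difference, whereas \<open>T_intro\<close> has the identity as second leg; symmetry of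
      \<open>S\<close> exchanges them.\<close>
    obtain y where y: "y \<in> ar E" "src E y = src E (mor i' \<cdot> h)" "trg E y = src E (mor s0)"
      "mor s0 \<cdot> y = mor s1 \<cdot> (mor i' \<cdot> h)" "mor s1 \<cdot> y = mor s0 \<cdot> (mor i' \<cdot> h)"
      by (rule reflexive_symD[OF SE ih(1,3)])
    have y': "src E y = arr_ob E ?V" "trg E y = arr_ob E ?R" "mor s1 \<cdot> y = iunit ?U \<cdot> ?x" "mor u \<cdot> (mor s0 \<cdot> y) = icomp E ?A g ?b"
      using y ih f0(2) uk by simp_all
    have par: "idom ?A \<cdot> ?b = idom ?A \<cdot> ?a" "icod ?A \<cdot> ?b = icod ?A \<cdot> ?a" using e0(4,5) e1(4,5) by simp_all
    have gb: "composable E ?A g ?b" using g(2) gty e1(1-3) par by simp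
    have "\<exists>z. z \<in> ar E \<and> src E z = src E ?a \<and> trg E z = arr_ob E T \<and> t0 \<cdot> z = ?a \<and> t1 \<cdot> z = icomp E ?A ?a (mor u \<cdot> (mor s0 \<cdot> y))"
      by (rule T_intro[OF e0(1,3) y(1) _ y'(2) x(1) _ x(3) y'(3) refl]) (use y'(1) x(2) e0(2) in simp_all)
    then obtain z where z: "z \<in> ar E" "src E z = arr_ob E ?V" "trg E z = arr_ob E T" "t0 \<cdot> z = ?a"
      "t1 \<cdot> z = icomp E ?A ?a (icomp E ?A g ?b)" using y'(4) e0(2) by auto
    have "icomp E ?A ?a (icomp E ?A g ?b) = icomp E ?A (icomp E ?A ?a g) ?b"
      by (rule icomp_assoc[symmetric, OF mu(5) g(1) gb])
    also have "\<dots> = ?b" unfolding g(3) by (rule icomp_iunit_left[OF mu(5) e1(1,3) par(1)])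
    finally have z1: "t1 \<cdot> z = ?b" using z(5) by simp
    have "(fst v0, z, fst ?t0) \<in> ar (Cat E X)"
      by (rule Cat_liftI[OF v(1,4) v(2,5,3) ta(1) _ ta(2)]) (use z z1 tjm in \<open>simp_all del: ar_Cat\<close>)
    then have "(fst v0, z, T) \<in> hom (Cat E X) (src (Cat E X) v0) (src (Cat E X) ?t0)"
      by (simp only: hom_iff src_Cat trg_Cat fst_conv snd_conv)
    moreover have "?t0 \<bullet> (fst v0, z, T) = v0" "?t1 \<bullet> (fst v0, z, T) = v1"
      by (rule Cat_eqI; use z z1 v in simp)+
    ultimately show ?thesis unfolding T'_eq rel_le_def prod.case by blast
  qed
  ultimately show "\<exists>T. equ_candidate (Cat E X) u S T \<and> (\<forall>T'. equ_candidate (Cat E X) u S T' \<longrightarrow> rel_le (Cat E X) T' T)"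
    by blast
qed

text \<open>The equality is one of records: a full subcategory keeps all operations, and as every
  internal category is a groupoid, the restriction leaves both carriers unchanged.\<close>

lemma Cat_eq_Grd: "Cat E X = Grd E X"
proof -
  have "{A \<in> ob (Cat E X). internal_groupoid E X A} = ob (Cat E X)"
    "{f \<in> ar (Cat E X). internal_groupoid E X (src (Cat E X) f) \<and> internal_groupoid E X (trg (Cat E X) f)} = ar (Cat E X)"
    using internal_category_is_groupoid by auto
  then show ?thesis unfolding Grd_def full_subcategory_def by simp
qed

end

theorem corollary5p2:
  fixes E :: "('o, 'm) cat_data" and X :: 'o
  assumes "maltsev_category E"
    and "X \<in> ob E"
  shows "Cat E X = Grd E X \<and>
    protomodular_category (Cat E X) \<and>
    equ_saturating_category (Cat E X)"
proof -
  interpret maltsev_category E by (rule assms(1))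
  interpret maltsev_fixed_objects E X by unfold_locales (rule assms(2))
  show ?thesis using Cat_eq_Grd protomodular_Cat equ_saturating_Cat by blast
qed

end
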